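(* Let $K$ be a convex body in $\mathbb{R}^n$ with $0\in\mathrm{int}(K)$. Then, for all integers $1\leqslant k\leqslant n-1$, $$\frac{S(K)}{|K|}\leqslant\frac{n}{n-k}\,t(K)\max_{H\in G_{n,n-k}}\frac{S(K\cap H)}{|K\cap H|}.$$
   Context: A convex body in $\mathbb{R}^n$ is a compact convex set with non-empty interior; $|\cdot|$ is volume in the appropriate dimension, $B_2^n$ the Euclidean unit ball. $G_{n,s}$ is the Grassmannian of $s$-dimensional linear subspaces of $\mathbb{R}^n$. $S(A)$ denotes the surface area of a convex body $A$ in its appropriate dimension: if $A$ lies in an $m$-dimensional Euclidean space $E$ with unit ball $B_E$, then $S(A)=\lim_{t\to0^+}\frac{|A+tB_E|-|A|}{t}$ (it equals $2$ for a segment when $m=1$); $S(K\cap H)$ and $|K\cap H|$ are computed in $H$. The inradius $r(K)$ is the largest $r>0$ such that $x_0+rB_2^n\subseteq K$ for some $x_0\in K$, and $t(K)=\left(\frac{|K|}{|r(K)B_2^n|}\right)^{1/n}$. *)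

theory Defs
  imports "HOL-Analysis.Analysis"
begin

text \<open>Lebesgue measure of a linear subspace \<open>E\<close> is the image of product Lebesgue measure under
  the coordinate map of an orthonormal basis of \<open>E\<close>, in the same way as the library defines
  \<^const>\<open>lborel\<close> from the standard basis. Lemmas \<open>subspace_lborel_eq\<close> and
  \<open>subspace_lborel_UNIV\<close> below show that the basis chosen is irrelevant and that
  \<^const>\<open>lborel\<close> is recovered for the whole space.\<close>

definition orthonormal_basis_of :: "'a::euclidean_space set \<Rightarrow> 'a set \<Rightarrow> bool"
  where "orthonormal_basis_of E B \<longleftrightarrow>
    pairwise orthogonal B \<and> (\<forall>b\<in>B. norm b = 1) \<and> span B = E"

definition basis_lborel :: "'a::euclidean_space set \<Rightarrow> 'a measure"
  where "basis_lborel B = distr (\<Pi>\<^sub>M b\<in>B. lborel) borel (\<lambda>f. \<Sum>b\<in>B. f b *\<^sub>R b)"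

definition subspace_lborel :: "'a::euclidean_space set \<Rightarrow> 'a measure"
  where "subspace_lborel E = basis_lborel (SOME B. orthonormal_basis_of E B)"

abbreviation vol_in :: "'a::euclidean_space set \<Rightarrow> 'a set \<Rightarrow> real"
  where "vol_in E A \<equiv> measure (subspace_lborel E) A"

definition surface_area_in :: "'a::euclidean_space set \<Rightarrow> 'a set \<Rightarrow> real"
  where "surface_area_in E A =
    Lim (at_right 0)
      (\<lambda>t. (vol_in E {x + t *\<^sub>R u | x u. x \<in> A \<and> u \<in> cball 0 1 \<inter> E} - vol_in E A) / t)"

definition grassmannian :: "nat \<Rightarrow> 'a::euclidean_space set set"
  where "grassmannian s = {H. subspace H \<and> dim H = s}"

definition convex_body :: "'a::euclidean_space set \<Rightarrow> bool"
  where "convex_body K \<longleftrightarrow> compact K \<and> convex K \<and> interior K \<noteq> {}"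

definition inradius :: "'a::euclidean_space set \<Rightarrow> real"
  where "inradius K = (GREATEST r. 0 < r \<and> (\<exists>x\<in>K. cball x r \<subseteq> K))"

text \<open>The quantity \<open>t(K)\<close>.\<close>

definition inradius_volume_ratio :: "'a::euclidean_space set \<Rightarrow> real"
  where "inradius_volume_ratio K =
    root DIM('a) (measure lborel K / measure lborel (cball (0::'a) (inradius K)))"


lemma emeasure_orthogonal_image_open_le:
  fixes T :: "'a::euclidean_space \<Rightarrow> 'a"
  assumes T: "orthogonal_transformation T" and S: "open S"
  shows "emeasure lborel (T ` S) \<le> emeasure lborel S"
proof -
  let ?K = "{i :: 'a \<times> real. ball (fst i) (snd i) \<subseteq> S}"
  have "\<exists>i. i \<in> ?K \<and> x \<in> ball (fst i) (snd i) \<and> snd i < d" if x: "x \<in> S" and d: "0 < d" for x d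
  proof -
    obtain e where e: "e > 0" "ball x e \<subseteq> S" using S x openE by blast
    let ?r = "min e (d/2)"
    have "ball x ?r \<subseteq> ball x e" by (rule subset_ball) simp
    then have "(x, ?r) \<in> ?K \<and> x \<in> ball (fst (x, ?r)) (snd (x, ?r)) \<and> snd (x, ?r) < d"
      using e d by auto
    then show ?thesis by blast
  qed
  then obtain C where C: "countable C" "C \<subseteq> ?K"
    and dis: "pairwise (\<lambda>i j. disjnt (ball (fst i) (snd i)) (ball (fst j) (snd j))) C"
    and neg: "negligible (S - (\<Union>i\<in>C. ball (fst i) (snd i)))"
    using Vitali_covering_theorem_balls[of S ?K fst snd] by blast
  let ?U = "\<Union>i\<in>C. ball (fst i) (snd i)" and ?V = "\<Union>i\<in>C. ball (T (fst i)) (snd i)"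
  have linT: "linear T" and injT: "inj T"
    using T by (simp_all add: orthogonal_transformation_linear orthogonal_transformation_inj)
  have oTS: "open (T ` S)"
    using open_surjective_linear_image[OF S linT orthogonal_transformation_surj[OF T]] .
  have img: "ball (T (fst i)) (snd i) = T ` ball (fst i) (snd i)" for i
    by (simp add: image_orthogonal_transformation_ball[OF T])
  have TU: "T ` ?U = ?V" by (simp add: image_UN img)
  have "negligible (T ` (S - ?U))"
    by (rule negligible_differentiable_image_negligible)
       (use neg linT in \<open>auto intro: linear_imp_differentiable_on\<close>)
  then have "negligible (T ` S - ?V)"
    by (rule negligible_subset) (use TU in blast)
  moreover have sV: "?V \<in> sets lborel" by (auto intro!: borel_open)
  moreover have sTS: "T ` S \<in> sets lborel" using oTS by simp
  ultimately have null: "T ` S - ?V \<in> null_sets lborel"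
    by (simp add: negligible_iff_null_sets null_sets_completion_iff)
  have "emeasure lborel (T ` S) \<le> emeasure lborel (?V \<union> (T ` S - ?V))"
    using sV sTS by (intro emeasure_mono) auto
  also have "\<dots> = emeasure lborel ?V"
    by (rule emeasure_Un_null_set[OF sV null])
  also have "\<dots> = (\<integral>\<^sup>+i. emeasure lborel (ball (T (fst i)) (snd i)) \<partial>count_space C)"
  proof (rule emeasure_UN_countable)
    show "disjoint_family_on (\<lambda>i. ball (T (fst i)) (snd i)) C"
      using dis by (auto simp: disjoint_family_on_def pairwise_def disjnt_def img
          image_Int[OF injT, symmetric])
  qed (use C(1) in auto)
  also have "\<dots> = (\<integral>\<^sup>+i. emeasure lborel (ball (fst i) (snd i)) \<partial>count_space C)"
  proof (rule nn_integral_cong)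
    show "emeasure lborel (ball (T (fst i)) (snd i)) = emeasure lborel (ball (fst i) (snd i))" for i
      by (cases "snd i \<ge> 0") (auto simp: emeasure_ball ball_empty)
  qed
  also have "\<dots> = emeasure lborel ?U"
    using C(1) dis
    by (intro emeasure_UN_countable[symmetric])
       (auto simp: disjoint_family_on_def pairwise_def disjnt_def)
  also have "\<dots> \<le> emeasure lborel S"
    using C S by (intro emeasure_mono) auto
  finally show ?thesis .
qed

lemma distr_lborel_orthogonal:
  fixes T :: "'a::euclidean_space \<Rightarrow> 'a"
  assumes T: "orthogonal_transformation T"
  shows "distr lborel borel T = lborel"
proof (rule lborel_eqI[symmetric])
  have linT: "linear T" using T by (simp add: orthogonal_transformation_linear)
  have [measurable]: "T \<in> borel \<rightarrow>\<^sub>M borel"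
    using linT by (intro borel_measurable_continuous_onI linear_continuous_on)
                  (simp add: linear_conv_bounded_linear)
  have bT: "bij T" using T by (rule orthogonal_transformation_bij)
  have T': "orthogonal_transformation (inv T)" using T by (rule orthogonal_transformation_inv)
  fix l u :: 'a assume le: "\<And>b. b \<in> Basis \<Longrightarrow> l \<bullet> b \<le> u \<bullet> b"
  have vim: "T -` box l u = inv T ` box l u" using bT by (simp add: bij_vimage_eq_inv_image)
  have oi: "open (inv T ` box l u)"
    using open_surjective_linear_image[OF open_box orthogonal_transformation_linear[OF T']
        orthogonal_transformation_surj[OF T']] .
  have "emeasure lborel (inv T ` box l u) = emeasure lborel (box l u)"
  proof (rule antisym)
    show "emeasure lborel (inv T ` box l u) \<le> emeasure lborel (box l u)"
      by (rule emeasure_orthogonal_image_open_le[OF T' open_box])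
    have "T ` inv T ` box l u = box l u"
      using bT by (simp add: image_f_inv_f bij_is_surj)
    then show "emeasure lborel (box l u) \<le> emeasure lborel (inv T ` box l u)"
      using emeasure_orthogonal_image_open_le[OF T oi] by simp
  qed
  then show "emeasure (distr lborel borel T) (box l u) = (\<Prod>b\<in>Basis. (u - l) \<bullet> b)"
    using le by (subst emeasure_distr) (simp_all add: vim)
qed simp

lemma orthonormal_basis_of_facts:
  assumes "orthonormal_basis_of E B"
  shows "finite B" "independent B" "card B = dim E" "B \<subseteq> E"
    "\<And>b c. b \<in> B \<Longrightarrow> c \<in> B \<Longrightarrow> b \<bullet> c = (if b = c then 1 else 0)"
proof -
  have 0: "0 \<notin> B" using assms by (auto simp: orthonormal_basis_of_def)
  show i: "independent B"
    using assms 0 by (simp add: orthonormal_basis_of_def pairwise_orthogonal_independent)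
  then show "finite B" by (rule independent_imp_finite)
  show "card B = dim E" using assms i by (metis dim_span_eq_card_independent orthonormal_basis_of_def)
  show "B \<subseteq> E" using assms by (auto simp: orthonormal_basis_of_def span_base)
  show "\<And>b c. b \<in> B \<Longrightarrow> c \<in> B \<Longrightarrow> b \<bullet> c = (if b = c then 1 else 0)"
    using assms by (auto simp: orthonormal_basis_of_def pairwise_def orthogonal_def norm_eq_1)
qed

lemma basis_lborel_UNIV:
  fixes B :: "'a::euclidean_space set"
  assumes B: "orthonormal_basis_of UNIV B"
  shows "basis_lborel B = lborel"
proof -
  note o = orthonormal_basis_of_facts[OF B]
  have "card (Basis::'a set) = card B" using o by (simp add: dim_UNIV)
  then obtain g where g: "bij_betw g (Basis::'a set) B"
    using o(1) finite_same_card_bij finite_Basis by metis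
  have gB: "g i \<in> B" if "i \<in> Basis" for i using g that by (auto simp: bij_betw_def)
  have gi: "g i = g j \<longleftrightarrow> i = j" if "i \<in> Basis" "j \<in> Basis" for i j
    using g that by (auto simp: bij_betw_def inj_on_def)
  define T where "T x = (\<Sum>i\<in>Basis. (x \<bullet> i) *\<^sub>R g i)" for x
  have "linear T"
    unfolding T_def by (auto intro!: linearI simp: inner_add_left scaleR_add_left sum.distrib
        scaleR_sum_right)
  moreover have "T v \<bullet> T w = v \<bullet> w" for v w
    unfolding T_def
    by (simp add: inner_sum_left inner_sum_right o(5) gB gi if_distrib sum.delta cong: if_cong)
       (simp add: euclidean_inner[of v w] mult.commute)
  ultimately have T: "orthogonal_transformation T"
    by (simp add: orthogonal_transformation_def)
  interpret P: product_sigma_finite "\<lambda>_::'a. lborel :: real measure" ..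
  have [measurable]: "(\<lambda>f. \<Sum>b\<in>B. f b *\<^sub>R b) \<in> (\<Pi>\<^sub>M b\<in>B. lborel) \<rightarrow>\<^sub>M borel"
    by measurable
  have m: "(\<lambda>f. \<lambda>i\<in>Basis. f (g i)) \<in> (\<Pi>\<^sub>M b\<in>B. lborel) \<rightarrow>\<^sub>M (\<Pi>\<^sub>M b\<in>Basis. (lborel::real measure))"
    by (intro measurable_restrict measurable_component_singleton gB)
  have re: "distr (\<Pi>\<^sub>M b\<in>B. lborel) (\<Pi>\<^sub>M b\<in>Basis. lborel) (\<lambda>f. \<lambda>i\<in>Basis. f (g i))
      = (\<Pi>\<^sub>M b\<in>Basis. (lborel::real measure))"
  proof (rule P.PiM_eqI)
    fix A :: "'a \<Rightarrow> real set" assume A: "\<And>i. i \<in> Basis \<Longrightarrow> A i \<in> sets lborel"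
    let ?h = "inv_into Basis g"
    have h: "?h b \<in> Basis" "g (?h b) = b" if "b \<in> B" for b
      using that g by (metis bij_betw_imp_surj_on inv_into_into f_inv_into_f)+
    have hg: "?h (g i) = i" if "i \<in> Basis" for i using that g by (simp add: bij_betw_def)
    have eq: "(\<lambda>f. \<lambda>i\<in>Basis. f (g i)) -` (Pi\<^sub>E Basis A) \<inter> space (\<Pi>\<^sub>M b\<in>B. (lborel::real measure))
      = (\<Pi>\<^sub>E b\<in>B. A (?h b))"
      using h hg gB by (auto simp: space_PiM PiE_iff) (metis h hg gB)+
    have "emeasure (distr (\<Pi>\<^sub>M b\<in>B. lborel) (\<Pi>\<^sub>M b\<in>Basis. lborel) (\<lambda>f. \<lambda>i\<in>Basis. f (g i))) (Pi\<^sub>E Basis A)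
        = (\<Prod>b\<in>B. emeasure lborel (A (?h b)))"
      using A h o(1) m by (subst emeasure_distr) (auto simp: eq P.emeasure_PiM intro!: sets_PiM_I_finite)
    also have "\<dots> = (\<Prod>i\<in>Basis. emeasure lborel (A i))"
      by (subst prod.reindex_bij_betw[OF g, symmetric]) (simp add: hg)
    finally show "emeasure (distr (\<Pi>\<^sub>M b\<in>B. lborel) (\<Pi>\<^sub>M b\<in>Basis. lborel) (\<lambda>f. \<lambda>i\<in>Basis. f (g i))) (Pi\<^sub>E Basis A)
        = (\<Prod>i\<in>Basis. emeasure lborel (A i))" .
  qed simp_all
  have [measurable]: "T \<in> borel \<rightarrow>\<^sub>M borel"
    unfolding T_def by measurable
  have "lborel = distr lborel borel T" by (simp add: distr_lborel_orthogonal[OF T])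
  also have "\<dots> = distr (\<Pi>\<^sub>M b\<in>Basis. lborel) borel (T \<circ> (\<lambda>f. \<Sum>b\<in>Basis. f b *\<^sub>R b))"
    by (subst lborel_eq) (subst distr_distr, auto)
  also have "\<dots> = distr (\<Pi>\<^sub>M b\<in>B. lborel) borel
      ((T \<circ> (\<lambda>f. \<Sum>b\<in>Basis. f b *\<^sub>R b)) \<circ> (\<lambda>f. \<lambda>i\<in>Basis. f (g i)))"
    by (subst re[symmetric]) (subst distr_distr, use m in auto)
  also have "\<dots> = basis_lborel B"
  proof -
    have "((T \<circ> (\<lambda>f. \<Sum>b\<in>Basis. f b *\<^sub>R b)) \<circ> (\<lambda>f. \<lambda>i\<in>Basis. f (g i))) f
        = (\<Sum>b\<in>B. f b *\<^sub>R b)" for f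
    proof -
      have "((T \<circ> (\<lambda>f. \<Sum>b\<in>Basis. f b *\<^sub>R b)) \<circ> (\<lambda>f. \<lambda>i\<in>Basis. f (g i))) f
          = (\<Sum>i\<in>Basis. f (g i) *\<^sub>R g i)"
        by (simp add: T_def inner_sum_left inner_Basis if_distrib sum.delta cong: if_cong)
      also have "\<dots> = (\<Sum>b\<in>B. f b *\<^sub>R b)"
        by (rule sum.reindex_bij_betw[OF g])
      finally show ?thesis .
    qed
    then show ?thesis unfolding basis_lborel_def by (metis (no_types, lifting) distr_cong)
  qed
  finally show ?thesis by simp
qed

lemma emeasure_basis_lborel_cylinder:
  fixes B C :: "'a::euclidean_space set"
  assumes B: "orthonormal_basis_of E B" and BC: "orthonormal_basis_of UNIV (B \<union> C)"
    and dis: "B \<inter> C = {}" and A: "A \<in> sets borel"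
  shows "emeasure (basis_lborel B) A =
    emeasure lborel {x. (\<Sum>b\<in>B. (x \<bullet> b) *\<^sub>R b) \<in> A \<and> (\<forall>c\<in>C. x \<bullet> c \<in> {0..1})}"
proof -
  let ?D = "{x. (\<Sum>b\<in>B. (x \<bullet> b) *\<^sub>R b) \<in> A \<and> (\<forall>c\<in>C. x \<bullet> c \<in> {0..1})}"
  note o = orthonormal_basis_of_facts[OF BC]
  have fin: "finite B" "finite C" using o(1) by auto
  interpret P: product_sigma_finite "\<lambda>_::'a. lborel :: real measure" ..
  interpret fB: finite_product_sigma_finite "\<lambda>_::'a. lborel :: real measure" B by standard (rule fin)
  interpret fC: finite_product_sigma_finite "\<lambda>_::'a. lborel :: real measure" C by standard (rule fin)
  note A[measurable]
  have [measurable]: "(\<lambda>f. \<Sum>b\<in>B. f b *\<^sub>R b) \<in> (\<Pi>\<^sub>M b\<in>B. lborel) \<rightarrow>\<^sub>M borel" by measurable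
  have m: "(\<lambda>f. \<Sum>b\<in>B\<union>C. f b *\<^sub>R b) \<in> (\<Pi>\<^sub>M b\<in>B\<union>C. lborel) \<rightarrow>\<^sub>M borel" by measurable
  have sC: "countable C" using fin by (simp add: countable_finite)
  have D: "?D \<in> sets borel"
    using sC by measurable
  let ?S = "(\<lambda>f. \<Sum>b\<in>B. f b *\<^sub>R b) -` A \<inter> space (\<Pi>\<^sub>M b\<in>B. (lborel::real measure))"
  have mm: "(\<lambda>f. \<Sum>b\<in>B\<union>C. f b *\<^sub>R b) \<circ> merge B C \<in>
      ((\<Pi>\<^sub>M b\<in>B. lborel) \<Otimes>\<^sub>M (\<Pi>\<^sub>M b\<in>C. lborel)) \<rightarrow>\<^sub>M borel"
    by (rule measurable_comp[OF measurable_merge m])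
  have "emeasure lborel ?D = emeasure (basis_lborel (B \<union> C)) ?D"
    by (simp add: basis_lborel_UNIV[OF BC])
  also have "\<dots> = emeasure (distr ((\<Pi>\<^sub>M b\<in>B. lborel) \<Otimes>\<^sub>M (\<Pi>\<^sub>M b\<in>C. lborel)) borel
      ((\<lambda>f. \<Sum>b\<in>B\<union>C. f b *\<^sub>R b) \<circ> merge B C)) ?D"
    unfolding basis_lborel_def
    by (subst P.distr_merge[OF dis fin, symmetric]) (subst distr_distr[OF m measurable_merge], simp)
  also have "\<dots> = emeasure ((\<Pi>\<^sub>M b\<in>B. lborel) \<Otimes>\<^sub>M (\<Pi>\<^sub>M b\<in>C. lborel))
      (((\<lambda>f. \<Sum>b\<in>B\<union>C. f b *\<^sub>R b) \<circ> merge B C) -` ?D \<inter>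
        space ((\<Pi>\<^sub>M b\<in>B. (lborel::real measure)) \<Otimes>\<^sub>M (\<Pi>\<^sub>M b\<in>C. (lborel::real measure))))"
    using mm D by (simp add: emeasure_distr)
  also have "(((\<lambda>f. \<Sum>b\<in>B\<union>C. f b *\<^sub>R b) \<circ> merge B C) -` ?D \<inter>
        space ((\<Pi>\<^sub>M b\<in>B. (lborel::real measure)) \<Otimes>\<^sub>M (\<Pi>\<^sub>M b\<in>C. (lborel::real measure))))
      = ?S \<times> (\<Pi>\<^sub>E c\<in>C. {0..1::real})"
  proof -
    have coord: "(\<Sum>b\<in>B\<union>C. h b *\<^sub>R b) \<bullet> d = h d" if "d \<in> B \<union> C" for h d
      using that fin by (simp add: inner_sum_left o(5) if_distrib sum.delta cong: if_cong)
    have "((\<lambda>f. \<Sum>b\<in>B\<union>C. f b *\<^sub>R b) \<circ> merge B C) (f, k) \<in> ?D \<longleftrightarrow>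
        (\<Sum>b\<in>B. f b *\<^sub>R b) \<in> A \<and> (\<forall>c\<in>C. k c \<in> {0..1})" for f k
    proof -
      have 1: "(\<Sum>b\<in>B. ((\<Sum>b\<in>B\<union>C. merge B C (f, k) b *\<^sub>R b) \<bullet> b) *\<^sub>R b) = (\<Sum>b\<in>B. f b *\<^sub>R b)"
        by (intro sum.cong) (auto simp: coord merge_def)
      have 2: "(\<Sum>b\<in>B\<union>C. merge B C (f, k) b *\<^sub>R b) \<bullet> c = k c" if "c \<in> C" for c
        using that dis by (subst coord) (auto simp: merge_def)
      show ?thesis by (simp only: comp_def mem_Collect_eq 1) (use 2 in auto)
    qed
    then show ?thesis
      unfolding space_pair_measure space_PiM space_lborel space_borel
      by (intro set_eqI; clarify) (simp only: vimage_eq Int_iff mem_Times_iff fst_conv snd_conv PiE_UNIV_domain PiE_iff, auto)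
  qed
  also have "emeasure ((\<Pi>\<^sub>M b\<in>B. lborel) \<Otimes>\<^sub>M (\<Pi>\<^sub>M b\<in>C. lborel)) (?S \<times> (\<Pi>\<^sub>E c\<in>C. {0..1::real}))
      = emeasure (\<Pi>\<^sub>M b\<in>B. lborel) ?S * emeasure (\<Pi>\<^sub>M b\<in>C. lborel) (\<Pi>\<^sub>E c\<in>C. {0..1::real})"
  proof (rule sigma_finite_measure.emeasure_pair_measure_Times)
    show "sigma_finite_measure (\<Pi>\<^sub>M b\<in>C. (lborel::real measure))"
      by (rule fC.sigma_finite_measure_axioms)
    show "?S \<in> sets (\<Pi>\<^sub>M b\<in>B. lborel)" by measurable
    show "(\<Pi>\<^sub>E c\<in>C. {0..1::real}) \<in> sets (\<Pi>\<^sub>M b\<in>C. lborel)"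
      using fin by (auto intro!: sets_PiM_I_finite)
  qed
  also have "emeasure (\<Pi>\<^sub>M b\<in>C. lborel) (\<Pi>\<^sub>E c\<in>C. {0..1::real}) = 1"
    using fin by (subst P.emeasure_PiM) auto
  finally show ?thesis
    by (simp add: basis_lborel_def emeasure_distr)
qed

lemma basis_lborel_unique:
  assumes B: "orthonormal_basis_of E B" and B': "orthonormal_basis_of E B'"
  shows "basis_lborel B = basis_lborel B'"
proof (rule measure_eqI)
  obtain C where C: "pairwise orthogonal C" "\<And>x. x \<in> C \<Longrightarrow> norm x = 1" "span C = E\<^sup>\<bottom>"
    using orthonormal_basis_subspace[OF subspace_orthogonal_comp] by metis
  have sub: "subspace E" using B by (auto simp: orthonormal_basis_of_def)
  have CE: "C \<subseteq> E\<^sup>\<bottom>" using C(3) span_superset by blast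
  have ex: "orthonormal_basis_of UNIV (D \<union> C)" "D \<inter> C = {}" if D: "orthonormal_basis_of E D" for D
  proof -
    have orth: "orthogonal d c" if "d \<in> D" "c \<in> C" for c d
      using that CE orthonormal_basis_of_facts(4)[OF D] by (auto simp: orthogonal_comp_def)
    then show "D \<inter> C = {}" using C(2) by (force simp: orthogonal_def)
    have "span (D \<union> C) = UNIV"
      using subspace_sum_orthogonal_comp[OF sub] D C(3)
      by (simp add: span_Un orthonormal_basis_of_def set_plus_def) blast
    then show "orthonormal_basis_of UNIV (D \<union> C)"
      using orth C D unfolding orthonormal_basis_of_def pairwise_def
      by (metis Un_iff orthogonal_commute)
  qed
  have proj: "(\<Sum>b\<in>B. (x \<bullet> b) *\<^sub>R b) = (\<Sum>b\<in>B'. (x \<bullet> b) *\<^sub>R b)" for x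
  proof -
    have key: "y \<in> E \<and> x - y \<in> E\<^sup>\<bottom>"
      if D: "orthonormal_basis_of E D" and y: "y = (\<Sum>b\<in>D. (x \<bullet> b) *\<^sub>R b)" for D y
    proof
      note o = orthonormal_basis_of_facts[OF D]
      show "y \<in> E" unfolding y using o(4) sub by (intro subspace_sum subspace_scale) auto
      have "orthogonal (x - y) d" if "d \<in> D" for d
        using that o(1) unfolding y
        by (simp add: orthogonal_def inner_diff_left inner_sum_left o(5) if_distrib sum.delta cong: if_cong)
      then have "orthogonal (x - y) e" if "e \<in> span D" for e
        using that orthogonal_to_span by blast
      then show "x - y \<in> E\<^sup>\<bottom>" using D by (simp add: orthonormal_basis_of_def orthogonal_comp_def orthogonal_commute)
    qed
    let ?y = "\<Sum>b\<in>B. (x \<bullet> b) *\<^sub>R b" and ?z = "\<Sum>b\<in>B'. (x \<bullet> b) *\<^sub>R b"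
    have "?y - ?z \<in> E" using key[OF B refl] key[OF B' refl] sub subspace_diff by blast
    moreover have "(x - ?z) - (x - ?y) \<in> E\<^sup>\<bottom>"
      using key[OF B refl] key[OF B' refl] subspace_orthogonal_comp subspace_diff by blast
    then have "?y - ?z \<in> E\<^sup>\<bottom>" by simp
    ultimately have "orthogonal (?y - ?z) (?y - ?z)" by (auto simp: orthogonal_comp_def)
    then show ?thesis by (simp add: orthogonal_self)
  qed
  show "sets (basis_lborel B) = sets (basis_lborel B')" by (simp add: basis_lborel_def)
  fix A assume "A \<in> sets (basis_lborel B)"
  then have A: "A \<in> sets borel" by (simp add: basis_lborel_def)
  show "emeasure (basis_lborel B) A = emeasure (basis_lborel B') A"
    using emeasure_basis_lborel_cylinder[OF B ex[OF B] A]
      emeasure_basis_lborel_cylinder[OF B' ex[OF B'] A] proj by simp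
qed

lemma subspace_lborel_eq:
  assumes "orthonormal_basis_of E B"
  shows "subspace_lborel E = basis_lborel B"
  unfolding subspace_lborel_def using assms by (metis someI basis_lborel_unique)

lemma subspace_lborel_UNIV: "subspace_lborel (UNIV :: 'a::euclidean_space set) = lborel"
proof -
  obtain B :: "'a set" where "pairwise orthogonal B" "\<And>x. x \<in> B \<Longrightarrow> norm x = 1" "span B = UNIV"
    using orthonormal_basis_subspace[OF subspace_UNIV] by metis
  then have B: "orthonormal_basis_of UNIV B" by (simp add: orthonormal_basis_of_def)
  show ?thesis by (simp add: subspace_lborel_eq[OF B] basis_lborel_UNIV[OF B])
qed

end

theory Submission
  imports Defs
begin

text \<open>
  Let \<open>n = CARD('n)\<close>, \<open>m = n - k\<close>, let \<open>r\<close> be the inradius of \<open>K\<close> and let \<open>\<rho>\<close> be the radius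
  of the ball with the volume of \<open>K\<close>. Then \<open>t(K) = \<rho> / r\<close>, and the theorem compares two
  estimates.

  On the one hand, the surface area of \<open>K\<close> divided by its volume is at most \<open>n / r\<close>
  (\<open>surface_area_le_of_inball\<close>), because \<open>K + t B\<close> fits into a translate of
  \<open>(1 + t / r) K\<close>. On the other hand some sections have ratio almost \<open>m / \<rho>\<close> or more. Indeed, by the
  isoperimetric inequality in \<open>H\<close> the ratio is at least \<open>m / R\<close>, where \<open>R\<close> is the radius of the
  ball in \<open>H\<close> with the volume of the section, and there are sections whose \<open>R\<close> is at most
  \<open>\<rho>\<close>, up to a factor arbitrarily close to 1 (\<open>ex_section_volume_le\<close>). The largest ratio is therefore
  at least \<open>m / \<rho>\<close>, and \<open>n / r = (n / m) * (\<rho> / r) * (m / \<rho>)\<close>.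

  Small sections are found by averaging. Replace the sections by thin slabs
  \<open>{x. 0 \<le> U\<^sub>i \<bullet> x \<le> \<epsilon>}\<close>, \<open>i \<in> I\<close>, where the rows of the matrix \<open>U\<close> range over a rotation
  invariant compact set of positive Lebesgue measure. By Fubini the average volume of \<open>K\<close> in such a slab is the
  integral over \<open>K\<close> of a radially decreasing density, which among bodies of given volume is
  largest for the centred ball. Hence some slab cuts no more from \<open>K\<close> than from the ball, and for a
  thin slab this passes to the section (\<open>section_volume_le_of_slab_volume_le\<close>).

  The limit that defines surface area is controlled through the shells around a convex set \<open>A\<close>.
  Shifting along outer normals expands distances, so
  \<open>W t = |A + t B| - |A|\<close> is superadditive and \<open>W t / t\<close> tends to its infimum
  (\<open>surface_area_in_facts\<close>). Thus surface area exists and is an infimum of quantities that depend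
  continuously on the section. It is upper semicontinuous, and by compactness of the orthogonal
  group the maximum over sections is attained (\<open>section_surface_ratio_attains_max\<close>).

  The isoperimetric inequality only requires the Brunn--Minkowski inequality for midpoints, which
  comes from the Prekopa--Leindler inequality by induction on the number of coordinates. Contraction and
  midpoint estimates pass to a subspace through cylinders, whose volume is that of their base.
\<close>

section \<open>The midpoint Prekopa--Leindler inequality\<close>

lemma emeasure_lborel_affine_vimage:
  fixes X :: "real set"
  assumes [measurable]: "X \<in> sets borel"
  shows "emeasure lborel X = 2 * emeasure lborel {z. 2 * z - t \<in> X}"
proof -
  have "emeasure lborel X = (\<integral>\<^sup>+x. indicator X x \<partial>lborel)" by simp
  also have "\<dots> = ennreal \<bar>2\<bar> * (\<integral>\<^sup>+x. indicator X (-t + 2 * x) \<partial>lborel)"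
    by (rule nn_integral_real_affine) auto
  also have "(\<lambda>x. indicator X (-t + 2 * x)) = (indicator {z. 2 * z - t \<in> X} :: real \<Rightarrow> ennreal)"
    by (auto simp: indicator_def fun_eq_iff algebra_simps)
  finally show ?thesis by (simp add: nn_integral_indicator)
qed

text \<open>With \<open>x0\<close> almost at the supremum of \<open>X\<close> and \<open>y0\<close> almost at the infimum of
  \<open>Y\<close>, the midpoints of \<open>y0\<close> with points of \<open>X\<close> below \<open>x0\<close> lie to the left of
  \<open>(x0 + y0) / 2\<close>, and those of \<open>x0\<close> with points of \<open>Y\<close> above \<open>y0\<close> lie to the right.
  These two half-size copies overlap in at most one point.\<close>

lemma emeasure_midpoints_bounded:
  fixes X Y Z :: "real set"
  assumes [measurable]: "X \<in> sets borel" "Y \<in> sets borel" "Z \<in> sets borel"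
    and ne: "X \<noteq> {}" "Y \<noteq> {}" and bdd: "bdd_above X" "bdd_below Y"
    and mid: "\<And>x y. x \<in> X \<Longrightarrow> y \<in> Y \<Longrightarrow> (x + y) / 2 \<in> Z"
  shows "emeasure lborel X + emeasure lborel Y \<le> 2 * emeasure lborel Z"
proof (rule ennreal_le_epsilon)
  fix e :: real assume e: "0 < e"
  obtain x0 where x0: "x0 \<in> X" "Sup X - e/2 < x0"
    using less_cSup_iff[OF ne(1) bdd(1), of "Sup X - e/2"] e by auto
  obtain y0 where y0: "y0 \<in> Y" "y0 < Inf Y + e/2"
    using cInf_less_iff[OF ne(2) bdd(2), of "Inf Y + e/2"] e by auto
  let ?X = "X \<inter> {..x0}" and ?Y = "Y \<inter> {y0..}"
  let ?U = "{z. 2 * z - y0 \<in> ?X}" and ?V = "{z. 2 * z - x0 \<in> ?Y}"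
  have [measurable]: "?U \<in> sets borel" "?V \<in> sets borel" by measurable
  have "emeasure lborel X \<le> emeasure lborel (?X \<union> {x0..x0 + e/2})"
  proof (rule emeasure_mono)
    show "X \<subseteq> ?X \<union> {x0..x0 + e/2}"
      using cSup_upper[OF _ bdd(1)] x0(2) by fastforce
  qed simp
  also have "\<dots> \<le> emeasure lborel ?X + emeasure lborel {x0..x0 + e/2}"
    by (rule emeasure_subadditive) auto
  finally have 1: "emeasure lborel X \<le> emeasure lborel ?X + ennreal (e/2)" using e by simp
  have "emeasure lborel Y \<le> emeasure lborel (?Y \<union> {y0 - e/2..y0})"
  proof (rule emeasure_mono)
    show "Y \<subseteq> ?Y \<union> {y0 - e/2..y0}"
      using cInf_lower[OF _ bdd(2)] y0(2) by fastforce
  qed simp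
  also have "\<dots> \<le> emeasure lborel ?Y + emeasure lborel {y0 - e/2..y0}"
    by (rule emeasure_subadditive) auto
  finally have 2: "emeasure lborel Y \<le> emeasure lborel ?Y + ennreal (e/2)" using e by simp
  have "emeasure lborel ?X + emeasure lborel ?Y = 2 * (emeasure lborel ?U + emeasure lborel ?V)"
    by (simp add: emeasure_lborel_affine_vimage[of ?X y0] emeasure_lborel_affine_vimage[of ?Y x0]
        distrib_left)
  also have "emeasure lborel ?U = emeasure lborel (?U - {(x0 + y0)/2})"
    by (rule sym, rule emeasure_Diff_null_set) auto
  also have "emeasure lborel (?U - {(x0 + y0)/2}) + emeasure lborel ?V
      = emeasure lborel ((?U - {(x0 + y0)/2}) \<union> ?V)"
    by (rule plus_emeasure) (auto simp: field_simps)
  also have "\<dots> \<le> emeasure lborel Z"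
  proof (rule emeasure_mono)
    show "(?U - {(x0 + y0)/2}) \<union> ?V \<subseteq> Z"
    proof -
      have "z \<in> Z" if "2 * z - y0 \<in> X" for z using mid[of "2*z-y0" y0] y0 that by simp
      moreover have "z \<in> Z" if "2 * z - x0 \<in> Y" for z using mid[of x0 "2*z-x0"] x0 that by simp
      ultimately show ?thesis by auto
    qed
  qed simp
  finally have 3: "emeasure lborel ?X + emeasure lborel ?Y \<le> 2 * emeasure lborel Z"
    by (simp add: mult_left_mono)
  have "emeasure lborel X + emeasure lborel Y \<le>
      (emeasure lborel ?X + ennreal (e/2)) + (emeasure lborel ?Y + ennreal (e/2))"
    using 1 2 by (rule add_mono)
  also have "\<dots> = (emeasure lborel ?X + emeasure lborel ?Y) + (ennreal (e/2) + ennreal (e/2))"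
    by (simp add: ac_simps)
  also have "ennreal (e/2) + ennreal (e/2) = ennreal e"
    using e by (simp flip: ennreal_plus)
  finally show "emeasure lborel X + emeasure lborel Y \<le> 2 * emeasure lborel Z + ennreal e"
    using 3 by (meson add_right_mono order_trans)
qed

lemma emeasure_midpoints_real:
  fixes X Y Z :: "real set"
  assumes [measurable]: "X \<in> sets borel" "Y \<in> sets borel" "Z \<in> sets borel"
    and ne: "X \<noteq> {}" "Y \<noteq> {}"
    and mid: "\<And>x y. x \<in> X \<Longrightarrow> y \<in> Y \<Longrightarrow> (x + y) / 2 \<in> Z"
  shows "emeasure lborel X + emeasure lborel Y \<le> 2 * emeasure lborel Z"
proof -
  obtain x0 y0 where xy: "x0 \<in> X" "y0 \<in> Y" using ne by auto
  define C where "C n = {- real n..real n}" for n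
  have [measurable]: "C n \<in> sets borel" for n by (simp add: C_def)
  have inc: "incseq (\<lambda>n. S \<inter> C n)" for S :: "real set" by (auto simp: incseq_def C_def)
  have un: "(\<Union>n. S \<inter> C n) = S" for S :: "real set"
  proof -
    have "\<exists>n. x \<in> C n" for x
    proof -
      obtain n where "\<bar>x\<bar> \<le> real n" using real_arch_simple by blast
      then show ?thesis by (intro exI[of _ n]) (auto simp: C_def)
    qed
    then show ?thesis by auto
  qed
  have lim: "(\<lambda>n. emeasure lborel (S \<inter> C n)) \<longlonglongrightarrow> emeasure lborel S" if [measurable]: "S \<in> sets borel" for S
  proof -
    have "range (\<lambda>n. S \<inter> C n) \<subseteq> sets lborel" by auto
    from Lim_emeasure_incseq[OF this inc] show ?thesis by (simp only: un)
  qed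
  have "(\<lambda>n. emeasure lborel (X \<inter> C n) + emeasure lborel (Y \<inter> C n))
      \<longlonglongrightarrow> emeasure lborel X + emeasure lborel Y"
    by (intro tendsto_add lim) auto
  then show ?thesis
  proof (rule LIMSEQ_le_const2)
    obtain N where N: "\<bar>x0\<bar> + \<bar>y0\<bar> \<le> real N" using real_arch_simple by blast
    have "emeasure lborel (X \<inter> C n) + emeasure lborel (Y \<inter> C n) \<le> 2 * emeasure lborel Z"
      if "N \<le> n" for n
    proof (rule emeasure_midpoints_bounded)
      have "x0 \<in> C n" "y0 \<in> C n" using N that by (auto simp: C_def)
      then show "X \<inter> C n \<noteq> {}" "Y \<inter> C n \<noteq> {}" using xy by auto
      show "bdd_above (X \<inter> C n)" by (rule bdd_aboveI[of _ "real n"]) (auto simp: C_def)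
      show "bdd_below (Y \<inter> C n)" by (rule bdd_belowI[of _ "- real n"]) (auto simp: C_def)
    qed (use mid in auto)
    then show "\<exists>N. \<forall>n\<ge>N. emeasure lborel (X \<inter> C n) + emeasure lborel (Y \<inter> C n)
        \<le> 2 * emeasure lborel Z" by blast
  qed
qed

lemma borel_measurable_level_measure:
  fixes f :: "real \<Rightarrow> ennreal"
  assumes f: "f \<in> borel_measurable borel"
  shows "(\<lambda>s. emeasure lborel {x. 0 < s \<and> ennreal (a * s) < f x}) \<in> borel_measurable borel"
proof -
  note f[measurable]
  have "{p \<in> space (lborel \<Otimes>\<^sub>M lborel). 0 < fst p \<and> ennreal (a * fst p) < f (snd p)}
      \<in> sets (lborel \<Otimes>\<^sub>M lborel)"
    by measurable
  from lborel.measurable_emeasure_Pair[OF this] show ?thesis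
    by (simp add: vimage_def space_pair_measure)
qed

text \<open>The layer-cake formula after the substitution \<open>t = a * s\<close>. With \<open>a\<close> the supremum of
  \<open>f\<close>, the levels of different functions are all indexed by the same interval \<open>s \<in> {0<..<1}\<close>.\<close>

lemma nn_integral_layer_cake_scaled:
  fixes f :: "real \<Rightarrow> ennreal"
  assumes [measurable]: "f \<in> borel_measurable borel" and a: "0 < a"
  shows "(\<integral>\<^sup>+x. f x \<partial>lborel)
    = ennreal a * (\<integral>\<^sup>+s. emeasure lborel {x. 0 < s \<and> ennreal (a * s) < f x} \<partial>lborel)"
proof -
  have len: "emeasure lborel {t. 0 < t \<and> ennreal t < z} = z" for z
  proof (cases z)
    case (real r)
    then have "{t. 0 < t \<and> ennreal t < z} = {0<..<r}" by (auto simp: ennreal_less_iff)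
    then show ?thesis using real by simp
  next
    case top
    then have "{t. 0 < t \<and> ennreal t < z} = {0<..}" by auto
    moreover have "emeasure lborel {0::real<..} = \<infinity>"
    proof -
      have "ennreal (real n) \<le> emeasure lborel {0::real<..}" for n
      proof -
        have "emeasure lborel {0<..<real n} \<le> emeasure lborel {0::real<..}"
          by (intro emeasure_mono) auto
        then show ?thesis by simp
      qed
      then show ?thesis
        by (metis SUP_least ennreal_SUP_of_nat_eq_top top.extremum_uniqueI infinity_ennreal_def
            ennreal_of_nat_eq_real_of_nat)
    qed
    ultimately show ?thesis using top by simp
  qed
  have "(\<integral>\<^sup>+x. f x \<partial>lborel) = (\<integral>\<^sup>+x. \<integral>\<^sup>+t. indicator {t. 0 < t \<and> ennreal t < f x} t \<partial>lborel \<partial>lborel)"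
    by (subst nn_integral_indicator) (auto simp: len)
  also have "\<dots> = (\<integral>\<^sup>+x. \<integral>\<^sup>+t. indicator {p. 0 < snd p \<and> ennreal (snd p) < f (fst p)} (x, t) \<partial>lborel \<partial>lborel)"
    by (simp add: indicator_def)
  also have "\<dots> = (\<integral>\<^sup>+t. \<integral>\<^sup>+x. indicator {p. 0 < snd p \<and> ennreal (snd p) < f (fst p)} (x, t) \<partial>lborel \<partial>lborel)"
  proof (rule lborel_pair.Fubini'[symmetric])
    show "(\<lambda>(x, y). indicator {p. 0 < snd p \<and> ennreal (snd p) < f (fst p)} (x, y))
      \<in> borel_measurable (lborel \<Otimes>\<^sub>M lborel)"
      by measurable
  qed
  also have "\<dots> = (\<integral>\<^sup>+t. emeasure lborel {x. 0 < t \<and> ennreal t < f x} \<partial>lborel)"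
  proof (rule nn_integral_cong)
    fix t
    have "(\<integral>\<^sup>+x. indicator {p. 0 < snd p \<and> ennreal (snd p) < f (fst p)} (x, t) \<partial>lborel)
      = (\<integral>\<^sup>+x. indicator {x. 0 < t \<and> ennreal t < f x} x \<partial>lborel)"
      by (simp add: indicator_def)
    also have "\<dots> = emeasure lborel {x. 0 < t \<and> ennreal t < f x}"
      by (rule nn_integral_indicator) simp
    finally show "(\<integral>\<^sup>+x. indicator {p. 0 < snd p \<and> ennreal (snd p) < f (fst p)} (x, t) \<partial>lborel)
      = emeasure lborel {x. 0 < t \<and> ennreal t < f x}" .
  qed
  also have "\<dots> = ennreal \<bar>a\<bar> * (\<integral>\<^sup>+s. emeasure lborel {x. 0 < 0 + a * s \<and> ennreal (0 + a * s) < f x} \<partial>lborel)"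
  proof (rule nn_integral_real_affine)
    show "(\<lambda>t. emeasure lborel {x. 0 < t \<and> ennreal t < f x}) \<in> borel_measurable borel"
      using borel_measurable_level_measure[of f 1] by simp
  qed (use a in auto)
  finally show ?thesis using a by (simp add: zero_less_mult_iff)
qed

lemma four_mult_le_square_sum_ennreal: "4 * (p * q) \<le> (p + q)\<^sup>2" for p q :: ennreal
proof (cases p; cases q)
  fix r s assume "p = ennreal r" "0 \<le> r" "q = ennreal s" "0 \<le> s"
  moreover have "4 * (r * s) \<le> (r + s)\<^sup>2"
    using zero_le_power2[of "r - s"] by (simp add: power2_eq_square algebra_simps)
  ultimately show ?thesis
    by (simp add: ennreal_power flip: ennreal_plus ennreal_mult ennreal_numeral)
next
qed (auto simp: power2_eq_square ennreal_top_mult ennreal_mult_top)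

text \<open>Scaling the levels of \<open>f\<close>, \<open>g\<close>, \<open>h\<close> by \<open>sup f = a\<close>, \<open>sup g = b\<close> and
  \<open>c = sqrt (a * b)\<close> makes each pair of level sets of \<open>f\<close> and \<open>g\<close> nonempty at heights below 1
  and puts their midpoints into the level set of \<open>h\<close>. The one-dimensional inequality for sets,
  integrated over the levels, bounds the arithmetic mean of the normalised integrals, hence their
  geometric mean.\<close>

lemma prekopa_leindler_real_bounded:
  fixes f g h :: "real \<Rightarrow> ennreal"
  assumes [measurable]: "f \<in> borel_measurable borel" "g \<in> borel_measurable borel" "h \<in> borel_measurable borel"
    and le: "\<And>x y. f x * g y \<le> (h ((x + y) / 2))\<^sup>2"
    and bdd: "\<And>x. f x \<le> ennreal N" "\<And>x. g x \<le> ennreal N"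
  shows "(\<integral>\<^sup>+x. f x \<partial>lborel) * (\<integral>\<^sup>+x. g x \<partial>lborel) \<le> (\<integral>\<^sup>+x. h x \<partial>lborel)\<^sup>2"
proof (cases "(\<forall>x. f x = 0) \<or> (\<forall>x. g x = 0)")
  case True then show ?thesis by auto
next
  case False
  have "(SUP x. f x) \<le> ennreal N" "(SUP x. g x) \<le> ennreal N" using bdd by (auto intro: SUP_least)
  then have "(SUP x. f x) < top" "(SUP x. g x) < top"
    by (auto intro: order_le_less_trans)
  then obtain a b where ab: "(SUP x. f x) = ennreal a" "(SUP x. g x) = ennreal b" "0 \<le> a" "0 \<le> b"
    by (metis ennreal_enn2real enn2real_nonneg)
  have pos: "0 < a" "0 < b"
    using False ab by (metis SUP_upper UNIV_I ennreal_0 le_zero_eq less_eq_real_def)+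
  define c where "c = sqrt (a * b)"
  have c: "0 < c" "c\<^sup>2 = a * b" using pos by (auto simp: c_def)
  let ?F = "\<lambda>f a s. emeasure lborel {x::real. 0 < s \<and> ennreal (a * s) < (f x::ennreal)}"
  have [measurable]: "(\<lambda>s. ?F f a s) \<in> borel_measurable borel" "(\<lambda>s. ?F g b s) \<in> borel_measurable borel"
     "(\<lambda>s. ?F h c s) \<in> borel_measurable borel" by (auto intro!: borel_measurable_level_measure)
  have level: "?F f a s + ?F g b s \<le> 2 * ?F h c s" for s
  proof (cases "0 < s \<and> s < 1")
    case True
    have "a * s < a" "b * s < b" using True pos by auto
    then have "ennreal (a * s) < (SUP x. f x)" "ennreal (b * s) < (SUP x. g x)"
      using True pos by (auto simp: ab ennreal_less_iff)
    then have ne: "{x. ennreal (a * s) < f x} \<noteq> {}" "{x. ennreal (b * s) < g x} \<noteq> {}"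
      by (auto simp: less_SUP_iff)
    have "emeasure lborel {x. ennreal (a * s) < f x} + emeasure lborel {x. ennreal (b * s) < g x}
        \<le> 2 * emeasure lborel {x. ennreal (c * s) < h x}"
    proof (rule emeasure_midpoints_real)
      fix x y assume xy: "x \<in> {x. ennreal (a * s) < f x}" "y \<in> {x. ennreal (b * s) < g x}"
      show "(x + y) / 2 \<in> {x. ennreal (c * s) < h x}"
      proof (rule ccontr)
        assume "\<not> ?thesis"
        then have "h ((x + y)/2) \<le> ennreal (c * s)" by simp
        then have "(h ((x + y)/2))\<^sup>2 \<le> (ennreal (c * s))\<^sup>2" by (rule power_mono) simp
        also have "\<dots> = ennreal (a * s) * ennreal (b * s)"
          using True c pos by (simp add: ennreal_power power_mult_distrib flip: ennreal_mult)
             (simp add: power2_eq_square ac_simps)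
        also have "\<dots> < f x * ennreal (b * s)"
          using xy True pos by (intro ennreal_mult_strict_right_mono) auto
        also have "\<dots> \<le> f x * g y"
          using xy by (intro mult_left_mono) auto
        also have "\<dots> \<le> (h ((x + y)/2))\<^sup>2" by (rule le)
        finally show False by simp
      qed
    qed (use ne in auto)
    then show ?thesis using True by simp
  next
    case False
    have "\<not> ennreal (a * s) < f x" "\<not> ennreal (b * s) < g x" if "1 \<le> s" for x
    proof -
      have "f x \<le> ennreal a" "g x \<le> ennreal b" using ab(1,2) by (metis SUP_upper UNIV_I)+
      moreover have "ennreal a \<le> ennreal (a * s)" "ennreal b \<le> ennreal (b * s)"
        using that pos by (auto intro!: ennreal_leI)
      ultimately show "\<not> ennreal (a * s) < f x" "\<not> ennreal (b * s) < g x" by (auto simp: not_less intro: order_trans)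
    qed
    then show ?thesis using False by auto
  qed
  let ?p = "\<integral>\<^sup>+s. ?F f a s \<partial>lborel" and ?q = "\<integral>\<^sup>+s. ?F g b s \<partial>lborel" and ?r = "\<integral>\<^sup>+s. ?F h c s \<partial>lborel"
  have pqr: "?p + ?q \<le> 2 * ?r"
  proof -
    have "?p + ?q = (\<integral>\<^sup>+s. ?F f a s + ?F g b s \<partial>lborel)" by (rule nn_integral_add[symmetric]) auto
    also have "\<dots> \<le> (\<integral>\<^sup>+s. 2 * ?F h c s \<partial>lborel)" by (intro nn_integral_mono level)
    also have "\<dots> = 2 * ?r" by (rule nn_integral_cmult) auto
    finally show ?thesis .
  qed
  have "4 * (?p * ?q) \<le> (2 * ?r)\<^sup>2"
    using four_mult_le_square_sum_ennreal power_mono[OF pqr, of 2] by (auto intro: order_trans)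
  then have "4 * (?p * ?q) \<le> 4 * ?r\<^sup>2" by (simp add: power_mult_distrib)
  then have key: "?p * ?q \<le> ?r\<^sup>2"
    by (subst (asm) ennreal_mult_le_mult_iff) auto
  have "(\<integral>\<^sup>+x. f x \<partial>lborel) * (\<integral>\<^sup>+x. g x \<partial>lborel) = (ennreal a * ?p) * (ennreal b * ?q)"
    using nn_integral_layer_cake_scaled[of f a] nn_integral_layer_cake_scaled[of g b] pos by simp
  also have "\<dots> = ennreal (c\<^sup>2) * (?p * ?q)" using pos c by (simp add: ennreal_mult ac_simps)
  also have "\<dots> \<le> ennreal (c\<^sup>2) * ?r\<^sup>2" using key by (rule mult_left_mono) simp
  also have "\<dots> = (ennreal c * ?r)\<^sup>2" using c by (simp add: power_mult_distrib ennreal_power)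
  also have "\<dots> = (\<integral>\<^sup>+x. h x \<partial>lborel)\<^sup>2"
    using nn_integral_layer_cake_scaled[of h c] c by simp
  finally show ?thesis .
qed

lemma prekopa_leindler_real:
  fixes f g h :: "real \<Rightarrow> ennreal"
  assumes [measurable]: "f \<in> borel_measurable borel" "g \<in> borel_measurable borel" "h \<in> borel_measurable borel"
    and le: "\<And>x y. f x * g y \<le> (h ((x + y) / 2))\<^sup>2"
  shows "(\<integral>\<^sup>+x. f x \<partial>lborel) * (\<integral>\<^sup>+x. g x \<partial>lborel) \<le> (\<integral>\<^sup>+x. h x \<partial>lborel)\<^sup>2"
proof -
  define T where "T f n x = min (f x) (ennreal (real n))" for f :: "real \<Rightarrow> ennreal" and n x
  have [measurable]: "T f n \<in> borel_measurable borel" if [measurable]: "f \<in> borel_measurable borel" for f n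
    unfolding T_def by measurable
  have lim: "(\<lambda>n. \<integral>\<^sup>+x. T f n x \<partial>lborel) \<longlonglongrightarrow> (\<integral>\<^sup>+x. f x \<partial>lborel)"
    and inc: "incseq (\<lambda>n. \<integral>\<^sup>+x. T f n x \<partial>lborel)"
    if [measurable]: "f \<in> borel_measurable borel" for f
  proof -
    have i: "incseq (T f)"
      unfolding incseq_def le_fun_def T_def by (auto intro!: min.coboundedI2 ennreal_leI)
    have s: "(SUP n. T f n x) = f x" for x
    proof -
      have "(SUP n. T f n x) = (SUP n. inf (f x) (ennreal (real n)))" by (simp add: T_def inf_min)
      also have "\<dots> = inf (f x) (SUP n. ennreal (real n))" by (simp add: inf_SUP)
      also have "(SUP n. ennreal (real n)) = top"
        using ennreal_SUP_of_nat_eq_top by (simp add: ennreal_of_nat_eq_real_of_nat)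
      finally show ?thesis by simp
    qed
    show "incseq (\<lambda>n. \<integral>\<^sup>+x. T f n x \<partial>lborel)"
      using i by (auto simp: incseq_def le_fun_def intro!: nn_integral_mono)
    then show "(\<lambda>n. \<integral>\<^sup>+x. T f n x \<partial>lborel) \<longlonglongrightarrow> (\<integral>\<^sup>+x. f x \<partial>lborel)"
      using LIMSEQ_SUP nn_integral_monotone_convergence_SUP[OF i] by (auto simp: s)
  qed
  have *: "(\<integral>\<^sup>+x. T f n x \<partial>lborel) * (\<integral>\<^sup>+x. T g n x \<partial>lborel) \<le> (\<integral>\<^sup>+x. h x \<partial>lborel)\<^sup>2" for n
  proof (rule prekopa_leindler_real_bounded[where N="real n"])
    show "T f n x * T g n y \<le> (h ((x + y) / 2))\<^sup>2" for x y
      using le[of x y] by (rule order_trans[rotated]) (auto simp: T_def intro: mult_mono)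
  qed (auto simp: T_def)
  let ?f = "\<lambda>n. \<integral>\<^sup>+x. T f n x \<partial>lborel" and ?g = "\<lambda>n. \<integral>\<^sup>+x. T g n x \<partial>lborel"
  have F: "(\<integral>\<^sup>+x. f x \<partial>lborel) = (SUP n. ?f n)" "(\<integral>\<^sup>+x. g x \<partial>lborel) = (SUP n. ?g n)"
    using lim inc LIMSEQ_SUP LIMSEQ_unique by (metis assms(1), metis assms(2))
  have "(SUP n. ?f n) * (SUP n. ?g n) = (SUP n. ?f n * (SUP n. ?g n))" 
    by (simp add: SUP_mult_right_ennreal)
  also have "\<dots> = (SUP n. SUP m. ?f n * ?g m)" by (simp add: SUP_mult_left_ennreal)
  also have "\<dots> \<le> (\<integral>\<^sup>+x. h x \<partial>lborel)\<^sup>2"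
  proof (intro SUP_least)
    fix n m
    have "?f n * ?g m \<le> ?f (max n m) * ?g (max n m)"
      using inc by (intro mult_mono) (auto simp: incseq_def)
    then show "?f n * ?g m \<le> (\<integral>\<^sup>+x. h x \<partial>lborel)\<^sup>2" using *[of "max n m"] by simp
  qed
  finally show ?thesis by (simp only: F)
qed

lemma borel_measurable_fun_upd_section:
  fixes u :: "('i \<Rightarrow> real) \<Rightarrow> ennreal"
  assumes u: "u \<in> borel_measurable (\<Pi>\<^sub>M i\<in>insert i I. lborel)" and x: "x \<in> extensional I"
  shows "(\<lambda>y. u (x(i := y))) \<in> borel_measurable borel"
proof -
  have "(\<lambda>y. x(i := y)) \<in> lborel \<rightarrow>\<^sub>M (\<Pi>\<^sub>M i\<in>insert i I. (lborel::real measure))"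
    using x by (intro measurable_fun_upd[where J=I]) (auto simp: space_PiM PiE_def)
  from measurable_compose[OF this u] show ?thesis by (simp add: fun_upd_def)
qed

text \<open>The fibre integrals over the last coordinate again satisfy the hypothesis, by the
  one-dimensional case, so the inequality tensorises. With midpoints all exponents are one half,
  so the inequality is written with squares.\<close>

lemma prekopa_leindler_PiM:
  fixes f g h :: "('i \<Rightarrow> real) \<Rightarrow> ennreal"
  assumes "finite I"
    and "f \<in> borel_measurable (\<Pi>\<^sub>M i\<in>I. lborel)" "g \<in> borel_measurable (\<Pi>\<^sub>M i\<in>I. lborel)"
      "h \<in> borel_measurable (\<Pi>\<^sub>M i\<in>I. lborel)"
    and "\<And>x y. x \<in> extensional I \<Longrightarrow> y \<in> extensional I \<Longrightarrow>
      f x * g y \<le> (h (\<lambda>i\<in>I. (x i + y i) / 2))\<^sup>2"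
  shows "(\<integral>\<^sup>+x. f x \<partial>(\<Pi>\<^sub>M i\<in>I. lborel)) * (\<integral>\<^sup>+x. g x \<partial>(\<Pi>\<^sub>M i\<in>I. lborel))
    \<le> (\<integral>\<^sup>+x. h x \<partial>(\<Pi>\<^sub>M i\<in>I. lborel))\<^sup>2"
  using assms
proof (induction I arbitrary: f g h rule: finite_induct)
  case empty
  have "(\<lambda>_::'i. undefined) \<in> extensional {}" by simp
  from empty(4)[OF this this] show ?case
    by (simp add: nn_integral_count_space_finite PiM_empty restrict_def)
next
  case (insert i I)
  interpret P: product_sigma_finite "\<lambda>_::'i. lborel :: real measure" ..
  note [measurable] = insert.prems(1-3)
  note sec = borel_measurable_fun_upd_section
  have int: "(\<lambda>x. \<integral>\<^sup>+y. u (x(i := y)) \<partial>lborel) \<in> borel_measurable (\<Pi>\<^sub>M i\<in>I. lborel)"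
    if [measurable]: "u \<in> borel_measurable (\<Pi>\<^sub>M i\<in>insert i I. lborel)"
    for u :: "('i \<Rightarrow> real) \<Rightarrow> ennreal"
    by measurable
  show ?case
    unfolding P.product_nn_integral_insert[OF insert.hyps insert.prems(1)]
      P.product_nn_integral_insert[OF insert.hyps insert.prems(2)]
      P.product_nn_integral_insert[OF insert.hyps insert.prems(3)]
  proof (rule insert.IH)
    fix x y :: "'i \<Rightarrow> real" assume xy: "x \<in> extensional I" "y \<in> extensional I"
    let ?m = "\<lambda>i\<in>I. (x i + y i) / 2"
    show "(\<integral>\<^sup>+s. f (x(i := s)) \<partial>lborel) * (\<integral>\<^sup>+s. g (y(i := s)) \<partial>lborel)
        \<le> (\<integral>\<^sup>+s. h (?m(i := s)) \<partial>lborel)\<^sup>2"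
    proof (rule prekopa_leindler_real)
      fix s t
      have "(\<lambda>j\<in>insert i I. ((x(i := s)) j + (y(i := t)) j) / 2) = ?m(i := (s + t) / 2)"
        using insert.hyps by (auto simp: fun_eq_iff)
      moreover have "x(i := s) \<in> extensional (insert i I)" "y(i := t) \<in> extensional (insert i I)"
        using xy by (auto simp: extensional_def)
      ultimately show "f (x(i := s)) * g (y(i := t)) \<le> (h (?m(i := (s + t) / 2)))\<^sup>2"
        using insert.prems(4)[of "x(i := s)" "y(i := t)"] by (simp only:)
    qed (rule sec[OF insert.prems(1) xy(1)] sec[OF insert.prems(2) xy(2)]
        sec[OF insert.prems(3) restrict_extensional])+
  qed (rule int[OF insert.prems(1)] int[OF insert.prems(2)] int[OF insert.prems(3)])+
qed

lemma emeasure_basis_lborel: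
  assumes [measurable]: "E \<in> sets borel"
  shows "emeasure (basis_lborel D) E
    = (\<integral>\<^sup>+f. indicator E (\<Sum>b\<in>D. f b *\<^sub>R b) \<partial>(\<Pi>\<^sub>M b\<in>D. lborel))"
proof -
  have "emeasure (basis_lborel D) E
      = (\<integral>\<^sup>+x. indicator E x \<partial>distr (\<Pi>\<^sub>M b\<in>D. lborel) borel (\<lambda>f. \<Sum>b\<in>D. f b *\<^sub>R b))"
    by (simp add: basis_lborel_def)
  also have "\<dots> = (\<integral>\<^sup>+f. indicator E (\<Sum>b\<in>D. f b *\<^sub>R b) \<partial>(\<Pi>\<^sub>M b\<in>D. lborel))"
    by (rule nn_integral_distr) measurable
  finally show ?thesis .
qed

text \<open>The multiplicative Brunn--Minkowski inequality at ratio one half. It does not mention the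
  dimension, so it passes unchanged to subspaces through cylinders.\<close>

lemma emeasure_lborel_midpoints:
  fixes X Y Z :: "'a::euclidean_space set"
  assumes [measurable]: "X \<in> sets borel" "Y \<in> sets borel" "Z \<in> sets borel"
    and mid: "\<And>x y. x \<in> X \<Longrightarrow> y \<in> Y \<Longrightarrow> (1/2) *\<^sub>R (x + y) \<in> Z"
  shows "emeasure lborel X * emeasure lborel Y \<le> (emeasure lborel Z)\<^sup>2"
proof -
  let ?s = "\<lambda>f. \<Sum>b\<in>Basis. f b *\<^sub>R b :: 'a"
  have [measurable]: "?s \<in> (\<Pi>\<^sub>M b\<in>Basis. lborel) \<rightarrow>\<^sub>M borel" by measurable
  have em: "emeasure lborel S = (\<integral>\<^sup>+f. indicator S (?s f) \<partial>(\<Pi>\<^sub>M b\<in>Basis. lborel))"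
    if [measurable]: "S \<in> sets borel" for S :: "'a set"
  proof -
    have "emeasure lborel S = (\<integral>\<^sup>+x. indicator S x \<partial>distr (\<Pi>\<^sub>M b\<in>Basis. lborel) borel ?s)"
      by (subst lborel_eq[symmetric]) simp
    also have "\<dots> = (\<integral>\<^sup>+f. indicator S (?s f) \<partial>(\<Pi>\<^sub>M b\<in>Basis. lborel))"
      by (rule nn_integral_distr) measurable
    finally show ?thesis .
  qed
  show ?thesis
    unfolding em[OF assms(1)] em[OF assms(2)] em[OF assms(3)]
  proof (rule prekopa_leindler_PiM)
    fix x y :: "'a \<Rightarrow> real"
    have "?s (\<lambda>i\<in>Basis. (x i + y i) / 2) = (\<Sum>i\<in>Basis. ((x i + y i) / 2) *\<^sub>R i)"
      by (rule sum.cong) auto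
    also have "\<dots> = (1/2) *\<^sub>R (?s x + ?s y)"
      by (simp add: scaleR_sum_right scaleR_add_left add_divide_distrib scaleR_right_distrib sum.distrib)
    finally have m: "?s (\<lambda>i\<in>Basis. (x i + y i) / 2) = (1/2) *\<^sub>R (?s x + ?s y)" .
    show "indicator X (?s x) * indicator Y (?s y)
        \<le> ((indicator Z (?s (\<lambda>i\<in>Basis. (x i + y i) / 2)))\<^sup>2 :: ennreal)"
      unfolding m using mid by (auto simp: indicator_def)
  qed measurable
qed

section \<open>Volume in a subspace\<close>

definition coord_proj :: "'a::euclidean_space set \<Rightarrow> 'a \<Rightarrow> 'a"
  where "coord_proj B x = (\<Sum>b\<in>B. (x \<bullet> b) *\<^sub>R b)"

text \<open>The cylinder with unit cube cross-section over a subset of the span of \<open>B\<close>: its volume is the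
  volume of the base.\<close>

definition cylinder_over :: "'a::euclidean_space set \<Rightarrow> 'a set \<Rightarrow> 'a set \<Rightarrow> 'a set"
  where "cylinder_over B C A = {x. coord_proj B x \<in> A \<and> (\<forall>c\<in>C. x \<bullet> c \<in> {0..1})}"

text \<open>\<open>B\<close> is an orthonormal basis of \<open>H\<close> and \<open>C\<close> one of its orthogonal complement.\<close>

definition split_basis :: "'a::euclidean_space set \<Rightarrow> 'a set \<Rightarrow> 'a set \<Rightarrow> bool"
  where "split_basis H B C \<longleftrightarrow> orthonormal_basis_of H B \<and> orthonormal_basis_of UNIV (B \<union> C) \<and> B \<inter> C = {}"

lemma ex_split_basis:
  assumes "subspace (H :: 'a::euclidean_space set)"
  shows "\<exists>B C. split_basis H B C"
proof -
  obtain B where B: "pairwise orthogonal B" "\<And>x. x \<in> B \<Longrightarrow> norm x = 1" "span B = H"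
    using orthonormal_basis_subspace[OF assms] by metis
  then have oB: "orthonormal_basis_of H B" by (auto simp: orthonormal_basis_of_def)
  obtain C where C: "pairwise orthogonal C" "\<And>x. x \<in> C \<Longrightarrow> norm x = 1" "span C = H\<^sup>\<bottom>"
    using orthonormal_basis_subspace[OF subspace_orthogonal_comp] by metis
  have CE: "C \<subseteq> H\<^sup>\<bottom>" using C(3) span_superset by blast
  have orth: "orthogonal d c" if "d \<in> B" "c \<in> C" for c d
    using that CE orthonormal_basis_of_facts(4)[OF oB] by (auto simp: orthogonal_comp_def)
  then have "B \<inter> C = {}" using C(2) by (force simp: orthogonal_def)
  moreover have "span (B \<union> C) = UNIV"
    using subspace_sum_orthogonal_comp[OF assms] B(3) C(3)
    by (simp add: span_Un set_plus_def) blast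
  then have "orthonormal_basis_of UNIV (B \<union> C)"
    using orth B C unfolding orthonormal_basis_of_def pairwise_def
    by (metis Un_iff orthogonal_commute)
  ultimately show ?thesis using oB by (auto simp: split_basis_def)
qed

lemma split_basis_facts:
  fixes H :: "'a::euclidean_space set"
  assumes "split_basis H B C"
  shows "finite B" "finite C" "card B = dim H" "card B + card C = DIM('a)" "B \<subseteq> H" "subspace H"
    "\<And>b c. b \<in> B \<union> C \<Longrightarrow> c \<in> B \<union> C \<Longrightarrow> b \<bullet> c = (if b = c then 1 else 0)"
    "B \<inter> C = {}"
proof -
  have o: "orthonormal_basis_of H B" "orthonormal_basis_of UNIV (B \<union> C)" "B \<inter> C = {}"
    using assms by (auto simp: split_basis_def)
  show "finite B" "finite C" using orthonormal_basis_of_facts(1)[OF o(2)] by auto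
  then show "card B + card C = DIM('a)"
    using orthonormal_basis_of_facts(3)[OF o(2)] o(3) by (simp add: card_Un_disjoint dim_UNIV)
  show "card B = dim H" "B \<subseteq> H" using orthonormal_basis_of_facts[OF o(1)] by auto
  show "subspace H" using o(1) by (auto simp: orthonormal_basis_of_def)
  show "\<And>b c. b \<in> B \<union> C \<Longrightarrow> c \<in> B \<union> C \<Longrightarrow> b \<bullet> c = (if b = c then 1 else 0)"
    using orthonormal_basis_of_facts(5)[OF o(2)] by auto
  show "B \<inter> C = {}" by (rule o(3))
qed

lemma orthonormal_expansion:
  assumes "orthonormal_basis_of E B" "x \<in> E"
  shows "(\<Sum>b\<in>B. (x \<bullet> b) *\<^sub>R b) = x"
proof -
  note o = orthonormal_basis_of_facts[OF assms(1)]
  have "x \<in> span B" using assms by (simp add: orthonormal_basis_of_def)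
  then obtain u where u: "x = (\<Sum>b\<in>B. u b *\<^sub>R b)" using span_finite[OF o(1)] by auto
  have "x \<bullet> b = u b" if "b \<in> B" for b
    unfolding u using that o(1) by (simp add: inner_sum_left o(5) if_distrib sum.delta cong: if_cong)
  then show ?thesis unfolding u by (intro sum.cong) auto
qed

lemma linear_coord_proj: "linear (coord_proj B)"
  unfolding coord_proj_def
  by (auto intro!: linearI simp: inner_add_left scaleR_add_left sum.distrib scaleR_sum_right)

lemma continuous_coord_proj: "continuous_on S (coord_proj B)"
  by (intro linear_continuous_on) (simp add: linear_coord_proj flip: linear_conv_bounded_linear)

lemma coord_proj_facts:
  assumes "split_basis H B C"
  shows "coord_proj B x \<in> H" "\<And>x. x \<in> H \<Longrightarrow> coord_proj B x = x"
    "\<And>b. b \<in> B \<Longrightarrow> coord_proj B x \<bullet> b = x \<bullet> b"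
    "\<And>c. c \<in> C \<Longrightarrow> coord_proj B x \<bullet> c = 0"
    "\<And>y. y \<in> H \<Longrightarrow> (x - coord_proj B x) \<bullet> y = 0"
    "x - coord_proj B x = (\<Sum>c\<in>C. (x \<bullet> c) *\<^sub>R c)"
    "(norm x)\<^sup>2 = (norm (coord_proj B x))\<^sup>2 + (norm (x - coord_proj B x))\<^sup>2"
    "norm (coord_proj B x) \<le> norm x"
proof -
  note f = split_basis_facts[OF assms]
  have o: "orthonormal_basis_of H B" "orthonormal_basis_of UNIV (B \<union> C)" "B \<inter> C = {}"
    using assms by (auto simp: split_basis_def)
  show H: "coord_proj B x \<in> H"
    unfolding coord_proj_def using f by (intro subspace_sum subspace_scale) auto
  show "\<And>x. x \<in> H \<Longrightarrow> coord_proj B x = x"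
    unfolding coord_proj_def by (rule orthonormal_expansion[OF o(1)])
  show b: "coord_proj B x \<bullet> b = x \<bullet> b" if "b \<in> B" for b x
    unfolding coord_proj_def using that f(1)
    by (simp add: inner_sum_left f(7) if_distrib sum.delta cong: if_cong)
  show "coord_proj B x \<bullet> c = 0" if "c \<in> C" for c
    unfolding coord_proj_def using that f(8)
    by (simp add: inner_sum_left f(7)) (intro sum.neutral, auto simp: f(7))
  show orth: "(x - coord_proj B x) \<bullet> y = 0" if "y \<in> H" for y
  proof -
    have "y = (\<Sum>b\<in>B. (y \<bullet> b) *\<^sub>R b)" using orthonormal_expansion[OF o(1) that] by simp
    then have "(x - coord_proj B x) \<bullet> y = (\<Sum>b\<in>B. (y \<bullet> b) * ((x - coord_proj B x) \<bullet> b))"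
      by (metis (no_types, lifting) inner_scaleR_right inner_sum_right sum.cong)
    also have "\<dots> = 0" by (intro sum.neutral) (simp add: inner_diff_left b)
    finally show ?thesis .
  qed
  have "x = (\<Sum>b\<in>B\<union>C. (x \<bullet> b) *\<^sub>R b)" using orthonormal_expansion[OF o(2)] by simp
  then show "x - coord_proj B x = (\<Sum>c\<in>C. (x \<bullet> c) *\<^sub>R c)"
    using sum.union_disjoint[OF f(1,2) o(3), of "\<lambda>b. (x \<bullet> b) *\<^sub>R b"]
    unfolding coord_proj_def by (simp add: algebra_simps)
  show pyth: "(norm x)\<^sup>2 = (norm (coord_proj B x))\<^sup>2 + (norm (x - coord_proj B x))\<^sup>2"
    using orth[OF H] norm_add_Pythagorean[of "coord_proj B x" "x - coord_proj B x"]
    by (simp add: orthogonal_def inner_commute)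
  show "norm (coord_proj B x) \<le> norm x"
    by (rule power2_le_imp_le) (use pyth in auto)
qed

lemma sets_cylinder_over [measurable]:
  assumes "finite C" and [measurable]: "A \<in> sets borel"
  shows "cylinder_over B C A \<in> sets borel"
proof -
  have [simp]: "countable C" using assms by (simp add: countable_finite)
  show ?thesis unfolding cylinder_over_def coord_proj_def by measurable
qed

lemma emeasure_subspace_cylinder:
  assumes "split_basis H B C" "A \<in> sets borel"
  shows "emeasure (subspace_lborel H) A = emeasure lborel (cylinder_over B C A)"
proof -
  have o: "orthonormal_basis_of H B" "orthonormal_basis_of UNIV (B \<union> C)" "B \<inter> C = {}"
    using assms by (auto simp: split_basis_def)
  show ?thesis
    unfolding subspace_lborel_eq[OF o(1)] cylinder_over_def coord_proj_def
    by (rule emeasure_basis_lborel_cylinder[OF o assms(2)])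
qed

lemma sets_subspace_lborel [simp, measurable_cong]: "sets (subspace_lborel H) = sets borel"
  by (simp add: subspace_lborel_def basis_lborel_def)

lemma bounded_cylinder_over:
  assumes s: "split_basis H B C" and "bounded A"
  shows "bounded (cylinder_over B C A)"
proof -
  obtain M where M: "\<And>x. x \<in> A \<Longrightarrow> norm x \<le> M" using assms(2) by (auto simp: bounded_iff)
  show ?thesis
    unfolding bounded_iff
  proof (intro exI ballI)
    fix x assume x: "x \<in> cylinder_over B C A"
    have "norm (x - coord_proj B x) \<le> (\<Sum>c\<in>C. norm ((x \<bullet> c) *\<^sub>R c))"
      unfolding coord_proj_facts(6)[OF s] by (rule norm_sum)
    also have "\<dots> \<le> (\<Sum>c\<in>C. 1)"
    proof (rule sum_mono)
      fix c assume c: "c \<in> C"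
      then have "norm c = 1" using split_basis_facts(7)[OF s, of c c] by (simp add: norm_eq_1)
      then show "norm ((x \<bullet> c) *\<^sub>R c) \<le> 1" using x c by (auto simp: cylinder_over_def)
    qed
    finally have "norm (x - coord_proj B x) \<le> real (card C)" by simp
    moreover have "norm (coord_proj B x) \<le> M" using x M by (auto simp: cylinder_over_def)
    ultimately show "norm x \<le> M + real (card C)"
      using norm_triangle_ineq[of "coord_proj B x" "x - coord_proj B x"] by simp
  qed
qed

lemma emeasure_subspace_finite:
  assumes "subspace (H :: 'a::euclidean_space set)" "bounded A" "A \<in> sets borel"
  shows "emeasure (subspace_lborel H) A < \<infinity>"
proof -
  obtain B C where s: "split_basis H B C" using ex_split_basis[OF assms(1)] by blast
  show ?thesis
    unfolding emeasure_subspace_cylinder[OF s assms(3)]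
    by (rule emeasure_bounded_finite[OF bounded_cylinder_over[OF s assms(2)]])
qed

lemma emeasure_vol_in:
  assumes "subspace (H :: 'a::euclidean_space set)" "bounded A" "A \<in> sets borel"
  shows "emeasure (subspace_lborel H) A = ennreal (vol_in H A)"
  using emeasure_subspace_finite[OF assms] by (intro emeasure_eq_ennreal_measure) auto

lemma vol_in_mono:
  assumes "subspace (H :: 'a::euclidean_space set)" "bounded A'" "A \<in> sets borel" "A' \<in> sets borel" "A \<subseteq> A'"
  shows "vol_in H A \<le> vol_in H A'"
  unfolding measure_def
  by (rule enn2real_mono) (use assms emeasure_subspace_finite[OF assms(1,2,4)] in \<open>auto intro!: emeasure_mono\<close>)

lemma emeasure_cball_pos:
  fixes x :: "'a::euclidean_space"
  assumes "0 < e"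
  shows "0 < emeasure lborel (cball x e)"
proof -
  have "emeasure lborel (cball x e) = ennreal (measure lborel (cball x e))"
    using emeasure_bounded_finite[of "cball x e"] by (intro emeasure_eq_ennreal_measure) auto
  then show ?thesis using content_cball_pos[OF assms, of x] by simp
qed

text \<open>The cylinder over a ball around the origin of \<open>H\<close> contains a nonempty open set.\<close>

lemma vol_in_pos:
  assumes H: "subspace (H :: 'a::euclidean_space set)" and "bounded A" "A \<in> sets borel"
    and r: "0 < r" "cball 0 r \<inter> H \<subseteq> A"
  shows "0 < vol_in H A"
proof -
  obtain B C where s: "split_basis H B C" using ex_split_basis[OF H] by blast
  note f = split_basis_facts[OF s]
  let ?U = "{x. coord_proj B x \<in> ball 0 r \<and> (\<forall>c\<in>C. x \<bullet> c \<in> {0<..<1})}"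
  have "?U = (coord_proj B -` ball 0 r) \<inter> (\<Inter>c\<in>C. (\<lambda>x. x \<bullet> c) -` {0<..<1})" by auto
  moreover have "open (coord_proj B -` ball 0 r)"
    by (intro open_vimage continuous_coord_proj) auto
  moreover have "open (\<Inter>c\<in>C. (\<lambda>x. x \<bullet> c) -` {0<..<1})"
    using f(2) by (intro open_INT ballI open_vimage) (auto intro!: continuous_intros)
  ultimately have "open ?U" by (simp add: open_Int)
  moreover have "(\<Sum>c\<in>C. (1/2) *\<^sub>R c) \<in> ?U"
  proof -
    have i: "(\<Sum>c\<in>C. (1/2) *\<^sub>R c) \<bullet> d = (if d \<in> C then 1/2 else 0)" if "d \<in> B \<union> C" for d
      using that f(2) by (simp add: inner_sum_left f(7) if_distrib sum.delta cong: if_cong)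
    have "coord_proj B (\<Sum>c\<in>C. (1/2) *\<^sub>R c) = 0"
      unfolding coord_proj_def using f(8) by (intro sum.neutral) (auto simp: i)
    then show ?thesis using r by (auto simp: i)
  qed
  moreover have "?U \<subseteq> cylinder_over B C A"
    using r coord_proj_facts(1)[OF s] by (auto simp: cylinder_over_def)
  ultimately obtain x e where e: "0 < e" "cball x e \<subseteq> cylinder_over B C A"
    unfolding open_contains_cball by (meson order_trans)
  have "0 < emeasure lborel (cball x e)" by (rule emeasure_cball_pos[OF e(1)])
  also have "\<dots> \<le> emeasure lborel (cylinder_over B C A)"
    using e(2) f(2) assms(3) by (intro emeasure_mono) (auto intro: sets_cylinder_over)
  also have "\<dots> = ennreal (vol_in H A)"
    using emeasure_vol_in[OF H assms(2,3)] emeasure_subspace_cylinder[OF s assms(3)] by simp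
  finally show ?thesis by simp
qed

section \<open>Scaling, rotations, contractions and midpoints in a subspace\<close>

lemma nn_integral_PiM_lborel_scale:
  fixes f :: "('i \<Rightarrow> real) \<Rightarrow> ennreal" and c :: real
  assumes "finite I" "0 < c" "f \<in> borel_measurable (\<Pi>\<^sub>M i\<in>I. lborel)"
  shows "(\<integral>\<^sup>+x. f x \<partial>(\<Pi>\<^sub>M i\<in>I. lborel))
    = ennreal (c ^ card I) * (\<integral>\<^sup>+x. f (\<lambda>i\<in>I. c * x i) \<partial>(\<Pi>\<^sub>M i\<in>I. lborel))"
  using assms(1,3)
proof (induction I arbitrary: f rule: finite_induct)
  case empty
  show ?case by (simp add: PiM_empty nn_integral_count_space_finite)
next
  case (insert i I)
  interpret P: product_sigma_finite "\<lambda>_::'i. lborel :: real measure" ..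
  note [measurable] = insert.prems
  have int: "(\<lambda>x. \<integral>\<^sup>+y. f (x(i := y)) \<partial>lborel) \<in> borel_measurable (\<Pi>\<^sub>M i\<in>I. lborel)"
    by measurable
  note sec = borel_measurable_fun_upd_section[OF insert.prems]
  have sc: "(\<lambda>x. \<lambda>i\<in>J. c * x i) \<in> (\<Pi>\<^sub>M i\<in>J. lborel) \<rightarrow>\<^sub>M (\<Pi>\<^sub>M i\<in>J. (lborel::real measure))" for J :: "'i set"
    by measurable
  have "(\<integral>\<^sup>+x. f x \<partial>(\<Pi>\<^sub>M i\<in>insert i I. lborel))
      = (\<integral>\<^sup>+x. \<integral>\<^sup>+y. f (x(i := y)) \<partial>lborel \<partial>(\<Pi>\<^sub>M i\<in>I. lborel))"
    by (rule P.product_nn_integral_insert[OF insert.hyps insert.prems])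
  also have "\<dots> = ennreal (c ^ card I) *
      (\<integral>\<^sup>+x. \<integral>\<^sup>+y. f ((\<lambda>i\<in>I. c * x i)(i := y)) \<partial>lborel \<partial>(\<Pi>\<^sub>M i\<in>I. lborel))"
    by (rule insert.IH[OF int])
  also have "(\<integral>\<^sup>+x. \<integral>\<^sup>+y. f ((\<lambda>i\<in>I. c * x i)(i := y)) \<partial>lborel \<partial>(\<Pi>\<^sub>M i\<in>I. lborel))
      = (\<integral>\<^sup>+x. ennreal c * (\<integral>\<^sup>+y. f (\<lambda>j\<in>insert i I. c * (x(i := y)) j) \<partial>lborel) \<partial>(\<Pi>\<^sub>M i\<in>I. lborel))"
  proof (rule nn_integral_cong)
    fix x
    have "(\<lambda>i\<in>I. c * x i)(i := 0 + c * y) = (\<lambda>j\<in>insert i I. c * (x(i := y)) j)" for y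
      using insert.hyps by (auto simp: fun_eq_iff)
    then show "(\<integral>\<^sup>+y. f ((\<lambda>i\<in>I. c * x i)(i := y)) \<partial>lborel)
        = ennreal c * (\<integral>\<^sup>+y. f (\<lambda>j\<in>insert i I. c * (x(i := y)) j) \<partial>lborel)"
      using nn_integral_real_affine[of "\<lambda>y. f ((\<lambda>i\<in>I. c * x i)(i := y))" c 0] sec assms(2) by simp
  qed
  also have "\<dots> = ennreal c * (\<integral>\<^sup>+x. (\<integral>\<^sup>+y. f (\<lambda>j\<in>insert i I. c * (x(i := y)) j) \<partial>lborel) \<partial>(\<Pi>\<^sub>M i\<in>I. lborel))"
    by (rule nn_integral_cmult) (use measurable_compose[OF sc insert.prems] in measurable)
  also have "(\<integral>\<^sup>+x. (\<integral>\<^sup>+y. f (\<lambda>j\<in>insert i I. c * (x(i := y)) j) \<partial>lborel) \<partial>(\<Pi>\<^sub>M i\<in>I. lborel))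
      = (\<integral>\<^sup>+x. f (\<lambda>j\<in>insert i I. c * x j) \<partial>(\<Pi>\<^sub>M i\<in>insert i I. lborel))"
    by (rule P.product_nn_integral_insert[OF insert.hyps measurable_compose[OF sc insert.prems], symmetric])
  finally show ?case
    using insert.hyps assms(2) by (simp add: ennreal_mult ac_simps del: restrict_apply insert_iff)
qed

lemma sets_borel_scaleR_image:
  fixes A :: "'a::euclidean_space set"
  assumes [measurable]: "A \<in> sets borel" and "c \<noteq> 0"
  shows "(\<lambda>x. c *\<^sub>R x) ` A \<in> sets borel"
proof -
  have "(\<lambda>x. c *\<^sub>R x) ` A = {x. inverse c *\<^sub>R x \<in> A}"
    using assms(2) by (force simp: image_iff)
  also have "\<dots> \<in> sets borel" by measurable
  finally show ?thesis .
qed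

lemma emeasure_subspace_scale:
  fixes H :: "'a::euclidean_space set"
  assumes "subspace H" and A[measurable]: "A \<in> sets borel" and c: "0 < c"
  shows "emeasure (subspace_lborel H) ((\<lambda>x. c *\<^sub>R x) ` A)
    = ennreal (c ^ dim H) * emeasure (subspace_lborel H) A"
proof -
  obtain B C where s: "split_basis H B C" using ex_split_basis[OF assms(1)] by blast
  note f = split_basis_facts[OF s]
  let ?s = "\<lambda>f. \<Sum>b\<in>B. f b *\<^sub>R b :: 'a"
  have [measurable]: "?s \<in> (\<Pi>\<^sub>M b\<in>B. lborel) \<rightarrow>\<^sub>M borel" by measurable
  have em: "emeasure (subspace_lborel H) S = (\<integral>\<^sup>+f. indicator S (?s f) \<partial>(\<Pi>\<^sub>M b\<in>B. lborel))"
    if "S \<in> sets borel" for S :: "'a set"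
    using s emeasure_basis_lborel[OF that, of B] by (simp add: split_basis_def subspace_lborel_eq[of H B])
  have cA[measurable]: "(\<lambda>x. c *\<^sub>R x) ` A \<in> sets borel" using c by (intro sets_borel_scaleR_image) auto
  have sc: "?s (\<lambda>b\<in>B. c * g b) = c *\<^sub>R ?s g" for g
  proof -
    have "?s (\<lambda>b\<in>B. c * g b) = (\<Sum>b\<in>B. (c * g b) *\<^sub>R b)" by (rule sum.cong) auto
    then show ?thesis by (simp add: scaleR_sum_right)
  qed
  have "indicator ((\<lambda>x. c *\<^sub>R x) ` A) (?s (\<lambda>b\<in>B. c * g b)) = (indicator A (?s g) :: ennreal)" for g
    unfolding sc using c by (auto simp: indicator_def)
  then show ?thesis
    unfolding em[OF cA] em[OF A] f(3)[symmetric]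
    by (subst nn_integral_PiM_lborel_scale[OF f(1) c]) simp_all
qed

lemma vol_in_scale:
  fixes H :: "'a::euclidean_space set"
  assumes "subspace H" "A \<in> sets borel" "0 < c"
  shows "vol_in H ((\<lambda>x. c *\<^sub>R x) ` A) = c ^ dim H * vol_in H A"
  unfolding measure_def emeasure_subspace_scale[OF assms] using assms(3) by (simp add: enn2real_mult)

lemma emeasure_orthogonal_image:
  fixes T :: "'a::euclidean_space \<Rightarrow> 'a"
  assumes T: "orthogonal_transformation T" and [measurable]: "X \<in> sets borel"
  shows "T ` X \<in> sets borel" "emeasure lborel (T ` X) = emeasure lborel X"
proof -
  have cont: "T' \<in> borel \<rightarrow>\<^sub>M borel" if "orthogonal_transformation T'" for T' :: "'a \<Rightarrow> 'a"
    using orthogonal_transformation_linear[OF that]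
    by (intro borel_measurable_continuous_onI linear_continuous_on) (simp add: linear_conv_bounded_linear)
  have b: "bij T" by (rule orthogonal_transformation_bij[OF T])
  have "T ` X = inv T -` X \<inter> space borel" using b by (simp add: bij_vimage_eq_inv_image bij_imp_bij_inv inv_inv_eq)
  then show B: "T ` X \<in> sets borel"
    using measurable_sets[OF cont[OF orthogonal_transformation_inv[OF T]] assms(2)] by simp
  have "emeasure lborel (T ` X) = emeasure (distr lborel borel T) (T ` X)"
    by (simp add: distr_lborel_orthogonal[OF T])
  also have "\<dots> = emeasure lborel (T -` (T ` X) \<inter> space lborel)"
    by (rule emeasure_distr) (use cont[OF T] B in auto)
  also have "T -` (T ` X) = X" using b by (simp add: bij_is_inj inj_vimage_image_eq)
  finally show "emeasure lborel (T ` X) = emeasure lborel X" by simp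
qed

lemma split_basis_orthogonal_image:
  fixes H :: "'a::euclidean_space set" and T :: "'a \<Rightarrow> 'a"
  assumes T: "orthogonal_transformation T" and s: "split_basis H B C"
  shows "split_basis (T ` H) (T ` B) (T ` C)"
proof -
  have l: "linear T" and b: "bij T" by (rule orthogonal_transformation_linear[OF T], rule orthogonal_transformation_bij[OF T])
  have "orthonormal_basis_of (T ` E) (T ` D)" if "orthonormal_basis_of E D" for E D
    using that T l unfolding orthonormal_basis_of_def
    by (auto simp: pairwise_def orthogonal_def orthogonal_transformation_def
        orthogonal_transformation_norm[OF T] linear_span_image[OF l])
  note ob = this[of H B] this[of UNIV "B \<union> C"]
  have "T ` B \<inter> T ` C = T ` (B \<inter> C)" using image_Int[OF bij_is_inj[OF b]] by metis
  then show ?thesis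
    using s ob unfolding split_basis_def image_Un bij_is_surj[OF b] by simp
qed

lemma emeasure_subspace_orthogonal_image:
  fixes H :: "'a::euclidean_space set" and T :: "'a \<Rightarrow> 'a"
  assumes T: "orthogonal_transformation T" and H: "subspace H" and A: "A \<in> sets borel"
  shows "emeasure (subspace_lborel (T ` H)) (T ` A) = emeasure (subspace_lborel H) A"
proof -
  obtain B C where s: "split_basis H B C" using ex_split_basis[OF H] by blast
  note f = split_basis_facts[OF s]
  have l: "linear T" and b: "bij T" by (rule orthogonal_transformation_linear[OF T], rule orthogonal_transformation_bij[OF T])
  have inn: "T x \<bullet> T y = x \<bullet> y" for x y using T by (simp add: orthogonal_transformation_def)
  have P: "coord_proj (T ` B) (T x) = T (coord_proj B x)" for x
    unfolding coord_proj_def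
    by (subst sum.reindex[OF inj_on_subset[OF bij_is_inj[OF b] subset_UNIV]])
      (simp add: inn linear_sum[OF l] linear_scale[OF l])
  have "cylinder_over (T ` B) (T ` C) (T ` A) = T ` cylinder_over B C A"
  proof
    show "T ` cylinder_over B C A \<subseteq> cylinder_over (T ` B) (T ` C) (T ` A)"
      by (auto simp: cylinder_over_def P inn)
    show "cylinder_over (T ` B) (T ` C) (T ` A) \<subseteq> T ` cylinder_over B C A"
    proof
      fix y assume y: "y \<in> cylinder_over (T ` B) (T ` C) (T ` A)"
      obtain x where x: "y = T x" using b by (metis bij_pointE)
      have "T (coord_proj B x) \<in> T ` A" "\<forall>c\<in>C. x \<bullet> c \<in> {0..1}"
        using y by (auto simp: cylinder_over_def P inn x)
      then have "x \<in> cylinder_over B C A"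
        using b by (auto simp: cylinder_over_def inj_image_mem_iff bij_is_inj)
      then show "y \<in> T ` cylinder_over B C A" using x by blast
    qed
  qed
  then show ?thesis
    using emeasure_subspace_cylinder[OF split_basis_orthogonal_image[OF T s] emeasure_orthogonal_image(1)[OF T A]]
      emeasure_subspace_cylinder[OF s A] emeasure_orthogonal_image(2)[OF T sets_cylinder_over[OF f(2) A]]
    by simp
qed

lemma emeasure_UN_le_nn_integral_count_space:
  assumes I: "countable I" and X: "\<And>i. i \<in> I \<Longrightarrow> X i \<in> sets M"
  shows "emeasure M (\<Union>i\<in>I. X i) \<le> (\<integral>\<^sup>+i. emeasure M (X i) \<partial>count_space I)"
proof -
  have "emeasure M (\<Union>i\<in>I. X i) = (\<integral>\<^sup>+x. indicator (\<Union>i\<in>I. X i) x \<partial>M)"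
    using assms by (intro nn_integral_indicator[symmetric] sets.countable_UN') auto
  also have "\<dots> \<le> (\<integral>\<^sup>+x. \<integral>\<^sup>+i. indicator (X i) x \<partial>count_space I \<partial>M)"
  proof (rule nn_integral_mono)
    fix x
    show "indicator (\<Union>i\<in>I. X i) x \<le> (\<integral>\<^sup>+i. indicator (X i) x \<partial>count_space I)"
    proof (cases "x \<in> (\<Union>i\<in>I. X i)")
      case True
      then obtain j where "j \<in> I" "x \<in> X j" by auto
      then show ?thesis
        using nn_integral_ge_point[of j I "\<lambda>i. indicator (X i) x"] by (auto simp: indicator_def)
    qed simp
  qed
  also have "\<dots> = (\<integral>\<^sup>+i. \<integral>\<^sup>+x. indicator (X i) x \<partial>M \<partial>count_space I)"
    using I X by (intro nn_integral_count_space_nn_integral) auto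
  also have "\<dots> = (\<integral>\<^sup>+i. emeasure M (X i) \<partial>count_space I)"
    using X by (intro nn_integral_cong) simp
  finally show ?thesis .
qed

text \<open>Cover \<open>S\<close> up to a null set by disjoint balls centred in \<open>S\<close> inside an open set of almost
  the same measure. The image of each ball lies in a ball of the same radius, and the image of the
  null set is null.\<close>

lemma emeasure_lipschitz_image_le:
  fixes f :: "'a::euclidean_space \<Rightarrow> 'a"
  assumes S: "S \<in> sets borel" and fS: "f ` S \<in> sets borel"
    and lip: "\<And>x y. x \<in> S \<Longrightarrow> y \<in> S \<Longrightarrow> norm (f x - f y) \<le> norm (x - y)"
  shows "emeasure lborel (f ` S) \<le> emeasure lborel S"
proof (rule ennreal_le_epsilon)
  fix e :: real assume e: "0 < e"
  have "S \<in> sets lebesgue" using S by simp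
  then obtain T where T: "open T" "S \<subseteq> T" "emeasure lebesgue (T - S) < ennreal e"
    using sets_lebesgue_outer_open e by metis
  have mT: "T \<in> sets borel" using T(1) by simp
  let ?K = "{i :: 'a \<times> real. fst i \<in> S \<and> ball (fst i) (snd i) \<subseteq> T}"
  have cov: "\<exists>i. i \<in> ?K \<and> x \<in> ball (fst i) (snd i) \<and> snd i < d" if x: "x \<in> S" and d: "0 < d" for x d
  proof -
    obtain r where r: "r > 0" "ball x r \<subseteq> T" using T x openE by blast
    let ?r = "min r (d/2)"
    have "ball x ?r \<subseteq> ball x r" by (rule subset_ball) simp
    then have "(x, ?r) \<in> ?K \<and> x \<in> ball (fst (x, ?r)) (snd (x, ?r)) \<and> snd (x, ?r) < d"
      using r d x by auto
    then show ?thesis by blast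
  qed
  obtain C where C: "countable C" "C \<subseteq> ?K"
    and dis: "pairwise (\<lambda>i j. disjnt (ball (fst i) (snd i)) (ball (fst j) (snd j))) C"
    and neg: "negligible (S - (\<Union>i\<in>C. ball (fst i) (snd i)))"
    by (rule Vitali_covering_theorem_balls[OF cov])
  let ?U = "\<Union>i\<in>C. ball (fst i) (snd i)" and ?V = "\<Union>i\<in>C. ball (f (fst i)) (snd i)"
  have sV: "?V \<in> sets lborel" by (auto intro!: borel_open)
  have "negligible (f ` (S - ?U))"
  proof (rule negligible_locally_Lipschitz_image[OF _ neg])
    fix x assume x: "x \<in> S - ?U"
    then show "\<exists>T B. open T \<and> x \<in> T \<and> (\<forall>y\<in>(S - ?U) \<inter> T. norm (f y - f x) \<le> B * norm (y - x))"
      using lip by (intro exI[of _ UNIV] exI[of _ 1]) auto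
  qed simp
  moreover have "f ` S - ?V \<subseteq> f ` (S - ?U)"
  proof
    fix y assume y: "y \<in> f ` S - ?V"
    then obtain x where x: "x \<in> S" "y = f x" by auto
    have "x \<notin> ?U"
    proof
      assume "x \<in> ?U"
      then obtain i where i: "i \<in> C" "x \<in> ball (fst i) (snd i)" by auto
      have "norm (f (fst i) - f x) \<le> norm (fst i - x)" using i C x lip by auto
      then have "y \<in> ball (f (fst i)) (snd i)" using i x by (simp add: dist_norm)
      then show False using y i by auto
    qed
    then show "y \<in> f ` (S - ?U)" using x by auto
  qed
  ultimately have "negligible (f ` S - ?V)" by (rule negligible_subset)
  then have null: "f ` S - ?V \<in> null_sets lborel"
    using fS sV by (simp add: negligible_iff_null_sets null_sets_completion_iff)
  have "emeasure lborel (f ` S) \<le> emeasure lborel (?V \<union> (f ` S - ?V))"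
    using sV fS by (intro emeasure_mono) auto
  also have "\<dots> = emeasure lborel ?V"
    by (rule emeasure_Un_null_set[OF sV null])
  also have "\<dots> \<le> (\<integral>\<^sup>+i. emeasure lborel (ball (f (fst i)) (snd i)) \<partial>count_space C)"
    using C(1) by (intro emeasure_UN_le_nn_integral_count_space) auto
  also have "\<dots> = (\<integral>\<^sup>+i. emeasure lborel (ball (fst i) (snd i)) \<partial>count_space C)"
  proof (rule nn_integral_cong)
    show "emeasure lborel (ball (f (fst i)) (snd i)) = emeasure lborel (ball (fst i) (snd i))" for i
      by (cases "snd i \<ge> 0") (auto simp: emeasure_ball ball_empty)
  qed
  also have "\<dots> = emeasure lborel ?U"
    using C(1) dis
    by (intro emeasure_UN_countable[symmetric])
       (auto simp: disjoint_family_on_def pairwise_def disjnt_def)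
  also have "\<dots> \<le> emeasure lborel (S \<union> (T - S))"
    using C S mT by (intro emeasure_mono) auto
  also have "\<dots> \<le> emeasure lborel S + emeasure lborel (T - S)"
    using S mT by (intro emeasure_subadditive) auto
  also have "\<dots> \<le> emeasure lborel S + ennreal e"
    using T(3) S mT by (intro add_left_mono) (auto simp: less_imp_le)
  finally show "emeasure lborel (f ` S) \<le> emeasure lborel S + ennreal e" .
qed

text \<open>Extended by the identity in the directions orthogonal to \<open>H\<close>, the map stays 1-Lipschitz
  by Pythagoras and carries the cylinder over \<open>D\<close> onto the cylinder over \<open>f ` D\<close>.\<close>

lemma emeasure_subspace_lipschitz_image_le:
  fixes H :: "'a::euclidean_space set"
  assumes H: "subspace H" and D: "D \<in> sets borel" "D \<subseteq> H" and fD: "f ` D \<in> sets borel" "f ` D \<subseteq> H"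
    and lip: "\<And>x y. x \<in> D \<Longrightarrow> y \<in> D \<Longrightarrow> norm (f x - f y) \<le> norm (x - y)"
  shows "emeasure (subspace_lborel H) (f ` D) \<le> emeasure (subspace_lborel H) D"
proof -
  obtain B C where s: "split_basis H B C" using ex_split_basis[OF H] by blast
  note b = split_basis_facts[OF s] and p = coord_proj_facts[OF s]
  let ?P = "coord_proj B"
  \<comment> \<open>\<open>f\<close> on the \<open>H\<close>-component, the identity on the orthogonal component\<close>
  define F where "F x = f (?P x) + (x - ?P x)" for x
  note add = linear_add[OF linear_coord_proj[of B]] and diff = linear_diff[OF linear_coord_proj[of B]]
  have PQ: "?P (x - ?P x) = 0" for x using p(2)[OF p(1)[of x]] by (simp add: diff)
  have PF: "?P (F x) = f (?P x)" if "?P x \<in> D" for x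
    using p(2)[of "f (?P x)"] that fD(2) by (auto simp: F_def add PQ)
  have Hc: "h \<bullet> c = 0" if "h \<in> H" "c \<in> C" for h c
    using p(4)[OF that(2), of h] p(2)[OF that(1)] by simp
  have Fc: "F x \<bullet> c = x \<bullet> c" if "?P x \<in> D" "c \<in> C" for x c
    using that fD(2) Hc[of "f (?P x)" c] Hc[of "?P x" c] p(1)[of x]
    by (auto simp: F_def inner_add_left inner_diff_left)
  have img: "F ` cylinder_over B C D = cylinder_over B C (f ` D)"
  proof
    show "F ` cylinder_over B C D \<subseteq> cylinder_over B C (f ` D)"
      by (auto simp: cylinder_over_def PF Fc)
    show "cylinder_over B C (f ` D) \<subseteq> F ` cylinder_over B C D"
    proof
      fix y assume y: "y \<in> cylinder_over B C (f ` D)"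
      then obtain d where d: "d \<in> D" "?P y = f d" by (auto simp: cylinder_over_def)
      let ?x = "d + (y - ?P y)"
      have Px: "?P ?x = d" using p(2)[of d] d(1) D(2) by (auto simp: add PQ)
      have "F ?x = y" unfolding F_def Px using d by simp
      moreover have "?x \<in> cylinder_over B C D"
        unfolding cylinder_over_def mem_Collect_eq Px
        using y d D(2) Hc p(1)[of y] by (auto simp: cylinder_over_def inner_add_left inner_diff_left)
      ultimately show "y \<in> F ` cylinder_over B C D" by force
    qed
  qed
  have "emeasure lborel (F ` cylinder_over B C D) \<le> emeasure lborel (cylinder_over B C D)"
  proof (rule emeasure_lipschitz_image_le)
    fix x y assume "x \<in> cylinder_over B C D" "y \<in> cylinder_over B C D"
    then have xy: "?P x \<in> D" "?P y \<in> D" by (auto simp: cylinder_over_def)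
    have "(norm (F x - F y))\<^sup>2 = (norm (?P (F x - F y)))\<^sup>2 + (norm ((F x - F y) - ?P (F x - F y)))\<^sup>2"
      by (rule p(7))
    also have "?P (F x - F y) = f (?P x) - f (?P y)" by (simp add: diff PF xy)
    also have "(F x - F y) - (f (?P x) - f (?P y)) = (x - y) - ?P (x - y)"
      by (simp add: F_def diff)
    also have "(norm (f (?P x) - f (?P y)))\<^sup>2 + (norm ((x - y) - ?P (x - y)))\<^sup>2
        \<le> (norm (?P (x - y)))\<^sup>2 + (norm ((x - y) - ?P (x - y)))\<^sup>2"
      using lip[OF xy] by (intro add_right_mono) (simp add: diff power_mono)
    also have "(norm (?P (x - y)))\<^sup>2 + (norm ((x - y) - ?P (x - y)))\<^sup>2 = (norm (x - y))\<^sup>2"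
      by (rule p(7)[symmetric])
    finally show "norm (F x - F y) \<le> norm (x - y)" by (rule power2_le_imp_le[OF _ norm_ge_zero])
  qed (simp_all only: img sets_cylinder_over[OF b(2) D(1)] sets_cylinder_over[OF b(2) fD(1)])
  then show ?thesis
    unfolding emeasure_subspace_cylinder[OF s D(1)] emeasure_subspace_cylinder[OF s fD(1)] img .
qed

lemma emeasure_subspace_midpoints:
  fixes H :: "'a::euclidean_space set"
  assumes H: "subspace H" and m: "X \<in> sets borel" "Y \<in> sets borel" "Z \<in> sets borel"
    and mid: "\<And>x y. x \<in> X \<Longrightarrow> y \<in> Y \<Longrightarrow> (1/2) *\<^sub>R (x + y) \<in> Z"
  shows "emeasure (subspace_lborel H) X * emeasure (subspace_lborel H) Y \<le> (emeasure (subspace_lborel H) Z)\<^sup>2"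
proof -
  obtain B C where s: "split_basis H B C" using ex_split_basis[OF H] by blast
  note b = split_basis_facts[OF s] and p = coord_proj_facts[OF s]
  note lin = linear_add[OF linear_coord_proj[of B]] linear_scale[OF linear_coord_proj[of B]]
  show ?thesis
    unfolding emeasure_subspace_cylinder[OF s m(1)] emeasure_subspace_cylinder[OF s m(2)]
      emeasure_subspace_cylinder[OF s m(3)]
  proof (rule emeasure_lborel_midpoints)
    fix x y assume xy: "x \<in> cylinder_over B C X" "y \<in> cylinder_over B C Y"
    have "((1/2) *\<^sub>R (x + y)) \<bullet> c \<in> {0..1}" if "c \<in> C" for c
    proof -
      have "x \<bullet> c \<in> {0..1}" "y \<bullet> c \<in> {0..1}" using xy that by (auto simp: cylinder_over_def)
      then show ?thesis by (auto simp: inner_add_left)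
    qed
    then show "(1/2) *\<^sub>R (x + y) \<in> cylinder_over B C Z"
      using xy mid[of "coord_proj B x" "coord_proj B y"] by (auto simp: cylinder_over_def lin)
  qed (intro sets_cylinder_over b m)+
qed

section \<open>Surface area as the least growth rate of outer parallel bodies\<close>

text \<open>The body whose volume enters the definition of surface area.\<close>

definition outer_parallel :: "'a::euclidean_space set \<Rightarrow> 'a set \<Rightarrow> real \<Rightarrow> 'a set"
  where "outer_parallel H A t = {x + t *\<^sub>R u | x u. x \<in> A \<and> u \<in> cball 0 1 \<inter> H}"

lemma compact_combinations:
  fixes A B :: "'a::euclidean_space set"
  assumes "compact A" "compact B"
  shows "compact {a *\<^sub>R x + b *\<^sub>R y | x y. x \<in> A \<and> y \<in> B}"
proof -
  have "{a *\<^sub>R x + b *\<^sub>R y | x y. x \<in> A \<and> y \<in> B} = (\<lambda>(x, y). a *\<^sub>R x + b *\<^sub>R y) ` (A \<times> B)"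
    by (auto simp: image_iff)
  also have "compact \<dots>"
    using assms by (intro compact_continuous_image compact_Times)
      (auto simp: case_prod_unfold intro!: continuous_intros)
  finally show ?thesis .
qed

lemma compact_cball_subspace: "subspace H \<Longrightarrow> compact (cball a r \<inter> H)"
  for H :: "'a::euclidean_space set"
  by (intro compact_Int_closed compact_cball closed_subspace)

lemma compact_outer_parallel:
  fixes H :: "'a::euclidean_space set"
  assumes "subspace H" "compact A"
  shows "compact (outer_parallel H A t)"
  using compact_combinations[OF assms(2) compact_cball_subspace[OF assms(1)], of 1 t 0 1]
  by (simp add: outer_parallel_def)

lemma compact_imp_borel_bounded:
  fixes A :: "'a::euclidean_space set"
  assumes "compact A"
  shows "A \<in> sets borel" "bounded A"
  using assms by (auto simp: compact_imp_bounded borel_closed compact_imp_closed)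

lemma mem_outer_parallel_iff:
  fixes H :: "'a::euclidean_space set"
  assumes H: "subspace H" and A: "compact A" "A \<noteq> {}" "A \<subseteq> H" and t: "0 < t"
  shows "x \<in> outer_parallel H A t \<longleftrightarrow> x \<in> H \<and> dist x (closest_point A x) \<le> t"
proof
  assume "x \<in> outer_parallel H A t"
  then obtain a u where au: "x = a + t *\<^sub>R u" "a \<in> A" "norm u \<le> 1" "u \<in> H"
    by (auto simp: outer_parallel_def)
  have "dist x (closest_point A x) \<le> dist x a"
    using closest_point_le[OF compact_imp_closed[OF A(1)] au(2)] .
  also have "\<dots> \<le> t" using au t by (simp add: dist_norm mult_left_le)
  finally show "x \<in> H \<and> dist x (closest_point A x) \<le> t"
    using au A(3) H by (auto intro!: subspace_add subspace_scale)
next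
  assume x: "x \<in> H \<and> dist x (closest_point A x) \<le> t"
  let ?p = "closest_point A x"
  have p: "?p \<in> A" using closest_point_in_set compact_imp_closed A by blast
  have "x = ?p + t *\<^sub>R ((1/t) *\<^sub>R (x - ?p))" using t by simp
  moreover have "(1/t) *\<^sub>R (x - ?p) \<in> cball 0 1 \<inter> H"
    using x t p A(3) H by (auto simp: dist_norm divide_simps intro!: subspace_scale subspace_diff)
  ultimately show "x \<in> outer_parallel H A t" using p unfolding outer_parallel_def by blast
qed

lemma closest_point_normal:
  fixes A :: "'a::euclidean_space set"
  assumes "closed A" "convex A" "p \<in> A" and v: "\<And>a. a \<in> A \<Longrightarrow> v \<bullet> (a - p) \<le> 0"
  shows "closest_point A (p + v) = p"
proof (rule closest_point_unique[symmetric])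
  show "\<forall>z\<in>A. dist (p + v) p \<le> dist (p + v) z"
  proof
    fix z assume z: "z \<in> A"
    have "(norm v)\<^sup>2 \<le> (norm v)\<^sup>2 - 2 * (v \<bullet> (z - p)) + (norm (z - p))\<^sup>2"
      using v[OF z] zero_le_power2[of "norm (z - p)"] by linarith
    also have "\<dots> = (norm (v - (z - p)))\<^sup>2"
      by (simp add: power2_norm_eq_inner inner_diff_left inner_diff_right inner_commute)
    finally have "norm v \<le> norm (v - (z - p))" by (rule power2_le_imp_le) simp
    then show "dist (p + v) p \<le> dist (p + v) z" by (simp add: dist_norm algebra_simps)
  qed
qed (use assms in auto)

text \<open>Pushing points away from a convex set by \<open>t\<close> along outer normals does not bring them closer:
  the normal directions form a monotone field. Here \<open>p\<close>, \<open>p'\<close> are the nearest points in the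
  convex set and \<open>u\<close>, \<open>u'\<close> the normals there.\<close>

lemma norm_normal_shift_le:
  fixes p p' u u' :: "'a::real_inner"
  assumes "norm u = 1" "norm u' = 1" "u \<bullet> (p' - p) \<le> 0" "u' \<bullet> (p - p') \<le> 0"
    and "0 \<le> a" "0 \<le> a'" "0 \<le> t"
  shows "norm ((p + a *\<^sub>R u) - (p' + a' *\<^sub>R u')) \<le> norm ((p + (a + t) *\<^sub>R u) - (p' + (a' + t) *\<^sub>R u'))"
proof -
  define Y where "Y = (p + a *\<^sub>R u) - (p' + a' *\<^sub>R u')"
  have uu: "u \<bullet> u = 1" "u' \<bullet> u' = 1" using assms(1,2) by (simp_all add: norm_eq_1)
  have c: "u \<bullet> u' \<le> 1" using norm_cauchy_schwarz[of u u'] assms(1,2) by simp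
  have "Y \<bullet> (u - u') = - (u \<bullet> (p' - p)) - (u' \<bullet> (p - p')) + (a + a') * (1 - u \<bullet> u')"
    by (simp add: Y_def inner_diff_left inner_diff_right inner_add_left inner_add_right uu
        inner_commute algebra_simps)
  also have "0 \<le> \<dots>"
    using assms(3-6) c by (intro add_nonneg_nonneg mult_nonneg_nonneg) auto
  finally have mono: "0 \<le> Y \<bullet> (u - u')" .
  have X: "(p + (a + t) *\<^sub>R u) - (p' + (a' + t) *\<^sub>R u') = Y + t *\<^sub>R (u - u')"
    by (simp add: Y_def algebra_simps)
  have "(norm Y)\<^sup>2 \<le> (norm Y)\<^sup>2 + 2 * t * (Y \<bullet> (u - u')) + t\<^sup>2 * (norm (u - u'))\<^sup>2"
    using mono assms(7) by simp
  also have "\<dots> = (norm (Y + t *\<^sub>R (u - u')))\<^sup>2"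
  proof -
    have "(norm Y)\<^sup>2 + 2 * t * (Y \<bullet> w) + t\<^sup>2 * (norm w)\<^sup>2 = (norm (Y + t *\<^sub>R w))\<^sup>2" for w
      by (simp only: power2_norm_eq_inner)
        (simp add: inner_add_left inner_add_right inner_commute power2_eq_square)
    then show ?thesis .
  qed
  finally have "norm Y \<le> norm (Y + t *\<^sub>R (u - u'))" by (rule power2_le_imp_le) simp
  then show ?thesis unfolding X Y_def[symmetric] .
qed

lemma vol_in_Diff:
  fixes H :: "'a::euclidean_space set"
  assumes "subspace H" "compact A" "compact A'" "A \<subseteq> A'"
  shows "vol_in H (A' - A) = vol_in H A' - vol_in H A"
  using assms emeasure_subspace_finite[OF assms(1)] compact_imp_borel_bounded
  by (intro measure_Diff) (auto simp: less_top)

text \<open>Moving points at distance between \<open>t\<close> and \<open>s + t\<close> towards \<open>A\<close> by \<open>t\<close> maps that shell onto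
  the shell at distance between 0 and \<open>s\<close>. Since the inverse motion expands distances, the map is
  1-Lipschitz, and outer shells of equal width are at least as large as inner ones.\<close>

lemma outer_parallel_superadditive:
  fixes H :: "'a::euclidean_space set"
  assumes H: "subspace H" and A: "compact A" "convex A" "A \<noteq> {}" "A \<subseteq> H" and st: "0 < s" "0 < t"
  shows "(vol_in H (outer_parallel H A s) - vol_in H A) + (vol_in H (outer_parallel H A t) - vol_in H A)
    \<le> vol_in H (outer_parallel H A (s + t)) - vol_in H A"
proof -
  let ?P = "outer_parallel H A" and ?c = "closest_point A"
  have clo: "closed A" using A compact_imp_closed by auto
  have cA: "?c x \<in> A" for x using closest_point_in_set clo A by auto
  have memA: "x \<in> A \<longleftrightarrow> x = ?c x" for x using cA closest_point_self by metis
  define D where "D = ?P (s + t) - ?P t"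
  define E where "E = ?P s - A"
  define u where "u x = (1 / dist x (?c x)) *\<^sub>R (x - ?c x)" for x
  define g where "g x = x - t *\<^sub>R u x" for x
  have memD: "x \<in> D \<longleftrightarrow> x \<in> H \<and> t < dist x (?c x) \<and> dist x (?c x) \<le> s + t" for x
    using mem_outer_parallel_iff[OF H A(1,3,4)] st by (auto simp: D_def)
  have memE: "x \<in> E \<longleftrightarrow> x \<in> H \<and> 0 < dist x (?c x) \<and> dist x (?c x) \<le> s" for x
    using mem_outer_parallel_iff[OF H A(1,3,4)] st memA by (auto simp: E_def)
  have form: "x = ?c x + dist x (?c x) *\<^sub>R u x" "norm (u x) = 1" "\<And>a. a \<in> A \<Longrightarrow> u x \<bullet> (a - ?c x) \<le> 0"
    if "0 < dist x (?c x)" for x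
  proof -
    show "x = ?c x + dist x (?c x) *\<^sub>R u x" "norm (u x) = 1"
      using that by (auto simp: u_def dist_norm)
    show "u x \<bullet> (a - ?c x) \<le> 0" if "a \<in> A" for a
      using closest_point_dot[OF A(2) clo that, of x] \<open>0 < dist x (?c x)\<close>
      by (simp add: u_def divide_simps)
  qed
  have shift: "?c (?c x + r *\<^sub>R u x) = ?c x" "dist (?c x + r *\<^sub>R u x) (?c x) = r"
    if "0 < dist x (?c x)" "0 \<le> r" for x r
  proof -
    show "?c (?c x + r *\<^sub>R u x) = ?c x"
      using form(3)[OF that(1)] that(2) by (intro closest_point_normal clo A cA) (auto simp: mult_nonneg_nonpos)
    show "dist (?c x + r *\<^sub>R u x) (?c x) = r" using form(2)[OF that(1)] that(2) by (simp add: dist_norm)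
  qed
  have uH: "u x \<in> H" if "x \<in> H" for x
    using that A(4) cA[of x] H by (auto simp: u_def intro!: subspace_scale subspace_diff)
  have gform: "g x = ?c x + (dist x (?c x) - t) *\<^sub>R u x" if "x \<in> D" for x
  proof -
    have "0 < dist x (?c x)" using that st by (auto simp: memD)
    from form(1)[OF this] have "g x = (?c x + dist x (?c x) *\<^sub>R u x) - t *\<^sub>R u x" by (simp add: g_def)
    then show ?thesis by (simp add: algebra_simps)
  qed
  have gD: "g ` D = E"
  proof
    show "g ` D \<subseteq> E"
    proof
      fix y assume "y \<in> g ` D"
      then obtain x where x: "x \<in> D" "y = g x" by auto
      then have d: "0 < dist x (?c x)" "0 \<le> dist x (?c x) - t" using st by (auto simp: memD)
      have "y \<in> H" using x uH H by (auto simp: g_def memD intro!: subspace_diff subspace_scale)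
      then show "y \<in> E" using x shift[OF d] gform[OF x(1)] by (auto simp: memE memD)
    qed
    show "E \<subseteq> g ` D"
    proof
      fix y assume y: "y \<in> E"
      then have d: "0 < dist y (?c y)" "0 \<le> dist y (?c y) + t" using st by (auto simp: memE)
      let ?x = "?c y + (dist y (?c y) + t) *\<^sub>R u y"
      note sh = shift[OF d]
      have "?x \<in> H" using y uH cA[of y] A(4) H by (auto simp: memE intro!: subspace_add subspace_scale)
      then have xD: "?x \<in> D" using sh y by (auto simp: memD memE)
      have "u ?x = u y" 
      proof -
        have "0 < dist y (?c y) + t" by (rule add_pos_pos[OF d(1) st(2)])
        then show ?thesis unfolding u_def[of ?x] sh by simp
      qed
      then have "g ?x = ?c y + dist y (?c y) *\<^sub>R u y" using gform[OF xD] unfolding sh by simp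
      then have "g ?x = y" using form(1)[OF d(1)] by simp
      then show "y \<in> g ` D" using xD by force
    qed
  qed
  have P: "compact (?P r)" for r by (rule compact_outer_parallel[OF H A(1)])
  note Pb = compact_imp_borel_bounded[OF P] and Ab = compact_imp_borel_bounded[OF A(1)]
  have sub1: "?P t \<subseteq> ?P (s + t)"
    using mem_outer_parallel_iff[OF H A(1,3,4)] st by fastforce
  have sub2: "A \<subseteq> ?P s" using memA mem_outer_parallel_iff[OF H A(1,3,4) st(1)] A(4) st by fastforce
  have mD: "D \<subseteq> H" "D \<in> sets borel" "bounded D"
    using memD Pb by (blast, auto simp: D_def intro: bounded_diff)
  have mE: "E \<in> sets borel" "E \<subseteq> H" using Pb Ab memE by (auto simp: E_def)
  have "emeasure (subspace_lborel H) (g ` D) \<le> emeasure (subspace_lborel H) D"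
  proof (rule emeasure_subspace_lipschitz_image_le[OF H])
    fix x y assume xy: "x \<in> D" "y \<in> D"
    then have d: "0 < dist x (?c x)" "0 < dist y (?c y)" "0 \<le> dist x (?c x) - t" "0 \<le> dist y (?c y) - t"
      using st by (auto simp: memD)
    have "norm (g x - g y) = norm ((?c x + (dist x (?c x) - t) *\<^sub>R u x) - (?c y + (dist y (?c y) - t) *\<^sub>R u y))"
      by (simp add: gform xy)
    also have "\<dots> \<le> norm ((?c x + (dist x (?c x) - t + t) *\<^sub>R u x) - (?c y + (dist y (?c y) - t + t) *\<^sub>R u y))"
      using d form st cA by (intro norm_normal_shift_le) auto
    also have "\<dots> = norm (x - y)" using form(1)[OF d(1)] form(1)[OF d(2)] by simp
    finally show "norm (g x - g y) \<le> norm (x - y)" .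
  qed (use mD mE gD in simp_all)
  then have "vol_in H E \<le> vol_in H D"
    unfolding gD measure_def using emeasure_subspace_finite[OF H mD(3,2)] by (intro enn2real_mono) auto
  then show ?thesis
    unfolding D_def E_def vol_in_Diff[OF H P P sub1] vol_in_Diff[OF H A(1) P sub2] by simp
qed

text \<open>Fekete's argument at zero: \<open>N\<close> steps of length \<open>s\<close> fit below \<open>t0\<close> with a remainder
  less than \<open>s\<close>, so \<open>W s / s\<close> is at most \<open>W t0 / (t0 - s)\<close>.\<close>

lemma superadditive_quotient_tendsto_Inf:
  fixes W :: "real \<Rightarrow> real"
  assumes nn: "\<And>t. 0 < t \<Longrightarrow> 0 \<le> W t"
    and sup: "\<And>s t. 0 < s \<Longrightarrow> 0 < t \<Longrightarrow> W s + W t \<le> W (s + t)"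
  shows "((\<lambda>t. W t / t) \<longlongrightarrow> (INF t\<in>{0<..}. W t / t)) (at_right 0)"
proof (rule order_tendstoI)
  let ?L = "INF t\<in>{0<..}. W t / t"
  have bdd: "bdd_below ((\<lambda>t. W t / t) ` {0<..})"
    by (rule bdd_belowI[of _ 0]) (use nn in auto)
  have ge: "?L \<le> W t / t" if "0 < t" for t
    using that by (intro cINF_lower bdd) auto
  have ev: "eventually (\<lambda>t::real. 0 < t) (at_right 0)" by (rule eventually_at_right_less)
  show "eventually (\<lambda>t. a < W t / t) (at_right 0)" if "a < ?L" for a
    using ev by eventually_elim (use ge that in \<open>auto intro: less_le_trans\<close>)
  fix a assume "?L < a"
  then obtain t0 where t0: "0 < t0" "W t0 / t0 < a"
    using cINF_less_iff[OF _ bdd] by auto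
  have mono: "W s \<le> W t" if "0 < s" "s \<le> t" for s t
    using sup[of s "t - s"] nn[of "t - s"] that by (cases "s = t") auto
  have mult: "real (Suc n) * W s \<le> W (real (Suc n) * s)" if "0 < s" for n s
  proof (induction n)
    case (Suc n)
    have "real (Suc (Suc n)) * W s = real (Suc n) * W s + W s" by (simp add: algebra_simps)
    also have "\<dots> \<le> W (real (Suc n) * s) + W s" using Suc by simp
    also have "\<dots> \<le> W (real (Suc n) * s + s)" using that by (intro sup) auto
    finally show ?case by (simp add: algebra_simps)
  qed simp
  have bound: "W s / s \<le> W t0 / (t0 - s)" if s: "0 < s" "s < t0" for s
  proof -
    define N where "N = nat \<lfloor>t0 / s\<rfloor>"
    have "1 \<le> t0 / s" using s by simp
    then have N: "1 \<le> N" "real N \<le> t0 / s" "t0 / s < real N + 1"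
      unfolding N_def by linarith+
    have N1: "real N * s \<le> t0" "t0 - s < real N * s" using N s by (simp_all add: field_simps)
    have "real N * W s \<le> W (real N * s)" using mult[OF s(1), of "N - 1"] N(1) by simp
    also have "\<dots> \<le> W t0" using N1 N s by (intro mono) auto
    finally have "W s / s \<le> W t0 / (real N * s)" using N s by (simp add: field_simps)
    also have "\<dots> \<le> W t0 / (t0 - s)" using N1 s nn[OF t0(1)] by (intro divide_left_mono) auto
    finally show ?thesis .
  qed
  have "((\<lambda>s. W t0 / (t0 - s)) \<longlongrightarrow> W t0 / (t0 - 0)) (at_right 0)"
    using t0 by (intro tendsto_intros) auto
  then have "eventually (\<lambda>s. W t0 / (t0 - s) < a) (at_right 0)" using t0 by (intro order_tendstoD) auto
  moreover have "eventually (\<lambda>s. s < t0) (at_right 0)"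
    using t0 by (auto simp: eventually_at_right_field)
  ultimately show "eventually (\<lambda>t. W t / t < a) (at_right 0)"
    using ev by eventually_elim (use bound in fastforce)
qed

text \<open>The limit defining surface area exists and is an infimum. The infimum is what makes surface
  area upper semicontinuous later on.\<close>

lemma surface_area_in_facts:
  fixes H :: "'a::euclidean_space set"
  assumes H: "subspace H" and A: "compact A" "convex A" "A \<noteq> {}" "A \<subseteq> H"
  shows surface_area_in_tendsto:
      "((\<lambda>t. (vol_in H (outer_parallel H A t) - vol_in H A) / t) \<longlongrightarrow> surface_area_in H A) (at_right 0)"
    and surface_area_in_le:
      "\<And>t. 0 < t \<Longrightarrow> surface_area_in H A \<le> (vol_in H (outer_parallel H A t) - vol_in H A) / t"
proof -
  let ?W = "\<lambda>t. vol_in H (outer_parallel H A t) - vol_in H A"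
  have nn: "0 \<le> ?W t" if "0 < t" for t
  proof -
    have "A \<subseteq> outer_parallel H A t"
    proof
      fix x assume "x \<in> A"
      then have "x = x + t *\<^sub>R 0 \<and> x \<in> A \<and> 0 \<in> cball 0 1 \<inter> H" using subspace_0[OF H] by simp
      then show "x \<in> outer_parallel H A t" unfolding outer_parallel_def by blast
    qed
    then show ?thesis
      using vol_in_mono[OF H] compact_imp_borel_bounded[OF A(1)]
        compact_imp_borel_bounded[OF compact_outer_parallel[OF H A(1)]] by simp
  qed
  have lim: "((\<lambda>t. ?W t / t) \<longlongrightarrow> (INF t\<in>{0<..}. ?W t / t)) (at_right 0)"
    using nn outer_parallel_superadditive[OF H A] by (rule superadditive_quotient_tendsto_Inf)
  have S: "surface_area_in H A = (INF t\<in>{0<..}. ?W t / t)"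
    unfolding surface_area_in_def outer_parallel_def[symmetric]
    by (rule tendsto_Lim[OF _ lim]) simp
  show "((\<lambda>t. ?W t / t) \<longlongrightarrow> surface_area_in H A) (at_right 0)" using lim S by simp
  show "surface_area_in H A \<le> ?W t / t" if "0 < t" for t
    unfolding S using that nn by (intro cINF_lower bdd_belowI[of _ 0]) auto
qed

section \<open>The isoperimetric inequality\<close>

text \<open>Brunn--Minkowski for two bodies of equal volume and ratios \<open>(1/2)^j\<close>: the next combination
  contains the midpoints of the previous one with points of the convex set \<open>A\<close>. This suffices for a
  derivative at 0.\<close>

lemma vol_in_convex_combination_ge:
  fixes H :: "'a::euclidean_space set"
  assumes H: "subspace H" and A: "compact A" "convex A" "A \<noteq> {}" and B: "compact B"
    and v: "vol_in H A = v" "vol_in H B = v" "0 < v"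
  shows "v \<le> vol_in H {(1 - (1/2)^j) *\<^sub>R a + (1/2)^j *\<^sub>R b | a b. a \<in> A \<and> b \<in> B}"
proof (induction j)
  case 0
  have "{(1 - (1/2)^0) *\<^sub>R a + (1/2)^0 *\<^sub>R b | a b. a \<in> A \<and> b \<in> B} = B" using A(3) by auto
  then show ?case using v by simp
next
  case (Suc j)
  let ?M = "\<lambda>j. {(1 - (1/2)^j) *\<^sub>R a + (1/2)^j *\<^sub>R b | a b. a \<in> A \<and> b \<in> B}"
  let ?l = "(1/2::real)^j"
  have c: "compact (?M j)" for j by (rule compact_combinations[OF A(1) B])
  have l: "0 < ?l" "?l \<le> 1" by (auto simp: power_le_one)
  have "emeasure (subspace_lborel H) (?M j) * emeasure (subspace_lborel H) A
      \<le> (emeasure (subspace_lborel H) (?M (Suc j)))\<^sup>2"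
  proof (rule emeasure_subspace_midpoints[OF H])
    fix x y assume x: "x \<in> ?M j" and y: "y \<in> A"
    then obtain a b where ab: "x = (1 - ?l) *\<^sub>R a + ?l *\<^sub>R b" "a \<in> A" "b \<in> B" by auto
    let ?z = "((1 - ?l) / (2 - ?l)) *\<^sub>R a + (1 / (2 - ?l)) *\<^sub>R y"
    have "?z \<in> A"
    proof -
      \<comment> \<open>the weights of \<open>a\<close> and \<open>y\<close> in the midpoint, normalised by their sum \<open>(2 - l) / 2\<close>\<close>
      have "0 \<le> (1 - l) / (2 - l)" "0 \<le> 1 / (2 - l)" "(1 - l) / (2 - l) + 1 / (2 - l) = 1"
        if "l \<le> 1" for l :: real
        using that by (auto simp: divide_simps)
      from this[OF l(2)] ab y show ?thesis by (intro convexD[OF A(2)]) auto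
    qed
    moreover have "(1/2) *\<^sub>R (x + y) = (1 - (1/2)^Suc j) *\<^sub>R ?z + (1/2)^Suc j *\<^sub>R b"
    proof -
      have gen: "(1 - l/2) * ((1 - l) / (2 - l)) = (1 - l) / 2" "(1 - l/2) * (1 / (2 - l)) = 1/2"
        if "l \<le> 1" for l :: real
      proof -
        have k: "(1 - l/2) / (2 - l) = 1/2" using that by (simp add: field_simps)
        then show "(1 - l/2) * (1 / (2 - l)) = 1/2" by simp
        have "(1 - l/2) * ((1 - l) / (2 - l)) = (1 - l/2) / (2 - l) * (1 - l)" by simp
        then show "(1 - l/2) * ((1 - l) / (2 - l)) = (1 - l) / 2" unfolding k by simp
      qed
      have comb: "(1/2) *\<^sub>R ((1 - l) *\<^sub>R a + l *\<^sub>R b + y)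
          = (1 - l/2) *\<^sub>R (((1 - l) / (2 - l)) *\<^sub>R a + (1 / (2 - l)) *\<^sub>R y) + (l/2) *\<^sub>R b"
        if "l \<le> 1" for l :: real
        unfolding scaleR_add_right scaleR_scaleR gen[OF that] by simp
      have "(1/2::real)^Suc j = ?l / 2" by simp
      then show ?thesis unfolding ab(1) by (simp only: comb[OF l(2)])
    qed
    ultimately show "(1/2) *\<^sub>R (x + y) \<in> ?M (Suc j)" using ab(3) by blast
  qed (rule compact_imp_borel_bounded(1)[OF c] compact_imp_borel_bounded(1)[OF A(1)])+
  then have "vol_in H (?M j) * v \<le> (vol_in H (?M (Suc j)))\<^sup>2"
    using emeasure_vol_in[OF H compact_imp_borel_bounded(2,1)[OF c], of j]
      emeasure_vol_in[OF H compact_imp_borel_bounded(2,1)[OF c], of "Suc j"]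
      emeasure_vol_in[OF H compact_imp_borel_bounded(2,1)[OF A(1)]] v
    by (simp add: ennreal_power flip: ennreal_mult)
  moreover have "v * v \<le> vol_in H (?M j) * v" using Suc v(3) by (intro mult_right_mono) auto
  ultimately have "v\<^sup>2 \<le> (vol_in H (?M (Suc j)))\<^sup>2" by (simp add: power2_eq_square)
  then show ?case by (rule power2_le_imp_le) simp
qed

text \<open>Rescaling the combinations of \<open>A\<close> with the ball of the same volume gives
  \<open>(1 + \<tau>) ^ dim H * vol_in H A\<close> as a lower bound for the volume of the outer parallel body at
  distance \<open>\<tau> * R\<close>, for a sequence of \<open>\<tau>\<close> tending to 0. Bernoulli's inequality bounds the
  difference quotients.\<close>

theorem isoperimetric_inequality:
  fixes H :: "'a::euclidean_space set"
  assumes H: "subspace H" and A: "compact A" "convex A" "A \<subseteq> H"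
    and R: "0 < R" "vol_in H (cball 0 R \<inter> H) = vol_in H A" and pos: "0 < vol_in H A"
  shows "real (dim H) * vol_in H A / R \<le> surface_area_in H A"
proof -
  let ?v = "vol_in H A" and ?B = "cball 0 R \<inter> H"
  have ne: "A \<noteq> {}" using pos by auto
  \<comment> \<open>\<open>(1 - l) A + l B = (1 - l) (A + \<tau> B)\<close> with \<open>\<tau> = l / (1 - l)\<close>, hence \<open>1 / (1 - l) = 1 + \<tau>\<close>\<close>
  define \<tau> where "\<tau> j = (1/2)^Suc j / (1 - (1/2::real)^Suc j)" for j
  have l: "0 < (1/2::real)^Suc j" "(1/2::real)^Suc j < 1" for j
    by (simp, rule power_less_one_iff[THEN iffD2], auto)
  have \<tau>: "0 < \<tau> j" for j using l[of j] by (simp add: \<tau>_def)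
  have quot: "real (dim H) * ?v / R \<le> (vol_in H (outer_parallel H A (\<tau> j * R)) - ?v) / (\<tau> j * R)" for j
  proof -
    let ?l = "(1/2::real)^Suc j"
    let ?P = "outer_parallel H A (\<tau> j * R)"
    let ?M = "{(1 - ?l) *\<^sub>R a + ?l *\<^sub>R b | a b. a \<in> A \<and> b \<in> ?B}"
    note P = compact_outer_parallel[OF H A(1), of "\<tau> j * R"]
    have "?M \<subseteq> (\<lambda>x. (1 - ?l) *\<^sub>R x) ` ?P"
    proof
      fix x assume "x \<in> ?M"
      then obtain a b where ab: "x = (1 - ?l) *\<^sub>R a + ?l *\<^sub>R b" "a \<in> A" "norm b \<le> R" "b \<in> H" by auto
      have "a + (\<tau> j * R) *\<^sub>R ((1/R) *\<^sub>R b) \<in> ?P"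
        using ab R H unfolding outer_parallel_def
        by (intro CollectI exI[of _ a] exI[of _ "(1/R) *\<^sub>R b"]) (auto simp: divide_simps intro!: subspace_scale)
      moreover have "x = (1 - ?l) *\<^sub>R (a + (\<tau> j * R) *\<^sub>R ((1/R) *\<^sub>R b))"
      proof -
        have "(1 - ?l) * \<tau> j = ?l" using l[of j] by (simp add: \<tau>_def del: power_Suc)
        then show ?thesis unfolding ab(1) using R by (simp add: scaleR_add_right del: power_Suc)
      qed
      ultimately show "x \<in> (\<lambda>x. (1 - ?l) *\<^sub>R x) ` ?P" by blast
    qed
    then have "vol_in H ?M \<le> vol_in H ((\<lambda>x. (1 - ?l) *\<^sub>R x) ` ?P)"
      by (intro vol_in_mono[OF H] compact_imp_borel_bounded[OF compact_scaling[OF P]]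
          compact_imp_borel_bounded[OF compact_combinations[OF A(1) compact_cball_subspace[OF H]]])
    also have "\<dots> = (1 - ?l) ^ dim H * vol_in H ?P"
      using l[of j] compact_imp_borel_bounded[OF P] by (intro vol_in_scale[OF H]) auto
    finally have "?v \<le> (1 - ?l) ^ dim H * vol_in H ?P"
      using vol_in_convex_combination_ge[OF H A(1,2) ne compact_cball_subspace[OF H] refl R(2) pos, of "Suc j"]
      by (simp del: power_Suc)
    then have "(1 + \<tau> j) ^ dim H * ?v \<le> (1 + \<tau> j) ^ dim H * ((1 - ?l) ^ dim H * vol_in H ?P)"
      using \<tau>[of j] by (intro mult_left_mono) auto
    also have "\<dots> = ((1 + \<tau> j) * (1 - ?l)) ^ dim H * vol_in H ?P" by (simp add: power_mult_distrib)
    also have "(1 + \<tau> j) * (1 - ?l) = 1" 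
    proof -
      have "(1 + x / (1 - x)) * (1 - x) = 1" if "x < 1" for x :: real
        using that by (simp add: field_simps)
      then show ?thesis using l[of j] by (simp add: \<tau>_def del: power_Suc)
    qed
    finally have 1: "(1 + \<tau> j) ^ dim H * ?v \<le> vol_in H ?P" by simp
    have "(1 + real (dim H) * \<tau> j) * ?v \<le> (1 + \<tau> j) ^ dim H * ?v"
      using \<tau>[of j] pos by (intro mult_right_mono Bernoulli_inequality) auto
    with 1 have "real (dim H) * \<tau> j * ?v \<le> vol_in H ?P - ?v" by (simp add: algebra_simps)
    then have "(real (dim H) * \<tau> j * ?v) / (\<tau> j * R) \<le> (vol_in H ?P - ?v) / (\<tau> j * R)"
      using \<tau>[of j] R by (intro divide_right_mono) auto
    moreover have "(real (dim H) * \<tau> j * ?v) / (\<tau> j * R) = real (dim H) * ?v / R"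
      using \<tau>[of j] R by (simp add: field_simps)
    ultimately show ?thesis by simp
  qed
  have "(\<lambda>j. (1/2::real)^Suc j) \<longlonglongrightarrow> 0"
    by (rule LIMSEQ_Suc) (rule LIMSEQ_realpow_zero, auto)
  then have "\<tau> \<longlonglongrightarrow> 0 / (1 - 0)" unfolding \<tau>_def by (intro tendsto_divide tendsto_diff tendsto_const) auto
  then have "(\<lambda>j. \<tau> j * R) \<longlonglongrightarrow> 0" using tendsto_mult_left_zero by fastforce
  then have "filterlim (\<lambda>j. \<tau> j * R) (at_right 0) sequentially"
    using \<tau> R by (intro tendsto_imp_filterlim_at_right) auto
  from filterlim_compose[OF surface_area_in_tendsto[OF H A(1,2) ne A(3)] this]
  have "(\<lambda>j. (vol_in H (outer_parallel H A (\<tau> j * R)) - ?v) / (\<tau> j * R)) \<longlonglongrightarrow> surface_area_in H A" .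
  then show ?thesis by (rule LIMSEQ_le_const) (use quot in blast)
qed

section \<open>A section with the largest ratio of surface area to volume\<close>

lemma outer_parallel_0:
  assumes "subspace H"
  shows "outer_parallel H A 0 = A"
proof -
  have "0 \<in> cball 0 1 \<inter> H" using subspace_0[OF assms] by simp
  then have "(\<exists>u. u \<in> cball 0 1 \<inter> H) = True" by blast
  then show ?thesis by (simp add: outer_parallel_def)
qed

lemma vol_in_orthogonal_image:
  fixes H :: "'a::euclidean_space set" and T :: "'a \<Rightarrow> 'a"
  assumes "orthogonal_transformation T" "subspace H" "A \<in> sets borel"
  shows "vol_in (T ` H) (T ` A) = vol_in H A"
  unfolding measure_def emeasure_subspace_orthogonal_image[OF assms] ..

lemma subspace_orthogonal_image:
  "orthogonal_transformation T \<Longrightarrow> subspace H \<Longrightarrow> subspace (T ` H)"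
  by (simp add: linear_subspace_image orthogonal_transformation_linear)

lemma dim_orthogonal_image:
  fixes H :: "'a::euclidean_space set" and T :: "'a \<Rightarrow> 'a"
  assumes "orthogonal_transformation T"
  shows "dim (T ` H) = dim H"
  using orthogonal_transformation_linear[OF assms]
    inj_on_subset[OF orthogonal_transformation_inj[OF assms] subset_UNIV]
  by (rule dim_image_eq)

text \<open>Enlarging a convex set around an inner ball of radius \<open>r\<close> by the factor \<open>1 + \<delta>\<close> absorbs
  perturbations of size \<open>\<delta> * r\<close>.\<close>

lemma mem_scaled_convex:
  fixes K :: "'a::real_normed_vector set"
  assumes "convex K" "cball 0 r \<subseteq> K" "0 < r" "x \<in> K" "0 \<le> \<delta>" "norm z \<le> \<delta> * r"
  shows "(1 / (1 + \<delta>)) *\<^sub>R (x + z) \<in> K"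
proof (cases "\<delta> = 0")
  case True then show ?thesis using assms by simp
next
  case False
  then have d: "0 < \<delta>" using assms by simp
  have "(1/\<delta>) *\<^sub>R z \<in> K" using assms d by (intro subsetD[OF assms(2)]) (simp add: field_simps)
  then have "(1 / (1 + \<delta>)) *\<^sub>R x + (\<delta> / (1 + \<delta>)) *\<^sub>R ((1/\<delta>) *\<^sub>R z) \<in> K"
    using assms d by (intro convexD) (auto simp: add_divide_distrib[symmetric])
  then show ?thesis using d by (simp add: scaleR_add_right)
qed

text \<open>A rotation that moves \<open>K\<close> little turns the section by \<open>H\<close> into a set contained in a slight
  enlargement of the section by \<open>S ` H\<close>. The bound is uniform in the section, which gives
  continuity of the volumes.\<close>

lemma vol_in_outer_parallel_section_le:
  fixes K :: "'a::euclidean_space set" and S :: "'a \<Rightarrow> 'a"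
  assumes S: "orthogonal_transformation S" and H: "subspace H" and K: "compact K" "convex K"
    and r: "0 < r" "cball 0 r \<subseteq> K" and d: "0 \<le> \<delta>" "\<And>x. x \<in> K \<Longrightarrow> norm (S x - x) \<le> \<delta> * r"
    and t: "0 \<le> t"
  shows "vol_in H (outer_parallel H (K \<inter> H) t)
    \<le> (1 + \<delta>) ^ dim H * vol_in (S ` H) (outer_parallel (S ` H) (K \<inter> S ` H) t)"
proof -
  let ?P = "outer_parallel H (K \<inter> H) t" and ?P' = "outer_parallel (S ` H) (K \<inter> S ` H) t"
  note SH = subspace_orthogonal_image[OF S H]
  have cP: "compact ?P" "compact ?P'"
    using H SH K by (intro compact_outer_parallel compact_Int_closed closed_subspace; simp)+
  have lin: "linear S" by (rule orthogonal_transformation_linear[OF S])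
  have d1: "0 < 1 + \<delta>" using d by simp
  have "S ` ?P \<subseteq> (\<lambda>x. (1 + \<delta>) *\<^sub>R x) ` ?P'"
  proof
    fix y assume "y \<in> S ` ?P"
    then obtain x u where xu: "y = S x + t *\<^sub>R S u" "x \<in> K" "x \<in> H" "norm u \<le> 1" "u \<in> H"
      by (auto simp: outer_parallel_def linear_add[OF lin] linear_scale[OF lin])
    have "(1 / (1 + \<delta>)) *\<^sub>R (x + (S x - x)) \<in> K"
      using xu d r K by (intro mem_scaled_convex) auto
    then have 1: "(1 / (1 + \<delta>)) *\<^sub>R S x \<in> K \<inter> S ` H"
      using xu SH by (auto intro: subspace_scale)
    have "norm ((1 / (1 + \<delta>)) *\<^sub>R S u) \<le> 1"
      using xu d by (simp add: orthogonal_transformation_norm[OF S] divide_simps)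
    then have 2: "(1 / (1 + \<delta>)) *\<^sub>R S u \<in> cball 0 1 \<inter> S ` H"
      using xu SH by (auto intro: subspace_scale)
    have "y = (1 + \<delta>) *\<^sub>R ((1 / (1 + \<delta>)) *\<^sub>R S x + t *\<^sub>R ((1 / (1 + \<delta>)) *\<^sub>R S u))"
      using d1 by (simp add: xu(1) scaleR_add_right)
    then show "y \<in> (\<lambda>x. (1 + \<delta>) *\<^sub>R x) ` ?P'"
      using 1 2 unfolding outer_parallel_def by blast
  qed
  moreover have cS: "compact (S ` ?P)"
    by (intro compact_continuous_image linear_continuous_on cP)
      (simp add: lin flip: linear_conv_bounded_linear)
  ultimately have "vol_in (S ` H) (S ` ?P) \<le> vol_in (S ` H) ((\<lambda>x. (1 + \<delta>) *\<^sub>R x) ` ?P')"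
    by (intro vol_in_mono[OF SH] compact_imp_borel_bounded[OF compact_scaling[OF cP(2)]]
        compact_imp_borel_bounded[OF cS])
  then show ?thesis
    using vol_in_orthogonal_image[OF S H compact_imp_borel_bounded(1)[OF cP(1)]]
      vol_in_scale[OF SH compact_imp_borel_bounded(1)[OF cP(2)] d1] dim_orthogonal_image[OF S]
    by simp
qed

lemma norm_matrix_vector_mult_le:
  fixes A :: "real^'n^'m"
  shows "norm (A *v x) \<le> norm A * norm x"
proof -
  have "norm (A *v x) \<le> L2_set (\<lambda>i. norm x * norm (A $ i)) UNIV"
    unfolding norm_vec_def[of "A *v x"]
  proof (rule L2_set_mono)
    fix i
    have "(A *v x) $ i = A $ i \<bullet> x"
      by (simp add: matrix_vector_mul_component)
    then show "norm ((A *v x) $ i) \<le> norm x * norm (A $ i)"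
      using Cauchy_Schwarz_ineq2[of "A $ i" x] by (simp add: mult.commute)
  qed simp
  also have "\<dots> = norm A * norm x"
    by (simp add: L2_set_right_distrib[symmetric] norm_vec_def mult.commute)
  finally show ?thesis .
qed

lemma compact_orthogonal_matrices: "compact {Q :: real^'n^'n. orthogonal_matrix Q}"
proof -
  have eq: "{Q :: real^'n^'n. orthogonal_matrix Q} = {Q. transpose Q ** Q = mat 1}"
    by (auto simp: orthogonal_matrix)
  have "closed {Q :: real^'n^'n. transpose Q ** Q = mat 1}"
  proof (rule closed_Collect_eq)
    show "continuous_on UNIV (\<lambda>Q :: real^'n^'n. transpose Q ** Q)"
      by (simp add: matrix_matrix_mult_def transpose_def)
        (intro continuous_on_vec_lambda continuous_intros)
  qed simp
  moreover have "bounded {Q :: real^'n^'n. orthogonal_matrix Q}"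
    unfolding bounded_iff
  proof (intro exI ballI)
    fix Q :: "real^'n^'n" assume "Q \<in> {Q. orthogonal_matrix Q}"
    then have "norm (row i Q) = 1" for i
      using orthogonal_matrix_orthonormal_rows by blast
    then have "norm (Q $ i) = 1" for i by (simp add: row_def)
    then show "norm Q \<le> L2_set (\<lambda>i::'n. 1) UNIV" by (simp add: norm_vec_def)
  qed
  ultimately show ?thesis by (simp add: compact_eq_bounded_closed eq)
qed

text \<open>As an infimum of continuous functions \<open>F t\<close>, \<open>\<phi>\<close> has closed superlevel sets; the
  superlevel sets at its own values have the finite intersection property.\<close>

lemma infimum_of_continuous_attains_max:
  fixes F :: "real \<Rightarrow> 'a::euclidean_space \<Rightarrow> real"
  assumes S: "compact S" "S \<noteq> {}"
    and cont: "\<And>t. 0 < t \<Longrightarrow> continuous_on S (F t)"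
    and le: "\<And>t x. 0 < t \<Longrightarrow> x \<in> S \<Longrightarrow> \<phi> x \<le> F t x"
    and lim: "\<And>x. x \<in> S \<Longrightarrow> ((\<lambda>t. F t x) \<longlongrightarrow> \<phi> x) (at_right 0)"
  shows "\<exists>x\<in>S. \<forall>y\<in>S. \<phi> y \<le> \<phi> x"
proof -
  let ?L = "\<lambda>y. {x \<in> S. \<phi> y \<le> \<phi> x}"
  have closed: "closed (?L y)" for y
  proof -
    have "?L y = S \<inter> (\<Inter>t\<in>{0<..}. {x \<in> S. \<phi> y \<le> F t x})"
    proof safe
      fix t :: real and x assume "x \<in> S" "\<phi> y \<le> \<phi> x" "t > 0"
      then show "\<phi> y \<le> F t x" using le[of t x] by simp
    next
      fix x assume x: "x \<in> S" "x \<in> (\<Inter>t\<in>{0<..}. {x \<in> S. \<phi> y \<le> F t x})"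
      have "eventually (\<lambda>t. \<phi> y \<le> F t x) (at_right 0)"
        using eventually_at_right_less[of "0::real"] by eventually_elim (use x in auto)
      then show "\<phi> y \<le> \<phi> x" using tendsto_lowerbound[OF lim[OF x(1)]] by simp
    qed
    also have "closed \<dots>"
    proof (intro closed_Int closed_INT ballI compact_imp_closed[OF S(1)])
      fix t :: real assume "t \<in> {0<..}"
      then show "closed {x \<in> S. \<phi> y \<le> F t x}"
        by (intro continuous_on_closed_Collect_le compact_imp_closed[OF S(1)] cont continuous_on_const)
          simp
    qed
    finally show ?thesis .
  qed
  have "S \<inter> \<Inter> (?L ` S) \<noteq> {}"
  proof (rule compact_imp_fip_image[OF S(1)])
    show "closed (?L y)" for y by (rule closed)
    fix I assume I: "finite I" "I \<subseteq> S"
    show "S \<inter> \<Inter> (?L ` I) \<noteq> {}"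
    proof (cases "I = {}")
      case False
      have "Max (\<phi> ` I) \<in> \<phi> ` I" using I False by (intro Max_in) auto
      then obtain x where x: "x \<in> I" "\<phi> x = Max (\<phi> ` I)" by auto
      then have "\<phi> y \<le> \<phi> x" if "y \<in> I" for y using I that by auto
      then show ?thesis using x I by auto
    qed (use S in simp)
  qed
  then show ?thesis by auto
qed

text \<open>Match orthonormal bases adapted to the two subspaces.\<close>

lemma ex_orthogonal_transformation_image:
  fixes H H' :: "'a::euclidean_space set"
  assumes "subspace H" "subspace H'" "dim H = dim H'"
  shows "\<exists>T :: 'a \<Rightarrow> 'a. orthogonal_transformation T \<and> T ` H = H'"
proof -
  obtain B C where s: "split_basis H B C" using ex_split_basis[OF assms(1)] by blast
  obtain B' C' where s': "split_basis H' B' C'" using ex_split_basis[OF assms(2)] by blast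
  note f = split_basis_facts[OF s] and f' = split_basis_facts[OF s']
  obtain g h where g: "bij_betw g B B'" and h: "bij_betw h C C'"
    using f f' assms(3) finite_same_card_bij by (metis add_left_cancel)
  define k where "k b = (if b \<in> B then g b else h b)" for b
  have kB: "bij_betw k B B'" using g by (rule bij_betw_cong[THEN iffD1, rotated]) (simp add: k_def)
  have "bij_betw k C C'"
    using h by (rule bij_betw_cong[THEN iffD1, rotated]) (use f(8) in \<open>auto simp: k_def\<close>)
  with kB have k: "bij_betw k (B \<union> C) (B' \<union> C')" by (rule bij_betw_combine) (rule f'(8))
  have kin: "k b \<in> B' \<union> C'" if "b \<in> B \<union> C" for b using k that by (auto simp: bij_betw_def)
  have keq: "k b = k c \<longleftrightarrow> b = c" if "b \<in> B \<union> C" "c \<in> B \<union> C" for b c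
    using k that by (auto simp: bij_betw_def inj_on_def)
  define T where "T x = (\<Sum>b\<in>B \<union> C. (x \<bullet> b) *\<^sub>R k b)" for x
  have lin: "linear T"
    unfolding T_def by (auto intro!: linearI simp: inner_add_left scaleR_add_left sum.distrib
        scaleR_sum_right)
  have "orthonormal_basis_of UNIV (B \<union> C)" using s by (simp add: split_basis_def)
  then have ex: "(\<Sum>b\<in>B \<union> C. (x \<bullet> b) *\<^sub>R b) = x" for x by (rule orthonormal_expansion) simp
  have fin: "finite (B \<union> C)" using f by simp
  have "T v \<bullet> T w = v \<bullet> w" for v w
  proof -
    have Tk: "T v \<bullet> k c = v \<bullet> c" if c: "c \<in> B \<union> C" for c
    proof -
      have "T v \<bullet> k c = (\<Sum>b\<in>B \<union> C. (v \<bullet> b) * (k b \<bullet> k c))" by (simp add: T_def inner_sum_left)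
      also have "\<dots> = (\<Sum>b\<in>B \<union> C. if b = c then v \<bullet> b else 0)"
      proof (rule sum.cong)
        fix b assume b: "b \<in> B \<union> C"
        show "(v \<bullet> b) * (k b \<bullet> k c) = (if b = c then v \<bullet> b else 0)"
          using f'(7)[OF kin[OF b] kin[OF c]] keq[OF b c] by simp
      qed simp
      also have "\<dots> = v \<bullet> c" using c fin by (simp add: sum.delta del: Un_iff)
      finally show ?thesis .
    qed
    have "T v \<bullet> T w = (\<Sum>b\<in>B \<union> C. (w \<bullet> b) * (T v \<bullet> k b))" by (simp add: T_def[of w] inner_sum_right)
    also have "\<dots> = (\<Sum>b\<in>B \<union> C. (v \<bullet> b) * (w \<bullet> b))" by (rule sum.cong) (simp_all only: Tk mult.commute)
    also have "\<dots> = v \<bullet> (\<Sum>b\<in>B \<union> C. (w \<bullet> b) *\<^sub>R b)" by (simp add: inner_sum_right mult.commute)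
    finally show ?thesis unfolding ex .
  qed
  then have T: "orthogonal_transformation T" using lin by (simp add: orthogonal_transformation_def)
  have "T b = k b" if "b \<in> B" for b
    unfolding T_def using that fin by (simp add: f(7) if_distrib[of "\<lambda>x. x *\<^sub>R _"] sum.delta cong: if_cong)
  then have "T ` B = B'" using kB by (auto simp: bij_betw_def image_iff)
  moreover have "H = span B" "H' = span B'" using s s' by (auto simp: split_basis_def orthonormal_basis_of_def)
  ultimately have "T ` H = H'" using linear_span_image[OF lin, of B] by simp
  with T show ?thesis by blast
qed

text \<open>Every subspace of dimension \<open>m\<close> is an orthogonal image of a fixed one, so the maximum is
  sought over the compact orthogonal group. At each \<open>t\<close> the difference quotient divided by the
  volume depends continuously on the rotation, and the ratio is the infimum of these.\<close>

theorem section_surface_ratio_attains_max: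
  fixes K :: "(real ^ 'n) set"
  assumes K: "compact K" "convex K" and r: "0 < r" "cball 0 r \<subseteq> K" and m: "m \<le> CARD('n)"
  shows "\<exists>H\<^sub>0 \<in> grassmannian m. \<forall>H \<in> grassmannian m.
      surface_area_in H (K \<inter> H) / vol_in H (K \<inter> H)
        \<le> surface_area_in H\<^sub>0 (K \<inter> H\<^sub>0) / vol_in H\<^sub>0 (K \<inter> H\<^sub>0)"
proof -
  obtain R where R: "\<And>x. x \<in> K \<Longrightarrow> norm x \<le> R"
    using compact_imp_bounded[OF K(1)] by (auto simp: bounded_iff)
  have "0 \<in> K" using r by auto
  then have R0: "0 \<le> R" using R[of 0] by simp
  obtain E :: "(real ^ 'n) set" where E: "subspace E" "dim E = m"
    using choose_subspace_of_subspace[of m "UNIV :: (real ^ 'n) set"] m by (auto simp: dim_UNIV)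
  define OG where "OG = {Q :: real^'n^'n. orthogonal_matrix Q}"
  define X where "X Q = (\<lambda>x. Q *v x) ` E" for Q :: "real^'n^'n"
  define G where "G t Q = vol_in (X Q) (outer_parallel (X Q) (K \<inter> X Q) t)" for t Q
  define \<phi> where "\<phi> Q = surface_area_in (X Q) (K \<inter> X Q) / vol_in (X Q) (K \<inter> X Q)" for Q
  have oQ: "orthogonal_transformation (\<lambda>x. Q *v x)" if "Q \<in> OG" for Q
    using that by (simp add: OG_def orthogonal_transformation_matrix)
  have X: "subspace (X Q)" "dim (X Q) = m" if "Q \<in> OG" for Q
    unfolding X_def using subspace_orthogonal_image[OF oQ[OF that] E(1)] dim_orthogonal_image[OF oQ[OF that]] E(2) by auto
  have KX: "compact (K \<inter> X Q)" "convex (K \<inter> X Q)" "K \<inter> X Q \<noteq> {}" "K \<inter> X Q \<subseteq> X Q" if "Q \<in> OG" for Q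
  proof -
    show "compact (K \<inter> X Q)" by (intro compact_Int_closed K closed_subspace X that)
    show "convex (K \<inter> X Q)" by (intro convex_Int K subspace_imp_convex X that)
    have "0 \<in> K \<inter> X Q" using r subspace_0[OF X(1)[OF that]] by auto
    then show "K \<inter> X Q \<noteq> {}" by auto
  qed simp
  have G0: "G 0 Q = vol_in (X Q) (K \<inter> X Q)" if "Q \<in> OG" for Q
    by (simp add: G_def outer_parallel_0[OF X(1)[OF that]])
  have Gpos: "0 < G 0 Q" if "Q \<in> OG" for Q
    unfolding G0[OF that] using r KX(1)[OF that] compact_imp_borel_bounded
    by (intro vol_in_pos[OF X(1)[OF that], of _ r]) auto
  have Gle: "G t Q \<le> (1 + norm (Q' - Q) * R / r) ^ m * G t Q'"
    if Q: "Q \<in> OG" "Q' \<in> OG" and t: "0 \<le> t" for Q Q' t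
  proof -
    obtain P where P: "orthogonal_matrix P" "P ** Q = mat 1" "Q ** P = mat 1"
      using Q by (auto simp: OG_def orthogonal_matrix_def orthogonal_matrix_transpose intro!: that[of "transpose Q"])
    \<comment> \<open>the rotation that carries the section by \<open>X Q\<close> to the one by \<open>X Q'\<close>\<close>
    let ?S = "\<lambda>x. Q' *v (P *v x)"
    have "orthogonal_transformation ((\<lambda>x. Q' *v x) \<circ> (\<lambda>x. P *v x))"
      using Q P by (intro orthogonal_transformation_compose oQ) (auto simp: OG_def)
    then have S: "orthogonal_transformation ?S" by (simp add: comp_def)
    have inv: "P *v (Q *v x) = x" "Q *v (P *v x) = x" for x
      using P by (auto simp: matrix_vector_mul_assoc)
    have SX: "?S ` X Q = X Q'" by (simp add: X_def image_image inv)
    have "vol_in (X Q) (outer_parallel (X Q) (K \<inter> X Q) t)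
        \<le> (1 + norm (Q' - Q) * R / r) ^ dim (X Q) * vol_in (?S ` X Q) (outer_parallel (?S ` X Q) (K \<inter> ?S ` X Q) t)"
    proof (rule vol_in_outer_parallel_section_le[OF S X(1)[OF Q(1)] K r])
      fix x assume x: "x \<in> K"
      have "?S x - x = (Q' - Q) *v (P *v x)"
        by (simp add: matrix_vector_mult_diff_rdistrib inv)
      also have "norm \<dots> \<le> norm (Q' - Q) * norm (P *v x)" by (rule norm_matrix_vector_mult_le)
      also have "norm (P *v x) = norm (Q *v (P *v x))"
        using orthogonal_transformation_norm[OF oQ[OF Q(1)]] by simp
      also have "\<dots> \<le> R" using R[OF x] by (simp add: inv)
      finally have "norm (?S x - x) \<le> norm (Q' - Q) * R" by (simp add: mult_left_mono)
      then show "norm (?S x - x) \<le> norm (Q' - Q) * R / r * r" using r by simp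
    qed (use R0 r t in auto)
    then show ?thesis unfolding SX G_def X(2)[OF Q(1)] .
  qed
  have Gcont: "continuous_on OG (G t)" if t: "0 \<le> t" for t
    unfolding continuous_on_def
  proof
    fix Q assume Q: "Q \<in> OG"
    let ?d = "\<lambda>Q'. (1 + norm (Q' - Q) * R / r) ^ m"
    have d1: "1 \<le> ?d Q'" for Q' using R0 r by (intro one_le_power) auto
    have dlim: "(?d \<longlongrightarrow> (1 + norm (Q - Q) * R / r) ^ m) (at Q within OG)"
      using r by (intro tendsto_intros) auto
    have inOG: "eventually (\<lambda>Q'. Q' \<in> OG) (at Q within OG)" by (simp add: eventually_at_filter)
    show "(G t \<longlongrightarrow> G t Q) (at Q within OG)"
    proof (rule tendsto_sandwich)
      show "eventually (\<lambda>Q'. G t Q / ?d Q' \<le> G t Q') (at Q within OG)"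
        using inOG
      proof eventually_elim
        case (elim Q')
        have "0 < ?d Q'" using d1[of Q'] by linarith
        then show ?case using Gle[OF Q elim t] by (simp add: divide_le_eq mult.commute)
      qed
      show "eventually (\<lambda>Q'. G t Q' \<le> ?d Q' * G t Q) (at Q within OG)"
        using inOG by eventually_elim (use Gle[OF _ Q t] in \<open>simp add: norm_minus_commute\<close>)
      have "((\<lambda>Q'. G t Q / ?d Q') \<longlongrightarrow> G t Q / (1 + norm (Q - Q) * R / r) ^ m) (at Q within OG)"
        by (intro tendsto_divide tendsto_const dlim) simp
      then show "((\<lambda>Q'. G t Q / ?d Q') \<longlongrightarrow> G t Q) (at Q within OG)" by simp
      have "((\<lambda>Q'. ?d Q' * G t Q) \<longlongrightarrow> (1 + norm (Q - Q) * R / r) ^ m * G t Q) (at Q within OG)"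
        by (intro tendsto_mult tendsto_const dlim)
      then show "((\<lambda>Q'. ?d Q' * G t Q) \<longlongrightarrow> G t Q) (at Q within OG)" by simp
    qed
  qed
  have "\<exists>Q\<in>OG. \<forall>Q'\<in>OG. \<phi> Q' \<le> \<phi> Q"
  proof (rule infimum_of_continuous_attains_max)
    show "compact OG" unfolding OG_def by (rule compact_orthogonal_matrices)
    show "OG \<noteq> {}" using orthogonal_matrix_id by (auto simp: OG_def)
    show "continuous_on OG (\<lambda>Q. (G t Q - G 0 Q) / t / G 0 Q)" if "0 < t" for t
      using that Gpos by (intro continuous_on_divide continuous_on_diff continuous_on_const Gcont) force+
    show "\<phi> Q \<le> (G t Q - G 0 Q) / t / G 0 Q" if "0 < t" "Q \<in> OG" for t Q
      unfolding \<phi>_def G0[OF that(2), symmetric]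
      using surface_area_in_le[OF X(1)[OF that(2)] KX[OF that(2)] that(1)] Gpos[OF that(2)]
      by (intro divide_right_mono) (auto simp: G_def[of t] G0[OF that(2)])
    show "((\<lambda>t. (G t Q - G 0 Q) / t / G 0 Q) \<longlongrightarrow> \<phi> Q) (at_right 0)" if "Q \<in> OG" for Q
      unfolding \<phi>_def G0[OF that, symmetric]
      using surface_area_in_tendsto[OF X(1)[OF that] KX[OF that]] Gpos[OF that]
      by (intro tendsto_divide tendsto_const) (auto simp: G_def[abs_def] outer_parallel_0[OF X(1)[OF that]])
  qed
  then obtain Q where Q: "Q \<in> OG" "\<And>Q'. Q' \<in> OG \<Longrightarrow> \<phi> Q' \<le> \<phi> Q" by blast
  show ?thesis
  proof (intro bexI ballI)
    show "X Q \<in> grassmannian m" using X[OF Q(1)] by (simp add: grassmannian_def)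
    fix H :: "(real ^ 'n) set" assume "H \<in> grassmannian m"
    then have "subspace H" "dim E = dim H" using E by (auto simp: grassmannian_def)
    then obtain T where T: "orthogonal_transformation T" "T ` E = H"
      using ex_orthogonal_transformation_image[OF E(1)] by blast
    have "matrix T \<in> OG" "X (matrix T) = H"
      using T orthogonal_transformation_matrix[of T] matrix_vector_mul(2)[OF orthogonal_transformation_linear[OF T(1)]]
      by (auto simp: OG_def X_def)
    then show "surface_area_in H (K \<inter> H) / vol_in H (K \<inter> H)
        \<le> surface_area_in (X Q) (K \<inter> X Q) / vol_in (X Q) (K \<inter> X Q)"
      using Q(2)[of "matrix T"] by (simp add: \<phi>_def)
  qed
qed

section \<open>Central sections as limits of slabs\<close>

text \<open>The intersection of the slabs orthogonal to the rows \<open>U $ i\<close>, \<open>i \<in> I\<close>. For small \<open>\<epsilon>\<close> it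
  is a thin one-sided neighbourhood of the subspace orthogonal to these rows.\<close>

definition slab :: "'n set \<Rightarrow> real \<Rightarrow> real^'n^'n \<Rightarrow> (real^'n) set"
  where "slab I \<epsilon> U = {x. \<forall>i\<in>I. U $ i \<bullet> x \<in> {0..\<epsilon>}}"

text \<open>The linear map that sends the standard basis to the rows of \<open>U\<close>.\<close>

definition frame_map :: "real^'n^'n \<Rightarrow> real^'n \<Rightarrow> real^'n"
  where "frame_map U c = (\<Sum>i\<in>UNIV. c $ i *\<^sub>R U $ i)"

text \<open>A compact family of quantitatively independent rows. It replaces the orthogonal frames: it is
  invariant under applying one rotation to all rows, but has positive finite Lebesgue measure, so
  that averages over it are Lebesgue integrals.\<close>

definition frames :: "(real^'n^'n) set"
  where "frames = {U. (\<forall>i. norm (U $ i) \<le> 2) \<and> (\<forall>c. norm c \<le> 2 * norm (frame_map U c))}"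

lemma linear_frame_map: "linear (frame_map U)"
  unfolding frame_map_def
  by (auto intro!: linearI simp: scaleR_add_left sum.distrib scaleR_sum_right)

lemma frame_map_axis: "frame_map U (axis i 1) = U $ i"
proof -
  have "frame_map U (axis i 1) = (\<Sum>j\<in>UNIV. if j = i then U $ j else 0)"
    unfolding frame_map_def by (rule sum.cong) (auto simp: axis_def)
  then show ?thesis by simp
qed

lemma inj_frame_map: "U \<in> frames \<Longrightarrow> inj (frame_map U)"
proof -
  assume U: "U \<in> frames"
  have "x = 0" if "frame_map U x = 0" for x
  proof -
    have "norm x \<le> 2 * norm (frame_map U x)" using U unfolding frames_def by blast
    then show ?thesis using that by simp
  qed
  then show ?thesis by (simp add: linear_injective_0[OF linear_frame_map])
qed

lemma span_frame_rows: "span ((\<lambda>i. U $ i) ` I) = frame_map U ` span ((\<lambda>i. axis i 1) ` I)"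
  unfolding linear_span_image[OF linear_frame_map, symmetric] image_image frame_map_axis ..

lemma span_axes_zero: "s \<in> span ((\<lambda>i. axis i (1::real)) ` I) \<Longrightarrow> j \<notin> I \<Longrightarrow> s $ j = 0"
proof -
  assume s: "s \<in> span ((\<lambda>i. axis i (1::real)) ` I)" and j: "j \<notin> I"
  have "span ((\<lambda>i. axis i (1::real)) ` I) \<subseteq> {s. s $ j = 0}"
  proof (rule span_minimal)
    show "(\<lambda>i. axis i (1::real)) ` I \<subseteq> {s. s $ j = 0}" using j by (auto simp: axis_def)
    show "subspace {s :: real^'a. s $ j = 0}" by (auto simp: subspace_def)
  qed
  then show ?thesis using s by blast
qed

lemma dim_span_frame_rows:
  fixes U :: "real^'n^'n"
  assumes "U \<in> frames"
  shows "dim (span ((\<lambda>i. U $ i) ` I)) = card I"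
proof -
  have "dim (span ((\<lambda>i. U $ i) ` I)) = dim (span ((\<lambda>i. axis i (1::real)) ` I))"
    unfolding span_frame_rows
    using inj_frame_map[OF assms] by (intro dim_image_eq linear_frame_map) (auto intro: inj_on_subset)
  also have "\<dots> = dim ((\<lambda>i. axis i (1::real)) ` I)" by (rule dim_span)
  also have "\<dots> = card ((\<lambda>i. axis i (1::real)) ` I)"
  proof (rule dim_eq_card_independent)
    show "independent ((\<lambda>i. axis i (1::real)) ` I)"
      by (rule independent_mono[OF independent_Basis]) (auto simp: Basis_vec_def)
  qed
  also have "\<dots> = card I" by (rule card_image) (auto simp: inj_on_def axis_eq_axis)
  finally show ?thesis .
qed

definition frame_kernel :: "'n set \<Rightarrow> real^'n^'n \<Rightarrow> (real^'n) set"
  where "frame_kernel I U = {x. \<forall>i\<in>I. U $ i \<bullet> x = 0}"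

lemma frame_kernel_orthogonal:
  "frame_kernel I U = {y. \<forall>x\<in>span ((\<lambda>i. U $ i) ` I). orthogonal x y}"
proof
  show "{y. \<forall>x\<in>span ((\<lambda>i. U $ i) ` I). orthogonal x y} \<subseteq> frame_kernel I U"
    by (auto simp: frame_kernel_def orthogonal_def span_base)
  show "frame_kernel I U \<subseteq> {y. \<forall>x\<in>span ((\<lambda>i. U $ i) ` I). orthogonal x y}"
  proof safe
    fix y x assume y: "y \<in> frame_kernel I U" and x: "x \<in> span ((\<lambda>i. U $ i) ` I)"
    have "orthogonal y x"
      by (rule orthogonal_to_span[OF x]) (use y in \<open>auto simp: frame_kernel_def orthogonal_def inner_commute\<close>)
    then show "orthogonal x y" by (simp add: orthogonal_commute)
  qed
qed

lemma subspace_frame_kernel: "subspace (frame_kernel I U)"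
  by (auto simp: frame_kernel_def subspace_def inner_add_right)

lemma dim_frame_kernel:
  fixes U :: "real^'n^'n"
  assumes "U \<in> frames"
  shows "dim (frame_kernel I U) = CARD('n) - card I"
proof -
  have "dim {y \<in> UNIV. \<forall>x\<in>span ((\<lambda>i. U $ i) ` I). orthogonal x y}
      + dim (span ((\<lambda>i. U $ i) ` I)) = dim (UNIV :: (real^'n) set)"
    by (rule dim_subspace_orthogonal_to_vectors) auto
  then show ?thesis by (simp add: frame_kernel_orthogonal dim_span_frame_rows[OF assms] dim_UNIV del: dim_span)
qed

text \<open>A vector orthogonal to the kernel is a combination of the rows in \<open>I\<close>, with coefficients
  controlled by its own norm. Pairing the combination with the vector itself bounds its length.\<close>

lemma norm_orthogonal_slab_le:
  fixes U :: "real^'n^'n"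
  assumes U: "U \<in> frames" and z: "z \<in> slab I \<epsilon> U" "\<And>y. y \<in> frame_kernel I U \<Longrightarrow> z \<bullet> y = 0" and e: "0 \<le> \<epsilon>"
  shows "norm z \<le> 2 * real (card I) * \<epsilon>"
proof -
  obtain a b where ab: "a \<in> span ((\<lambda>i. U $ i) ` I)" "\<And>w. w \<in> span ((\<lambda>i. U $ i) ` I) \<Longrightarrow> orthogonal b w" "z = a + b"
    using orthogonal_subspace_decomp_exists[of "(\<lambda>i. U $ i) ` I" z] by metis
  have "b \<in> frame_kernel I U" using ab(2) by (auto simp: frame_kernel_orthogonal orthogonal_commute)
  then have "z \<bullet> b = 0" by (rule z(2))
  moreover have "a \<bullet> b = 0" using ab(2)[OF ab(1)] by (simp add: orthogonal_def inner_commute)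
  ultimately have "b = 0" using ab(3) by (simp add: inner_add_left)
  then have "z \<in> span ((\<lambda>i. U $ i) ` I)" using ab by simp
  then obtain s where s: "z = frame_map U s" "s \<in> span ((\<lambda>i. axis i 1) ` I)"
    unfolding span_frame_rows by auto
  have ns: "norm s \<le> 2 * norm z" using U s(1) unfolding frames_def by blast
  have "(norm z)\<^sup>2 = (\<Sum>i\<in>UNIV. s $ i * (U $ i \<bullet> z))"
    unfolding power2_norm_eq_inner by (subst s(1)) (simp add: frame_map_def inner_sum_left)
  also have "\<dots> = (\<Sum>i\<in>I. s $ i * (U $ i \<bullet> z))"
    by (rule sum.mono_neutral_right) (use span_axes_zero[OF s(2)] in auto)
  also have "\<dots> \<le> (\<Sum>i\<in>I. norm s * \<epsilon>)"
  proof (rule sum_mono)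
    fix i assume i: "i \<in> I"
    have 1: "0 \<le> U $ i \<bullet> z" "U $ i \<bullet> z \<le> \<epsilon>" using z(1) i by (auto simp: slab_def)
    have "s $ i \<le> norm s" using component_le_norm_cart[of s i] by linarith
    then show "s $ i * (U $ i \<bullet> z) \<le> norm s * \<epsilon>" using 1 by (intro mult_mono) auto
  qed
  also have "\<dots> = real (card I) * \<epsilon> * norm s" by simp
  also have "\<dots> \<le> real (card I) * \<epsilon> * (2 * norm z)" using ns e by (intro mult_left_mono) auto
  finally have "norm z * norm z \<le> (2 * real (card I) * \<epsilon>) * norm z" by (simp add: power2_eq_square algebra_simps)
  then show ?thesis using e by (cases "z = 0") auto
qed

lemma closed_slab: "closed (slab I \<epsilon> U)"
proof -
  have "slab I \<epsilon> U = (\<Inter>i\<in>I. (\<lambda>x. U $ i \<bullet> x) -` {0..\<epsilon>})" by (auto simp: slab_def)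
  then show ?thesis by (simp) (intro closed_INT ballI closed_vimage continuous_intros closed_atLeastAtMost)
qed

text \<open>Lebesgue measure is the product of the measures of \<open>H\<close> and of its orthogonal complement;
  here the cross-section may be any Borel set instead of the unit cube.\<close>

lemma emeasure_lborel_split:
  fixes H :: "'a::euclidean_space set"
  assumes s: "split_basis H B C" and [measurable]: "X \<in> sets borel" "S \<in> sets borel"
  shows "emeasure lborel {x. coord_proj B x \<in> X \<and> coord_proj C x \<in> S}
    = emeasure (basis_lborel B) X * emeasure (basis_lborel C) S"
proof -
  note f = split_basis_facts[OF s]
  have o: "orthonormal_basis_of UNIV (B \<union> C)" using s by (simp add: split_basis_def)
  interpret P: product_sigma_finite "\<lambda>_::'a. lborel :: real measure" ..
  let ?s = "\<lambda>B f. \<Sum>b\<in>B. f b *\<^sub>R b :: 'a"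
  have s[measurable]: "?s D \<in> (\<Pi>\<^sub>M b\<in>D. lborel) \<rightarrow>\<^sub>M borel" for D by measurable
  note em = emeasure_basis_lborel
  let ?D = "{x. coord_proj B x \<in> X \<and> coord_proj C x \<in> S}"
  have cm[measurable]: "coord_proj E \<in> borel \<rightarrow>\<^sub>M borel" for E :: "'a set"
    by (intro borel_measurable_continuous_onI continuous_coord_proj)
  have D[measurable]: "?D \<in> sets borel" by measurable
  have coord: "?s (B \<union> C) h \<bullet> d = h d" if "d \<in> B \<union> C" for h d
  proof -
    have "?s (B \<union> C) h \<bullet> d = (\<Sum>b\<in>B \<union> C. if b = d then h b else 0)"
      unfolding inner_sum_left by (rule sum.cong) (use f(7)[OF _ that] in auto)
    then show ?thesis using that f(1,2) by (simp add: sum.delta del: Un_iff)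
  qed
  have ind: "indicator ?D (?s (B \<union> C) (merge B C (g, h))) = (indicator X (?s B g) * indicator S (?s C h) :: ennreal)" for g h
  proof -
    have "coord_proj B (?s (B \<union> C) (merge B C (g, h))) = ?s B g"
      unfolding coord_proj_def by (rule sum.cong) (auto simp: coord merge_def)
    moreover have "coord_proj C (?s (B \<union> C) (merge B C (g, h))) = ?s C h"
      unfolding coord_proj_def by (rule sum.cong) (use f(8) in \<open>auto simp: coord merge_def\<close>)
    ultimately show ?thesis by (auto simp: indicator_def)
  qed
  have "emeasure lborel ?D = (\<integral>\<^sup>+g. indicator ?D (?s (B \<union> C) g) \<partial>(\<Pi>\<^sub>M b\<in>B \<union> C. lborel))"
    using em[OF D, of "B \<union> C"] by (simp only: basis_lborel_UNIV[OF o])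
  also have "\<dots> = (\<integral>\<^sup>+g. \<integral>\<^sup>+h. indicator ?D (?s (B \<union> C) (merge B C (g, h)))
      \<partial>(\<Pi>\<^sub>M b\<in>C. lborel) \<partial>(\<Pi>\<^sub>M b\<in>B. lborel))"
    using f(8,1,2) by (rule P.product_nn_integral_fold) measurable
  also have "\<dots> = (\<integral>\<^sup>+g. \<integral>\<^sup>+h. indicator X (?s B g) * indicator S (?s C h)
      \<partial>(\<Pi>\<^sub>M b\<in>C. lborel) \<partial>(\<Pi>\<^sub>M b\<in>B. lborel))"
    by (simp only: ind)
  also have "\<dots> = (\<integral>\<^sup>+g. indicator X (?s B g) * emeasure (basis_lborel C) S \<partial>(\<Pi>\<^sub>M b\<in>B. lborel))"
    by (subst nn_integral_cmult) (simp_all add: em)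
  also have "\<dots> = emeasure (basis_lborel B) X * emeasure (basis_lborel C) S"
    by (subst nn_integral_multc) (simp_all add: em)
  finally show ?thesis .
qed

lemma ex_inner_rows_eq:
  fixes U :: "real^'n^'n"
  assumes "U \<in> frames"
  shows "\<exists>z. \<forall>i. U $ i \<bullet> z = v $ i"
proof -
  let ?L = "\<lambda>z. \<chi> i. U $ i \<bullet> z"
  have lin: "linear ?L" by (rule linearI) (simp_all add: vec_eq_iff inner_add_right)
  have inj: "inj ?L"
    unfolding linear_injective_0[OF lin]
  proof (intro allI impI)
    fix z assume "?L z = 0"
    then have 0: "U $ i \<bullet> z = 0" for i by (simp add: vec_eq_iff)
    obtain c where "frame_map U c = z"
      using linear_injective_imp_surjective[OF linear_frame_map inj_frame_map[OF assms]] by (metis surjD)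
    then have "z \<bullet> z = (\<Sum>i\<in>UNIV. c $ i * (U $ i \<bullet> z))" by (metis (no_types, lifting) frame_map_def inner_scaleR_left inner_sum_left sum.cong)
    then show "z = 0" by (simp add: 0)
  qed
  obtain z where "v = ?L z" using surjD[OF linear_injective_imp_surjective[OF lin inj], of v] by blast
  then have "U $ i \<bullet> z = v $ i" for i by simp
  then show ?thesis by blast
qed

text \<open>Membership in the slab depends only on the component orthogonal to the kernel \<open>H\<close>, so this
  set is a product over \<open>X\<close>. The factor \<open>\<kappa>\<close> is the volume of the cross-section of the slab. It
  does not depend on \<open>X\<close> and cancels in comparisons.\<close>

lemma slab_volume_proportional:
  fixes U :: "real^'n^'n"
  assumes U: "U \<in> frames" and e: "0 < \<epsilon>" and s: "split_basis (frame_kernel I U) B C"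
  shows "\<exists>\<kappa>>0. \<forall>X. compact X \<longrightarrow> compact {x \<in> slab I \<epsilon> U. coord_proj B x \<in> X} \<and>
    measure lborel {x \<in> slab I \<epsilon> U. coord_proj B x \<in> X} = vol_in (frame_kernel I U) X * \<kappa>"
proof -
  let ?H = "frame_kernel I U" and ?P = "coord_proj B" and ?S = "slab I \<epsilon> U"
  let ?Y = "\<lambda>X. {x \<in> ?S. ?P x \<in> X}"
  note f = split_basis_facts[OF s] and p = coord_proj_facts[OF s]
  have PU: "U $ i \<bullet> ?P x = 0" if "i \<in> I" for i x using p(1)[of x] that by (simp add: frame_kernel_def)
  have SC: "x \<in> ?S \<longleftrightarrow> x - ?P x \<in> ?S" for x by (auto simp: slab_def inner_diff_right PU)
  have Ycomp: "compact (?Y X)" if X: "compact X" for X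
  proof -
    have cl: "closed (?P -` X)" using X by (intro closed_vimage compact_imp_closed continuous_coord_proj)
    have Y: "?Y X = ?S \<inter> ?P -` X" by auto
    have "closed (?Y X)" unfolding Y by (rule closed_Int[OF closed_slab cl])
    moreover have "bounded (?Y X)"
    proof -
      obtain M where M: "\<And>x. x \<in> X \<Longrightarrow> norm x \<le> M" using compact_imp_bounded[OF X] by (auto simp: bounded_iff)
      show ?thesis unfolding bounded_iff
      proof (intro exI ballI)
        fix x assume x: "x \<in> ?Y X"
        then have "x - ?P x \<in> ?S" using SC by blast
        then have "norm (x - ?P x) \<le> 2 * real (card I) * \<epsilon>"
          using p(5) e by (intro norm_orthogonal_slab_le[OF U]) auto
        moreover have "norm (?P x) \<le> M" using x M by auto
        ultimately show "norm x \<le> M + 2 * real (card I) * \<epsilon>"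
          using norm_triangle_ineq[of "?P x" "x - ?P x"] by simp
      qed
    qed
    ultimately show ?thesis by (simp add: compact_eq_bounded_closed)
  qed
  define k where "k = emeasure (basis_lborel C) ?S"
  have prod: "emeasure lborel (?Y X) = emeasure (subspace_lborel ?H) X * k" if X: "X \<in> sets borel" for X
  proof -
    have "coord_proj C x = x - ?P x" for x using p(6)[of x] unfolding coord_proj_def by simp
    then have "?Y X = {x. ?P x \<in> X \<and> coord_proj C x \<in> ?S}" using SC by auto
    then show ?thesis
      using emeasure_lborel_split[OF s X borel_closed[OF closed_slab]] s
      by (simp add: k_def split_basis_def subspace_lborel_eq[of ?H B])
  qed
  let ?X = "cball 0 1 \<inter> ?H"
  have cX: "compact ?X" by (rule compact_cball_subspace[OF f(6)])
  note bX = compact_imp_borel_bounded[OF cX]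
  have vX: "0 < vol_in ?H ?X" by (rule vol_in_pos[OF f(6) bX(2,1), of 1]) auto
  have "0 < emeasure lborel (?Y ?X)"
  proof -
    obtain z where z: "\<And>i. U $ i \<bullet> z = \<epsilon> / 2" using ex_inner_rows_eq[OF U, of "\<chi> i. \<epsilon> / 2"] by auto
    let ?O = "(?P -` ball 0 1) \<inter> (\<Inter>i\<in>I. (\<lambda>x. U $ i \<bullet> x) -` {0<..<\<epsilon>})"
    have "open ?O" by (intro open_Int open_INT ballI open_vimage continuous_coord_proj continuous_intros) auto
    moreover have "z - ?P z \<in> ?O"
    proof -
      have "?P (z - ?P z) = 0" using p(2)[OF p(1)[of z]] by (simp add: linear_diff[OF linear_coord_proj])
      then show ?thesis using e by (auto simp: inner_diff_right PU z)
    qed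
    ultimately obtain y d where d: "0 < d" "cball y d \<subseteq> ?O"
      unfolding open_contains_cball by meson
    have "?O \<subseteq> ?Y ?X" using p(1) by (auto simp: slab_def less_imp_le)
    with d(2) have "cball y d \<subseteq> ?Y ?X" by (rule order_trans)
    moreover have "?Y ?X \<in> sets lborel"
      unfolding sets_lborel by (rule compact_imp_borel_bounded(1)[OF Ycomp[OF cX]])
    ultimately have "emeasure lborel (cball y d) \<le> emeasure lborel (?Y ?X)"
      by (rule emeasure_mono)
    have "0 < emeasure lborel (cball y d)" by (rule emeasure_cball_pos[OF d(1)])
    also have "\<dots> \<le> emeasure lborel (?Y ?X)" by fact
    finally show ?thesis .
  qed
  moreover have "emeasure lborel (?Y ?X) < \<infinity>"
    by (rule emeasure_bounded_finite[OF compact_imp_bounded[OF Ycomp[OF cX]]])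
  ultimately have k: "0 < k" "k < \<infinity>"
    using vX unfolding prod[OF bX(1)] emeasure_vol_in[OF f(6) bX(2,1)]
    by (auto simp: zero_less_iff_neq_zero ennreal_mult_less_top)
  show ?thesis
  proof (intro exI[of _ "enn2real k"] conjI allI impI)
    show "0 < enn2real k" using k by (simp add: enn2real_positive_iff)
    fix X :: "(real^'n) set" assume X: "compact X"
    show "compact (?Y X)" by (rule Ycomp[OF X])
    show "measure lborel (?Y X) = vol_in ?H X * enn2real k"
      unfolding measure_def prod[OF compact_imp_borel_bounded(1)[OF X]] by (simp add: enn2real_mult)
  qed
qed

text \<open>For \<open>x\<close> in the slab, \<open>x\<close> differs from its projection to \<open>H\<close> by at most \<open>\<eta> * r\<close>.
  Hence \<open>K\<close> contains the part of the slab over the shrunken section, by convexity, while the part of the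
  slab in the ball lies over the section of the ball.\<close>

lemma section_volume_le_of_slab_volume_le:
  fixes U :: "real^'n^'n"
  assumes K: "compact K" "convex K" and r: "0 < r" "cball 0 r \<subseteq> K" and U: "U \<in> frames"
    and \<eta>: "0 < \<eta>" "\<eta> < 1" and e: "0 < \<epsilon>" "2 * real (card I) * \<epsilon> \<le> \<eta> * r"
    and le: "measure lborel (K \<inter> slab I \<epsilon> U) \<le> measure lborel (cball 0 \<rho> \<inter> slab I \<epsilon> U)"
  defines "H \<equiv> frame_kernel I U"
  shows "(1 - \<eta>) ^ dim H * vol_in H (K \<inter> H) \<le> vol_in H (cball 0 \<rho> \<inter> H)"
proof -
  have H: "subspace H" unfolding H_def by (rule subspace_frame_kernel)
  obtain B C where s: "split_basis H B C" using ex_split_basis[OF H] by blast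
  note p = coord_proj_facts[OF s]
  let ?P = "coord_proj B" and ?S = "slab I \<epsilon> U"
  let ?Y = "\<lambda>X. {x \<in> ?S. ?P x \<in> X}"
  obtain \<kappa> where \<kappa>: "0 < \<kappa>" "\<And>X. compact X \<Longrightarrow> compact (?Y X)"
    "\<And>X. compact X \<Longrightarrow> measure lborel (?Y X) = vol_in H X * \<kappa>"
    using slab_volume_proportional[OF U e(1) s[unfolded H_def], folded H_def] by blast
  let ?X = "(\<lambda>x. (1 - \<eta>) *\<^sub>R x) ` (K \<inter> H)" and ?Z = "cball 0 \<rho> \<inter> H"
  have cK: "compact (K \<inter> H)" by (intro compact_Int_closed K closed_subspace H)
  have cX: "compact ?X" by (rule compact_scaling[OF cK])
  have cZ: "compact ?Z" by (rule compact_cball_subspace[OF H])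
  have mono: "measure lborel X \<le> measure lborel X'" if "compact X" "compact X'" "X \<subseteq> X'" for X X' :: "(real^'n) set"
    using that compact_imp_borel_bounded[OF that(1)] compact_imp_borel_bounded[OF that(2)] emeasure_bounded_finite[of X']
    by (intro measure_mono_fmeasurable) (auto simp: fmeasurable_def)
  have sub1: "?Y ?X \<subseteq> K \<inter> ?S"
  proof safe
    fix x y assume x: "x \<in> ?S" and y: "?P x = (1 - \<eta>) *\<^sub>R y" "y \<in> K"
    have "norm (x - ?P x) \<le> 2 * real (card I) * \<epsilon>"
    proof (rule norm_orthogonal_slab_le[OF U])
      show "x - ?P x \<in> ?S"
        using x p(1)[of x] by (auto simp: slab_def H_def frame_kernel_def inner_diff_right)
    qed (use p(5) e in \<open>auto simp: H_def\<close>)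
    then have "norm (x - ?P x) / \<eta> \<le> r" using e(2) \<eta> by (simp add: pos_divide_le_eq mult.commute)
    then have "norm ((1/\<eta>) *\<^sub>R (x - ?P x)) \<le> r" using \<eta> by simp
    then have "(1/\<eta>) *\<^sub>R (x - ?P x) \<in> K" by (intro subsetD[OF r(2)]) simp
    then have "(1 - \<eta>) *\<^sub>R y + \<eta> *\<^sub>R ((1/\<eta>) *\<^sub>R (x - ?P x)) \<in> K"
      using y \<eta> by (intro convexD[OF K(2)]) auto
    then show "x \<in> K" using \<eta> y(1) by simp
  qed
  have sub2: "cball 0 \<rho> \<inter> ?S \<subseteq> ?Y ?Z" using p(1) order_trans[OF p(8)] by auto
  have "measure lborel (?Y ?X) \<le> measure lborel (K \<inter> ?S)"
    by (rule mono[OF \<kappa>(2)[OF cX] compact_Int_closed[OF K(1) closed_slab] sub1])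
  moreover have "measure lborel (cball 0 \<rho> \<inter> ?S) \<le> measure lborel (?Y ?Z)"
    by (rule mono[OF compact_Int_closed[OF compact_cball closed_slab] \<kappa>(2)[OF cZ] sub2])
  ultimately have "measure lborel (?Y ?X) \<le> measure lborel (?Y ?Z)" using le by linarith
  then have "vol_in H ?X \<le> vol_in H ?Z"
    unfolding \<kappa>(3)[OF cX] \<kappa>(3)[OF cZ] using \<kappa>(1) by simp
  then show ?thesis
    using vol_in_scale[OF H compact_imp_borel_bounded(1)[OF cK], of "1 - \<eta>"] \<eta> by simp
qed

section \<open>Averaging slabs over a rotation invariant family\<close>

lemma continuous_frame_map: "continuous_on S (\<lambda>U. frame_map U c)"
  unfolding frame_map_def by (intro continuous_intros)

lemma compact_frames: "compact (frames :: (real^'n^'n) set)"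
proof -
  have "(frames :: (real^'n^'n) set)
      = (\<Inter>i. {U. norm (U $ i) \<le> 2}) \<inter> (\<Inter>c. {U. norm c \<le> 2 * norm (frame_map U c)})"
    by (auto simp: frames_def)
  also have "closed \<dots>"
    by (intro closed_Int closed_INT ballI closed_Collect_le continuous_intros continuous_frame_map)
  finally have "closed (frames :: (real^'n^'n) set)" .
  moreover have "bounded (frames :: (real^'n^'n) set)"
    unfolding bounded_iff
  proof (intro exI ballI)
    fix U :: "real^'n^'n" assume U: "U \<in> frames"
    show "norm U \<le> L2_set (\<lambda>i::'n. 2) UNIV"
      unfolding norm_vec_def[of U] by (rule L2_set_mono) (use U in \<open>auto simp: frames_def\<close>)
  qed
  ultimately show ?thesis by (simp add: compact_eq_bounded_closed)
qed

lemma emeasure_frames_pos: "0 < emeasure lborel (frames :: (real^'n^'n) set)"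
proof -
  define \<delta> where "\<delta> = 1 / (2 * real CARD('n))"
  have n1: "1 \<le> real CARD('n)" using zero_less_card_finite[where 'a='n] by linarith
  have d13: "0 < \<delta>" "real CARD('n) * \<delta> = 1/2" by (simp_all add: \<delta>_def)
  have "1 * \<delta> \<le> real CARD('n) * \<delta>" using n1 d13(1) by (intro mult_right_mono) auto
  with d13 have d: "0 < \<delta>" "\<delta> \<le> 1" "real CARD('n) * \<delta> = 1/2" by linarith+
  \<comment> \<open>rows within \<open>\<delta>\<close> of the standard basis change \<open>c\<close> by at most half its norm\<close>
  have "cball (mat 1) \<delta> \<subseteq> (frames :: (real^'n^'n) set)"
  proof
    fix U :: "real^'n^'n" assume U: "U \<in> cball (mat 1) \<delta>"
    have row: "norm (U $ i - axis i 1) \<le> \<delta>" for i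
    proof -
      have "(mat 1 :: real^'n^'n) $ i = axis i 1" by (simp add: mat_def axis_def vec_eq_iff eq_commute)
      then have "norm (U $ i - axis i 1) = norm ((U - mat 1) $ i)" by simp
      also have "\<dots> \<le> norm (U - mat 1)" by (rule Finite_Cartesian_Product.norm_nth_le)
      also have "\<dots> \<le> \<delta>" using U by (simp add: dist_norm norm_minus_commute)
      finally show ?thesis .
    qed
    have "norm (U $ i) \<le> 2" for i
      using norm_triangle_ineq[of "U $ i - axis i 1" "axis i (1::real)"] row[of i] d by (simp add: norm_axis_1)
    moreover have "norm c \<le> 2 * norm (frame_map U c)" for c
    proof -
      have c: "c = (\<Sum>i\<in>UNIV. c $ i *\<^sub>R axis i 1)"
        using basis_expansion[of c] by (simp add: scalar_mult_eq_scaleR)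
      have "frame_map U c - c = (\<Sum>i\<in>UNIV. c $ i *\<^sub>R (U $ i - axis i 1))"
        by (subst (2) c) (simp add: frame_map_def scaleR_diff_right sum_subtractf)
      then have "norm (frame_map U c - c) \<le> (\<Sum>i\<in>UNIV. norm (c $ i *\<^sub>R (U $ i - axis i 1)))"
        by (simp only: norm_sum)
      also have "\<dots> \<le> (\<Sum>i\<in>(UNIV::'n set). norm c * \<delta>)"
      proof (rule sum_mono)
        fix i show "norm (c $ i *\<^sub>R (U $ i - axis i 1)) \<le> norm c * \<delta>"
          using row[of i] component_le_norm_cart[of c i] by (auto intro: mult_mono)
      qed
      also have "\<dots> = norm c * (real CARD('n) * \<delta>)" by simp
      finally have "norm (frame_map U c - c) \<le> norm c / 2" using d(3) by simp
      then show ?thesis using norm_triangle_ineq2[of c "frame_map U c"] by (simp add: norm_minus_commute)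
    qed
    ultimately show "U \<in> frames" by (auto simp: frames_def)
  qed
  moreover have "0 < emeasure lborel (cball (mat 1 :: real^'n^'n) \<delta>)"
    by (rule emeasure_cball_pos[OF d(1)])
  ultimately show ?thesis
    using emeasure_mono[of "cball (mat 1 :: real^'n^'n) \<delta>" frames lborel]
      compact_imp_borel_bounded[OF compact_frames] by (auto intro: less_le_trans)
qed

text \<open>The measure of this set, as a function of \<open>x\<close>, is the density with which slabs cover
  the point \<open>x\<close>.\<close>

definition slab_frames :: "'n set \<Rightarrow> real \<Rightarrow> real^'n \<Rightarrow> (real^'n^'n) set"
  where "slab_frames I \<epsilon> x = {U \<in> frames. x \<in> slab I \<epsilon> U}"

lemma closed_slab_pairs: "closed {(U, x). x \<in> slab I \<epsilon> U}"
proof -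
  have "{(U, x). x \<in> slab I \<epsilon> U}
      = (\<Inter>i\<in>I. {p. 0 \<le> fst p $ i \<bullet> snd p} \<inter> {p. fst p $ i \<bullet> snd p \<le> \<epsilon>})"
    by (auto simp: slab_def)
  also have "closed \<dots>"
    by (intro closed_INT ballI closed_Int closed_Collect_le continuous_intros)
  finally show ?thesis .
qed

lemma slab_frames_borel: "slab_frames I \<epsilon> x \<in> sets borel"
proof -
  have "slab_frames I \<epsilon> x = frames \<inter> (\<Inter>i\<in>I. {U. 0 \<le> U $ i \<bullet> x} \<inter> {U. U $ i \<bullet> x \<le> \<epsilon>})"
    by (auto simp: slab_frames_def slab_def)
  also have "closed \<dots>"
    by (intro closed_Int compact_imp_closed[OF compact_frames] closed_INT ballI closed_Collect_le continuous_intros)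
  finally show ?thesis by (rule borel_closed)
qed

text \<open>Applying \<open>T\<close> to every row is an orthogonal transformation of the space of matrices.\<close>

lemma emeasure_slab_frames_orthogonal_le:
  fixes T :: "real^'n \<Rightarrow> real^'n"
  assumes T: "orthogonal_transformation T"
  shows "emeasure lborel (slab_frames I \<epsilon> x) \<le> emeasure lborel (slab_frames I \<epsilon> (T x))"
proof -
  define \<Theta> where "\<Theta> U = (\<chi> i. T (U $ i))" for U :: "real^'n^'n"
  have lin: "linear T" by (rule orthogonal_transformation_linear[OF T])
  have inn: "T v \<bullet> T w = v \<bullet> w" for v w using T by (simp add: orthogonal_transformation_def)
  have "linear \<Theta>"
    by (rule linearI) (simp_all add: \<Theta>_def vec_eq_iff linear_add[OF lin] linear_scale[OF lin])
  moreover have "\<Theta> v \<bullet> \<Theta> w = v \<bullet> w" for v w by (simp add: \<Theta>_def inner_vec_def[of "_ :: real^'n^'n"] inn)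
  ultimately have \<Theta>: "orthogonal_transformation \<Theta>" by (simp add: orthogonal_transformation_def)
  have "frame_map (\<Theta> U) c = T (frame_map U c)" for U c
    by (simp add: frame_map_def \<Theta>_def linear_sum[OF lin] linear_scale[OF lin])
  then have "\<Theta> ` slab_frames I \<epsilon> x \<subseteq> slab_frames I \<epsilon> (T x)"
    by (auto simp: slab_frames_def frames_def slab_def orthogonal_transformation_norm[OF T])
      (simp_all add: \<Theta>_def inn orthogonal_transformation_norm[OF T])
  then have "emeasure lborel (\<Theta> ` slab_frames I \<epsilon> x) \<le> emeasure lborel (slab_frames I \<epsilon> (T x))"
    by (rule emeasure_mono) (simp add: slab_frames_borel)
  then show ?thesis by (simp add: emeasure_orthogonal_image(2)[OF \<Theta> slab_frames_borel])
qed

text \<open>The density is radial by rotation invariance and decreases along rays, since a slab that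
  contains \<open>x\<close> contains the segment from 0 to \<open>x\<close>.\<close>

lemma emeasure_slab_frames_antimono:
  fixes x y :: "real^'n"
  assumes xy: "norm y \<le> norm x" and e: "0 \<le> \<epsilon>"
  shows "emeasure lborel (slab_frames I \<epsilon> x) \<le> emeasure lborel (slab_frames I \<epsilon> y)"
proof -
  obtain c where c: "0 \<le> c" "c \<le> 1" "norm y = c * norm x"
  proof (cases "x = 0")
    case True then show thesis using that[of 0] xy by simp
  next
    case False then show thesis using that[of "norm y / norm x"] xy by simp
  qed
  then have "norm (c *\<^sub>R x) = norm y" by simp
  then obtain T where T: "orthogonal_transformation T" "T (c *\<^sub>R x) = y"
    using orthogonal_transformation_exists[of "c *\<^sub>R x" y] by metis
  have "slab_frames I \<epsilon> x \<subseteq> slab_frames I \<epsilon> (c *\<^sub>R x)"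
  proof -
    have "0 \<le> c * v \<and> c * v \<le> \<epsilon>" if "0 \<le> v" "v \<le> \<epsilon>" for v
      using that c mult_left_le_one_le[of v c] by auto
    then show ?thesis by (auto simp: slab_frames_def slab_def)
  qed
  then have "emeasure lborel (slab_frames I \<epsilon> x) \<le> emeasure lborel (slab_frames I \<epsilon> (c *\<^sub>R x))"
    by (rule emeasure_mono) (simp add: slab_frames_borel)
  also have "\<dots> \<le> emeasure lborel (slab_frames I \<epsilon> y)"
    using emeasure_slab_frames_orthogonal_le[OF T(1), of I \<epsilon> "c *\<^sub>R x"] T(2) by simp
  finally show ?thesis .
qed

text \<open>The bathtub principle: replacing \<open>K - cball 0 \<rho>\<close>, where \<open>w\<close> is at most its value at norm
  \<open>\<rho>\<close>, by the equally large set \<open>cball 0 \<rho> - K\<close>, where \<open>w\<close> is at least that value, does not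
  decrease the integral.\<close>

lemma nn_integral_radial_antimono_le_ball:
  fixes w :: "'a::euclidean_space \<Rightarrow> ennreal"
  assumes w[measurable]: "w \<in> borel_measurable borel"
    and anti: "\<And>x y. norm y \<le> norm x \<Longrightarrow> w x \<le> w y"
    and K[measurable]: "K \<in> sets borel" and fin: "emeasure lborel K < \<infinity>" and \<rho>: "0 \<le> \<rho>"
    and eq: "emeasure lborel K = emeasure lborel (cball (0::'a) \<rho>)"
  shows "(\<integral>\<^sup>+x. indicator K x * w x \<partial>lborel) \<le> (\<integral>\<^sup>+x. indicator (cball 0 \<rho>) x * w x \<partial>lborel)"
proof -
  let ?B = "cball (0::'a) \<rho>"
  obtain e :: 'a where e: "norm e = \<rho>" using vector_choose_size[OF \<rho>] by blast
  define a where "a = w e"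
  have i: "emeasure lborel (K \<inter> ?B) \<noteq> \<infinity>"
    using fin emeasure_mono[of "K \<inter> ?B" K lborel] by (auto simp: top_unique)
  have diff: "emeasure lborel (K - ?B) = emeasure lborel (?B - K)"
  proof -
    have "emeasure lborel (K - K \<inter> ?B) = emeasure lborel K - emeasure lborel (K \<inter> ?B)"
      by (rule emeasure_Diff[OF i]) auto
    moreover have "emeasure lborel (?B - K \<inter> ?B) = emeasure lborel ?B - emeasure lborel (K \<inter> ?B)"
      by (rule emeasure_Diff[OF i]) auto
    moreover have "K - K \<inter> ?B = K - ?B" "?B - K \<inter> ?B = ?B - K" by auto
    ultimately show ?thesis by (simp only: eq)
  qed
  have split: "(\<integral>\<^sup>+x. indicator X x * w x \<partial>lborel)
      = (\<integral>\<^sup>+x. indicator (X \<inter> Y) x * w x \<partial>lborel) + (\<integral>\<^sup>+x. indicator (X - Y) x * w x \<partial>lborel)"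
    if [measurable]: "X \<in> sets borel" "Y \<in> sets borel" for X Y
    by (subst nn_integral_add[symmetric]) (auto intro!: nn_integral_cong simp: indicator_def)
  have "(\<integral>\<^sup>+x. indicator (K - ?B) x * w x \<partial>lborel) \<le> (\<integral>\<^sup>+x. a * indicator (K - ?B) x \<partial>lborel)"
    by (intro nn_integral_mono) (auto simp: indicator_def a_def e intro!: anti)
  also have "\<dots> = a * emeasure lborel (K - ?B)" by (rule nn_integral_cmult_indicator) simp
  also have "\<dots> = a * emeasure lborel (?B - K)" by (simp only: diff)
  also have "\<dots> = (\<integral>\<^sup>+x. a * indicator (?B - K) x \<partial>lborel)" by (rule nn_integral_cmult_indicator[symmetric]) simp
  also have "\<dots> \<le> (\<integral>\<^sup>+x. indicator (?B - K) x * w x \<partial>lborel)"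
    by (intro nn_integral_mono) (auto simp: indicator_def a_def e intro!: anti)
  finally have "(\<integral>\<^sup>+x. indicator (K - ?B) x * w x \<partial>lborel) \<le> (\<integral>\<^sup>+x. indicator (?B - K) x * w x \<partial>lborel)" .
  then show ?thesis
    unfolding split[OF K, of ?B, simplified] split[of ?B K, OF _ K, simplified]
    by (simp add: Int_commute add_left_mono)
qed

text \<open>By Fubini the average over frames of the volume of \<open>K\<close> in the slab is the integral over \<open>K\<close>
  of the density of slabs, which the ball maximises. If every slab cut more from \<open>K\<close> than from the
  ball, the averages would be in the opposite order.\<close>

lemma ex_frame_slab_volume_le:
  fixes K :: "(real^'n) set"
  assumes K: "compact K" and \<rho>: "0 \<le> \<rho>" and eq: "measure lborel K = measure lborel (cball (0::real^'n) \<rho>)"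
    and e: "0 \<le> \<epsilon>"
  shows "\<exists>U\<in>frames. measure lborel (K \<inter> slab I \<epsilon> U) \<le> measure lborel (cball 0 \<rho> \<inter> slab I \<epsilon> U)"
proof (rule ccontr)
  assume contra: "\<not> ?thesis"
  let ?B = "cball (0::real^'n) \<rho>"
  define N where "N X = {(U, x). U \<in> frames \<and> x \<in> X \<and> x \<in> slab I \<epsilon> U}" for X :: "(real^'n) set"
  define w where "w x = emeasure lborel (slab_frames I \<epsilon> x)" for x :: "real^'n"
  have fin: "emeasure lborel X = ennreal (measure lborel X)" if "compact X" for X :: "'b::euclidean_space set"
    using emeasure_bounded_finite[OF compact_imp_bounded[OF that]] by (intro emeasure_eq_ennreal_measure) auto
  have N: "N X \<in> sets (borel \<Otimes>\<^sub>M borel)" if "compact X" for X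
  proof -
    have "N X = (frames \<times> X) \<inter> {(U, x). x \<in> slab I \<epsilon> U}" by (auto simp: N_def)
    also have "closed \<dots>"
      using compact_frames that by (intro closed_Int closed_slab_pairs closed_Times compact_imp_closed)
    finally show ?thesis unfolding borel_prod by (rule borel_closed)
  qed
  have inner1: "(\<integral>\<^sup>+U. indicator (N X) (U, x) \<partial>lborel) = indicator X x * w x" for X x
  proof -
    have "(\<integral>\<^sup>+U. indicator (N X) (U, x) \<partial>lborel) = (\<integral>\<^sup>+U. indicator X x * indicator (slab_frames I \<epsilon> x) U \<partial>lborel)"
      by (intro nn_integral_cong) (auto simp: indicator_def N_def slab_frames_def)
    also have "\<dots> = indicator X x * w x"
      unfolding w_def by (rule nn_integral_cmult_indicator) (simp add: slab_frames_borel)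
    finally show ?thesis .
  qed
  have inner2: "(\<integral>\<^sup>+x. indicator (N X) (U, x) \<partial>lborel) = indicator frames U * emeasure lborel (X \<inter> slab I \<epsilon> U)"
    if "compact X" for X U
  proof -
    have "(\<integral>\<^sup>+x. indicator (N X) (U, x) \<partial>lborel) = (\<integral>\<^sup>+x. indicator frames U * indicator (X \<inter> slab I \<epsilon> U) x \<partial>lborel)"
      by (intro nn_integral_cong) (auto simp: indicator_def N_def)
    also have "\<dots> = indicator frames U * emeasure lborel (X \<inter> slab I \<epsilon> U)"
      using compact_imp_borel_bounded(1)[OF compact_Int_closed[OF that closed_slab]]
      by (intro nn_integral_cmult_indicator) (simp only: sets_lborel)
    finally show ?thesis .
  qed
  have fubini: "(\<integral>\<^sup>+U. \<integral>\<^sup>+x. indicator (N X) (U, x) \<partial>lborel \<partial>lborel) = (\<integral>\<^sup>+x. indicator X x * w x \<partial>lborel)"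
    if X: "compact X" for X
  proof -
    have [measurable]: "N X \<in> sets (lborel \<Otimes>\<^sub>M lborel)" using N[OF X] by (simp cong: sets_pair_measure_cong)
    have "(\<integral>\<^sup>+x. \<integral>\<^sup>+U. indicator (N X) (U, x) \<partial>lborel \<partial>lborel) = (\<integral>\<^sup>+U. \<integral>\<^sup>+x. indicator (N X) (U, x) \<partial>lborel \<partial>lborel)"
      by (rule lborel_pair.Fubini') (simp add: case_prod_unfold)
    then show ?thesis by (simp add: inner1)
  qed
  have meas: "(\<lambda>U. \<integral>\<^sup>+x. indicator (N X) (U, x) \<partial>lborel) \<in> borel_measurable lborel" if X: "compact X" for X
  proof -
    have [measurable]: "N X \<in> sets (lborel \<Otimes>\<^sub>M lborel)" using N[OF X] by (simp cong: sets_pair_measure_cong)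
    show ?thesis by measurable
  qed
  have wm: "w \<in> borel_measurable borel"
  proof -
    have "slab_frames I \<epsilon> x = {U. (x, U) \<in> {p. snd p \<in> frames \<and> fst p \<in> slab I \<epsilon> (snd p)}}" for x
      by (auto simp: slab_frames_def)
    moreover have "{p. snd p \<in> frames \<and> fst p \<in> slab I \<epsilon> (snd p)} \<in> sets (lborel \<Otimes>\<^sub>M lborel)"
    proof -
      have "{p. snd p \<in> frames \<and> fst p \<in> slab I \<epsilon> (snd p)}
          = (UNIV \<times> frames) \<inter> (\<Inter>i\<in>I. {p. 0 \<le> snd p $ i \<bullet> fst p} \<inter> {p. snd p $ i \<bullet> fst p \<le> \<epsilon>})"
        by (auto simp: slab_def)
      also have "closed \<dots>"
        by (intro closed_INT ballI closed_Int closed_Collect_le continuous_intros closed_Times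
            compact_imp_closed[OF compact_frames] closed_UNIV)
      finally have "closed {p. snd p \<in> frames \<and> fst p \<in> slab I \<epsilon> (snd p)}" .
      then have "{p. snd p \<in> frames \<and> fst p \<in> slab I \<epsilon> (snd p)} \<in> sets (borel \<Otimes>\<^sub>M borel)"
        unfolding borel_prod by (rule borel_closed)
      then show ?thesis by (simp cong: sets_pair_measure_cong)
    qed
    ultimately show ?thesis
      using lborel.measurable_emeasure_Pair[of "{p. snd p \<in> frames \<and> fst p \<in> slab I \<epsilon> (snd p)}" lborel]
      by (simp add: w_def[abs_def] vimage_def)
  qed
  have anti: "w x \<le> w y" if "norm y \<le> norm x" for x y
    unfolding w_def by (rule emeasure_slab_frames_antimono[OF that e])
  have le: "(\<integral>\<^sup>+x. indicator K x * w x \<partial>lborel) \<le> (\<integral>\<^sup>+x. indicator ?B x * w x \<partial>lborel)"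
    by (rule nn_integral_radial_antimono_le_ball[OF wm anti])
      (use compact_imp_borel_bounded[OF K] fin[OF K] fin[of ?B] eq \<rho> in auto)
  have strict: "emeasure lborel (?B \<inter> slab I \<epsilon> U) < emeasure lborel (K \<inter> slab I \<epsilon> U)" if "U \<in> frames" for U
  proof -
    have c: "compact (?B \<inter> slab I \<epsilon> U)" "compact (K \<inter> slab I \<epsilon> U)"
      by (rule compact_Int_closed[OF compact_cball closed_slab], rule compact_Int_closed[OF K closed_slab])
    show ?thesis unfolding fin[OF c(1)] fin[OF c(2)]
      using contra that by (auto simp: ennreal_less_iff not_le)
  qed
  have "(\<integral>\<^sup>+U. \<integral>\<^sup>+x. indicator (N ?B) (U, x) \<partial>lborel \<partial>lborel)
      < (\<integral>\<^sup>+U. \<integral>\<^sup>+x. indicator (N K) (U, x) \<partial>lborel \<partial>lborel)"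
  proof (rule nn_integral_less[OF meas[OF compact_cball] meas[OF K]])
    have "(\<integral>\<^sup>+U. \<integral>\<^sup>+x. indicator (N ?B) (U, x) \<partial>lborel \<partial>lborel) \<le> (\<integral>\<^sup>+x. emeasure lborel (frames :: (real^'n^'n) set) * indicator ?B x \<partial>lborel)"
      unfolding fubini[OF compact_cball]
    proof (rule nn_integral_mono)
      fix x
      have "w x \<le> emeasure lborel (frames :: (real^'n^'n) set)"
        unfolding w_def using compact_imp_borel_bounded[OF compact_frames]
        by (intro emeasure_mono) (auto simp: slab_frames_def)
      then show "indicator ?B x * w x \<le> emeasure lborel (frames :: (real^'n^'n) set) * indicator ?B x"
        by (auto simp: indicator_def)
    qed
    also have "\<dots> = emeasure lborel (frames :: (real^'n^'n) set) * emeasure lborel ?B"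
      by (rule nn_integral_cmult_indicator) simp
    also have "\<dots> < \<infinity>"
      unfolding fin[OF compact_frames] fin[OF compact_cball] by (simp flip: ennreal_mult)
    finally show "(\<integral>\<^sup>+U. \<integral>\<^sup>+x. indicator (N ?B) (U, x) \<partial>lborel \<partial>lborel) \<noteq> \<infinity>" by simp
    show "AE U in lborel. (\<integral>\<^sup>+x. indicator (N ?B) (U, x) \<partial>lborel) \<le> (\<integral>\<^sup>+x. indicator (N K) (U, x) \<partial>lborel)"
      unfolding inner2[OF compact_cball] inner2[OF K]
      by (rule AE_I2) (use strict in \<open>auto simp: indicator_def intro: less_imp_le\<close>)
    show "\<not> (AE U in lborel. (\<integral>\<^sup>+x. indicator (N K) (U, x) \<partial>lborel) \<le> (\<integral>\<^sup>+x. indicator (N ?B) (U, x) \<partial>lborel))"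
    proof
      assume "AE U in lborel. (\<integral>\<^sup>+x. indicator (N K) (U, x) \<partial>lborel) \<le> (\<integral>\<^sup>+x. indicator (N ?B) (U, x) \<partial>lborel)"
      then have "AE U :: real^'n^'n in lborel. U \<notin> frames"
        unfolding inner2[OF compact_cball] inner2[OF K]
      proof eventually_elim
        case (elim U)
        then show ?case using strict[of U] by (auto simp: indicator_def not_le[symmetric])
      qed
      then have "emeasure lborel (frames :: (real^'n^'n) set) = 0"
        using compact_imp_borel_bounded[OF compact_frames] by (subst (asm) AE_iff_measurable[OF _ refl]) auto
      then show False using emeasure_frames_pos[where 'n='n] by simp
    qed
  qed
  then show False using le unfolding fubini[OF compact_cball] fubini[OF K] by simp
qed

text \<open>The factor \<open>1 - \<eta>\<close>, which comes from the thickness of the slab, avoids a passage to the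
  limit in the subspace.\<close>

theorem ex_section_volume_le:
  fixes K :: "(real^'n) set"
  assumes K: "compact K" "convex K" and r: "0 < r" "cball 0 r \<subseteq> K"
    and \<rho>: "0 \<le> \<rho>" "measure lborel K = measure lborel (cball (0::real^'n) \<rho>)"
    and \<eta>: "0 < \<eta>" "\<eta> < 1" and k: "1 \<le> k" "k \<le> CARD('n)"
  shows "\<exists>H\<in>grassmannian (CARD('n) - k).
    (1 - \<eta>) ^ (CARD('n) - k) * vol_in H (K \<inter> H) \<le> vol_in H (cball 0 \<rho> \<inter> H)"
proof -
  obtain I :: "'n set" where I: "card I = k"
    using obtain_subset_with_card_n[of k "UNIV :: 'n set"] k by auto
  define \<epsilon> where "\<epsilon> = \<eta> * r / (2 * real k)"
  have e: "0 < \<epsilon>" "2 * real (card I) * \<epsilon> \<le> \<eta> * r" using \<eta> r k by (auto simp: \<epsilon>_def I)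
  obtain U where U: "U \<in> frames" "measure lborel (K \<inter> slab I \<epsilon> U) \<le> measure lborel (cball 0 \<rho> \<inter> slab I \<epsilon> U)"
    using ex_frame_slab_volume_le[OF K(1) \<rho>] e by (meson less_imp_le)
  have "frame_kernel I U \<in> grassmannian (CARD('n) - k)"
    by (simp add: grassmannian_def subspace_frame_kernel dim_frame_kernel[OF U(1)] I)
  moreover have "(1 - \<eta>) ^ (CARD('n) - k) * vol_in (frame_kernel I U) (K \<inter> frame_kernel I U)
      \<le> vol_in (frame_kernel I U) (cball 0 \<rho> \<inter> frame_kernel I U)"
    using section_volume_le_of_slab_volume_le[OF K r U(1) \<eta> e U(2)] dim_frame_kernel[OF U(1), of I] I by simp
  ultimately show ?thesis by blast
qed

section \<open>Inradius and conclusion\<close>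

text \<open>The largest ball centred at \<open>x\<close> inside \<open>K\<close> has radius the distance from \<open>x\<close> to the
  complement, a continuous function on the compact set \<open>K\<close>.\<close>

lemma inradius_attained:
  fixes K :: "'a::euclidean_space set"
  assumes "convex_body K"
  shows "0 < inradius K" "\<exists>x\<in>K. cball x (inradius K) \<subseteq> K"
proof -
  have K: "compact K" "interior K \<noteq> {}" using assms by (auto simp: convex_body_def)
  obtain x0 r0 where x0: "0 < r0" "cball x0 r0 \<subseteq> K"
    using K(2) by (meson ex_in_conv mem_interior_cball)
  then have x0K: "x0 \<in> K" by auto
  have ne: "- K \<noteq> {}"
    using compact_imp_bounded[OF K(1)] not_bounded_UNIV by (metis Compl_UNIV_eq double_complement)
  have inball: "cball x r \<subseteq> K \<longleftrightarrow> r \<le> infdist x (- K)" if "0 < r" for x r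
  proof
    assume r: "cball x r \<subseteq> K"
    have "r \<le> dist x y" if "y \<in> - K" for y using r that by (metis ComplD mem_cball nle_le subsetD)
    then show "r \<le> infdist x (- K)" using ne by (auto simp: infdist_def intro!: cINF_greatest)
  next
    assume r: "r \<le> infdist x (- K)"
    have "ball x r \<subseteq> K"
    proof
      fix y assume "y \<in> ball x r"
      then have "dist x y < infdist x (- K)" using r by simp
      then show "y \<in> K" using infdist_le[of y "- K" x] by force
    qed
    then have "closure (ball x r) \<subseteq> K" using compact_imp_closed[OF K(1)] by (simp add: closure_minimal)
    then show "cball x r \<subseteq> K" using that by simp
  qed
  have "continuous_on K (\<lambda>x. infdist x (- K))" by (intro continuous_intros)
  then obtain x1 where x1: "x1 \<in> K" "\<And>x. x \<in> K \<Longrightarrow> infdist x (- K) \<le> infdist x1 (- K)"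
    using continuous_attains_sup[OF K(1)] x0K by blast
  have pos: "0 < infdist x1 (- K)" using x1(2)[OF x0K] inball[of r0 x0] x0 by simp
  have eq: "inradius K = infdist x1 (- K)"
    unfolding inradius_def
  proof (rule Greatest_equality)
    show "0 < infdist x1 (- K) \<and> (\<exists>x\<in>K. cball x (infdist x1 (- K)) \<subseteq> K)"
      using pos x1(1) inball[OF pos, of x1] by auto
    fix r assume "0 < r \<and> (\<exists>x\<in>K. cball x r \<subseteq> K)"
    then obtain x where "0 < r" "x \<in> K" "cball x r \<subseteq> K" by auto
    then show "r \<le> infdist x1 (- K)" using inball[of r x] x1(2)[of x] by auto
  qed
  show "0 < inradius K" unfolding eq by (rule pos)
  show "\<exists>x\<in>K. cball x (inradius K) \<subseteq> K" unfolding eq using x1(1) inball[OF pos, of x1] by auto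
qed

text \<open>Since \<open>K\<close> contains a ball of radius \<open>r\<close>, the body at distance \<open>t\<close> from \<open>K\<close> fits into a
  translate of \<open>(1 + t / r)\<close> times \<open>K\<close>.\<close>

lemma surface_area_le_of_inball:
  fixes K :: "'a::euclidean_space set"
  assumes K: "compact K" "convex K" and r: "0 < r" "x\<^sub>0 \<in> K" "cball x\<^sub>0 r \<subseteq> K"
  shows "surface_area_in UNIV K \<le> real DIM('a) / r * measure lborel K"
proof -
  let ?n = "DIM('a)" and ?v = "measure lborel K" and ?P = "outer_parallel UNIV K"
  have ne: "K \<noteq> {}" using r by auto
  have le: "(measure lborel (?P t) - ?v) / t \<le> ((1 + t / r) ^ ?n - 1) / t * ?v" if t: "0 < t" for t
  proof -
    let ?c = "1 + t / r"
    have c: "0 < ?c" using t r by (simp add: add_pos_pos)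
    let ?A = "(\<lambda>x. ?c *\<^sub>R x) ` K"
    have cA: "compact ?A" by (rule compact_scaling[OF K(1)])
    have "?P t \<subseteq> (+) (- ((t / r) *\<^sub>R x\<^sub>0)) ` ?A"
    proof
      fix y assume "y \<in> ?P t"
      then obtain x u where xu: "y = x + t *\<^sub>R u" "x \<in> K" "norm u \<le> 1" by (auto simp: outer_parallel_def)
      have "x\<^sub>0 + r *\<^sub>R u \<in> K" using xu r by (intro subsetD[OF r(3)]) (simp add: dist_norm)
      \<comment> \<open>\<open>x + t u + (t / r) x\<^sub>0 = x + (t / r) (x\<^sub>0 + r u)\<close> is \<open>?c\<close> times a convex combination\<close>
      then have "(1 / ?c) *\<^sub>R x + ((t / r) / ?c) *\<^sub>R (x\<^sub>0 + r *\<^sub>R u) \<in> K"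
        using xu(2) c t r
      proof (intro convexD[OF K(2)])
        show "1 / ?c + (t / r) / ?c = 1"
          unfolding add_divide_distrib[symmetric] using c by simp
      qed auto
      moreover have "y = - ((t / r) *\<^sub>R x\<^sub>0) + ?c *\<^sub>R ((1 / ?c) *\<^sub>R x + ((t / r) / ?c) *\<^sub>R (x\<^sub>0 + r *\<^sub>R u))"
      proof -
        have "?c *\<^sub>R ((1 / ?c) *\<^sub>R x + ((t / r) / ?c) *\<^sub>R (x\<^sub>0 + r *\<^sub>R u)) = x + (t / r) *\<^sub>R (x\<^sub>0 + r *\<^sub>R u)"
          using c by (simp only: scaleR_add_right scaleR_scaleR) simp
        then show ?thesis using r by (simp add: xu(1) scaleR_add_right)
      qed
      ultimately show "y \<in> (+) (- ((t / r) *\<^sub>R x\<^sub>0)) ` ?A" by blast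
    qed
    moreover have cT: "compact ((+) (- ((t / r) *\<^sub>R x\<^sub>0)) ` ?A)" by (rule compact_translation[OF cA])
    ultimately have "vol_in UNIV (?P t) \<le> vol_in UNIV ((+) (- ((t / r) *\<^sub>R x\<^sub>0)) ` ?A)"
      by (intro vol_in_mono[OF subspace_UNIV] compact_imp_borel_bounded
          compact_outer_parallel[OF subspace_UNIV K(1)])
    also have "\<dots> = measure lebesgue ((+) (- ((t / r) *\<^sub>R x\<^sub>0)) ` ?A)"
      using compact_imp_borel_bounded(1)[OF cT] by (simp add: subspace_lborel_UNIV measure_completion)
    also have "\<dots> = measure lebesgue ?A" by (rule measure_translation)
    also have "\<dots> = vol_in UNIV ?A"
      using compact_imp_borel_bounded(1)[OF cA] by (simp add: subspace_lborel_UNIV measure_completion)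
    also have "\<dots> = ?c ^ ?n * ?v"
      using vol_in_scale[OF subspace_UNIV compact_imp_borel_bounded(1)[OF K(1)] c]
      by (simp add: subspace_lborel_UNIV dim_UNIV)
    finally have "measure lborel (?P t) - ?v \<le> (?c ^ ?n - 1) * ?v"
      by (simp add: subspace_lborel_UNIV algebra_simps)
    then have "(measure lborel (?P t) - ?v) / t \<le> ((?c ^ ?n - 1) * ?v) / t"
      using t by (intro divide_right_mono) auto
    then show ?thesis by simp
  qed
  have lim: "((\<lambda>t. ((1 + t / r) ^ ?n - 1) / t * ?v) \<longlongrightarrow> real ?n / r * ?v) (at_right 0)"
  proof (intro tendsto_mult tendsto_const)
    have "((\<lambda>t. (1 + t / r) ^ ?n) has_field_derivative real ?n / r) (at 0)"
      using r(1) by (auto intro!: derivative_eq_intros)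
    then have "((\<lambda>t. ((1 + t / r) ^ ?n - 1) / t) \<longlongrightarrow> real ?n / r) (at 0)"
      by (simp add: has_field_derivative_iff)
    then show "((\<lambda>t. ((1 + t / r) ^ ?n - 1) / t) \<longlongrightarrow> real ?n / r) (at_right 0)"
      by (rule tendsto_within_subset) simp
  qed
  have "((\<lambda>t. (measure lborel (?P t) - ?v) / t) \<longlongrightarrow> surface_area_in UNIV K) (at_right 0)"
    using surface_area_in_tendsto[OF subspace_UNIV K ne] by (simp add: subspace_lborel_UNIV)
  moreover have "eventually (\<lambda>t. (measure lborel (?P t) - ?v) / t
      \<le> ((1 + t / r) ^ ?n - 1) / t * ?v) (at_right 0)"
    using eventually_at_right_less[of "0::real"] by eventually_elim (rule le)
  ultimately show ?thesis by (rule tendsto_le[OF trivial_limit_at_right_real lim])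
qed

text \<open>If the section is small compared with a ball of radius \<open>\<rho>\<close>, then the ball of its own volume has radius at
  most \<open>\<rho> / c\<close>, and the isoperimetric inequality applies to that ball.\<close>

lemma surface_volume_ratio_ge:
  fixes H :: "'a::euclidean_space set"
  assumes H: "subspace H" "1 \<le> dim H" and A: "compact A" "convex A" "A \<subseteq> H" and pos: "0 < vol_in H A"
    and c: "0 \<le> c" "0 < \<rho>" and le: "c ^ dim H * vol_in H A \<le> vol_in H (cball 0 \<rho> \<inter> H)"
  shows "c * (real (dim H) / \<rho>) \<le> surface_area_in H A / vol_in H A"
proof -
  let ?m = "dim H" and ?v = "vol_in H A"
  define \<beta> where "\<beta> = vol_in H (cball 0 1 \<inter> H)"
  note cb = compact_imp_borel_bounded[OF compact_cball_subspace[OF H(1)]]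
  have \<beta>: "0 < \<beta>" unfolding \<beta>_def by (rule vol_in_pos[OF H(1) cb(2,1), of 1]) auto
  have ball: "vol_in H (cball 0 s \<inter> H) = s ^ ?m * \<beta>" if s: "0 < s" for s
  proof -
    have "(\<lambda>x. s *\<^sub>R x) ` (cball 0 1 \<inter> H) = cball 0 s \<inter> H"
    proof
      show "(\<lambda>x. s *\<^sub>R x) ` (cball 0 1 \<inter> H) \<subseteq> cball 0 s \<inter> H"
        using s H(1) by (auto simp: mult_left_le intro: subspace_scale)
      show "cball 0 s \<inter> H \<subseteq> (\<lambda>x. s *\<^sub>R x) ` (cball 0 1 \<inter> H)"
      proof
        fix x assume x: "x \<in> cball 0 s \<inter> H"
        have "x = s *\<^sub>R ((1/s) *\<^sub>R x)" "(1/s) *\<^sub>R x \<in> cball 0 1 \<inter> H"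
          using x s H(1) by (auto simp: divide_simps intro: subspace_scale)
        then show "x \<in> (\<lambda>x. s *\<^sub>R x) ` (cball 0 1 \<inter> H)" by blast
      qed
    qed
    then show ?thesis using vol_in_scale[OF H(1) cb(1)[of 0 1] s] by (simp add: \<beta>_def)
  qed
  define R where "R = root ?m (?v / \<beta>)"
  have m: "0 < ?m" using H(2) by simp
  have R: "0 < R" "R ^ ?m = ?v / \<beta>" using pos \<beta> m by (auto simp: R_def)
  have "vol_in H (cball 0 R \<inter> H) = ?v" using ball[OF R(1)] R(2) \<beta> by simp
  then have "real ?m * ?v / R \<le> surface_area_in H A"
    by (intro isoperimetric_inequality[OF H(1) A R(1) _ pos])
  then have 1: "real ?m / R \<le> surface_area_in H A / ?v" using pos by (simp add: field_simps)
  have "c ^ ?m * (R ^ ?m * \<beta>) \<le> \<rho> ^ ?m * \<beta>" using le ball[OF c(2)] R(2) \<beta> by simp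
  then have "(c * R) ^ ?m \<le> \<rho> ^ ?m" using \<beta> by (simp add: power_mult_distrib mult.assoc[symmetric])
  then have "c * R \<le> \<rho>" using power_mono_iff[of "c * R" \<rho> ?m] c R m by simp
  then have "(c * R) * real ?m \<le> \<rho> * real ?m" by (rule mult_right_mono) simp
  then have "c * (real ?m / \<rho>) \<le> real ?m / R"
    using c R by (simp add: field_simps)
  with 1 show ?thesis by linarith
qed

lemma inradius_volume_ratio_eq:
  fixes K :: "'a::euclidean_space set"
  assumes r: "0 < inradius K" and \<rho>: "0 < \<rho>" "measure lborel K = measure lborel (cball (0::'a) \<rho>)"
  shows "inradius_volume_ratio K = \<rho> / inradius K"
proof -
  have "0 < unit_ball_vol (real DIM('a))" by (rule unit_ball_vol_pos) simp
  then have "unit_ball_vol (real DIM('a)) \<noteq> 0" by (rule less_imp_neq[symmetric])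
  then have "measure lborel K / measure lborel (cball (0::'a) (inradius K)) = (\<rho> / inradius K) ^ DIM('a)"
    using r \<rho> by (simp add: content_cball power_divide)
  then show ?thesis using r \<rho> by (simp add: inradius_volume_ratio_def real_root_power_cancel)
qed

lemma ex_cball_same_volume:
  assumes "0 < v"
  shows "\<exists>\<rho>>0. measure lborel (cball (0::'a::euclidean_space) \<rho>) = v"
proof -
  let ?w = "unit_ball_vol (real DIM('a))"
  let ?\<rho> = "root DIM('a) (v / ?w)"
  have w: "0 < ?w" by (rule unit_ball_vol_pos) simp
  have "0 < ?\<rho>" "?\<rho> ^ DIM('a) = v / ?w" using assms w by (auto simp: real_root_pow_pos2)
  then show ?thesis
    using less_imp_neq[OF w, symmetric] by (intro exI[of _ ?\<rho>]) (simp add: content_cball)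
qed

theorem theorem1p4:
  fixes K :: "(real ^ 'n) set" and k :: nat
  assumes "convex_body K" and "0 \<in> interior K"
    and "1 \<le> k" and "k \<le> CARD('n) - 1"
  shows "\<exists>H\<^sub>0 \<in> grassmannian (CARD('n) - k).
    (\<forall>H \<in> grassmannian (CARD('n) - k).
      surface_area_in H (K \<inter> H) / vol_in H (K \<inter> H)
        \<le> surface_area_in H\<^sub>0 (K \<inter> H\<^sub>0) / vol_in H\<^sub>0 (K \<inter> H\<^sub>0)) \<and>
    surface_area_in UNIV K / measure lborel K
      \<le> real CARD('n) / real (CARD('n) - k) * inradius_volume_ratio K
         * (surface_area_in H\<^sub>0 (K \<inter> H\<^sub>0) / vol_in H\<^sub>0 (K \<inter> H\<^sub>0))"
proof -
  let ?n = "CARD('n)" and ?m = "CARD('n) - k"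
  let ?\<phi> = "\<lambda>H. surface_area_in H (K \<inter> H) / vol_in H (K \<inter> H)"
  have K: "compact K" "convex K" using assms(1) by (auto simp: convex_body_def)
  obtain r where r: "0 < r" "cball 0 r \<subseteq> K" using assms(2) by (meson mem_interior_cball)
  obtain H\<^sub>0 where H\<^sub>0: "H\<^sub>0 \<in> grassmannian ?m" "\<And>H. H \<in> grassmannian ?m \<Longrightarrow> ?\<phi> H \<le> ?\<phi> H\<^sub>0"
    using section_surface_ratio_attains_max[OF K r, of ?m] by auto
  let ?r = "inradius K"
  obtain x\<^sub>0 where x\<^sub>0: "x\<^sub>0 \<in> K" "cball x\<^sub>0 ?r \<subseteq> K" "0 < ?r" using inradius_attained[OF assms(1)] by auto
  have vK: "0 < measure lborel K"
    using vol_in_pos[OF subspace_UNIV compact_imp_borel_bounded(2,1)[OF K(1)] r(1)] r(2)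
    by (simp add: subspace_lborel_UNIV)
  obtain \<rho> where \<rho>: "0 < \<rho>" "measure lborel K = measure lborel (cball (0::real^'n) \<rho>)"
    using ex_cball_same_volume[OF vK, where 'a="real^'n"] by metis
  have m: "1 \<le> ?m" "0 < ?m" "k \<le> ?n" using assms(3,4) by auto
  have "real ?m / \<rho> \<le> ?\<phi> H\<^sub>0"
  proof (rule field_le_mult_one_interval)
    fix c :: real assume c: "0 < c" "c < 1"
    obtain H where H: "H \<in> grassmannian ?m" "c ^ ?m * vol_in H (K \<inter> H) \<le> vol_in H (cball 0 \<rho> \<inter> H)"
      using ex_section_volume_le[OF K r less_imp_le[OF \<rho>(1)] \<rho>(2), of "1 - c" k] c assms(3) m by auto
    have sub: "subspace H" and dim: "dim H = ?m" using H(1) by (auto simp: grassmannian_def)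
    have A: "compact (K \<inter> H)" "convex (K \<inter> H)"
      using K sub by (auto intro: compact_Int_closed closed_subspace convex_Int subspace_imp_convex)
    have pos: "0 < vol_in H (K \<inter> H)"
      using vol_in_pos[OF sub compact_imp_borel_bounded(2,1)[OF A(1)] r(1)] r(2) by auto
    have "c * (real ?m / \<rho>) \<le> ?\<phi> H"
      using surface_volume_ratio_ge[OF sub _ A Int_lower2 pos less_imp_le[OF c(1)] \<rho>(1)] H(2) m(1)
      unfolding dim by simp
    also have "\<dots> \<le> ?\<phi> H\<^sub>0" by (rule H\<^sub>0(2)[OF H(1)])
    finally show "c * (real ?m / \<rho>) \<le> ?\<phi> H\<^sub>0" .
  qed
  then have max_ge: "real ?n / real ?m * (\<rho> / ?r) * (real ?m / \<rho>) \<le> real ?n / real ?m * (\<rho> / ?r) * ?\<phi> H\<^sub>0"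
    using \<rho>(1) x\<^sub>0(3) by (intro mult_left_mono) auto
  have "surface_area_in UNIV K / measure lborel K \<le> real ?n / ?r"
    using surface_area_le_of_inball[OF K x\<^sub>0(3,1,2)] vK by (simp add: divide_le_eq)
  also have "\<dots> = real ?n / real ?m * (\<rho> / ?r) * (real ?m / \<rho>)"
    using \<rho>(1) m by (simp del: of_nat_diff)
  also note max_ge
  also have "\<rho> / ?r = inradius_volume_ratio K"
    by (rule inradius_volume_ratio_eq[OF x\<^sub>0(3) \<rho>, symmetric])
  finally have "surface_area_in UNIV K / measure lborel K
      \<le> real ?n / real ?m * inradius_volume_ratio K * ?\<phi> H\<^sub>0" .
  then show ?thesis using H\<^sub>0 by blast
qed

end
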